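(* Let $d\ge 1$ and $m>0$. There exists a successful coupling for the symmetric inclusion process SIP($m$) on $\mathbb Z^d$. That is, for every $n\in\mathbb N$, $n\ge 1$, and all $\mathbf x=(x_1,\dots,x_n),\ \mathbf y=(y_1,\dots,y_n)\in(\mathbb Z^d)^n$, there exists a coupling $\{(\mathbf X^S(t),\mathbf Y^S(t)):t\ge 0\}$ of the $n$-particle SIP($m$) started from $\mathbf x$ and the $n$-particle SIP($m$) started from $\mathbf y$, with path space measure $\widehat{\mathbb P}^{SIP}_{\mathbf x,\mathbf y}$, such that the coupling time $$\tau=\inf\{t\ge 0:\ \mathbf X^S(s)=\mathbf Y^S(s)\ \ \forall s\ge t\}\qquad(\inf\emptyset=\infty)$$ satisfies $\widehat{\mathbb P}^{SIP}_{\mathbf x,\mathbf y}(\tau<\infty)=1$.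
   Context: Let $p(x,y)=\frac1{2d}$ if $\|x-y\|=1$ ($\ell_1$-norm on $\mathbb Z^d$) and $p(x,y)=0$ otherwise. The symmetric inclusion process SIP($m$) with parameter $m>0$ is the continuous-time Markov process on particle configurations $\eta\in\mathbb N^{\mathbb Z^d}$ ($\mathbb N=\{0,1,2,\dots\}$) with generator $$\mathcal L f(\eta)=\sum_{x\in\mathbb Z^d}\sum_{y:\|y-x\|=1}p(x,y)\,\eta(x)\Big(\frac m2+\eta(y)\Big)\big(f(\eta^{x,y})-f(\eta)\big),\qquad \eta^{x,y}=\eta-\delta_x+\delta_y,$$ where $\delta_x$ is the configuration with a single particle at $x$. The $n$-particle SIP started from $\mathbf x=(x_1,\dots,x_n)\in(\mathbb Z^d)^n$ is the labelled version $\mathbf X^S(t)=(X^S_1(t),\dots,X^S_n(t))$ of this process, where $X_i^S(t)$ keeps track of the location of the particle started at $x_i$: it is the continuous-time Markov chain on $(\mathbb Z^d)^n$ in which, when the current state is $(z_1,\dots,z_n)$, the coordinate $z_i$ jumps to $y$ at rate $p(z_i,y)\big(\frac m2+\#\{j: z_j=y\}\big)$. The configuration $\sum_{i=1}^n\delta_{X_i^S(t)}$ then evolves as the SIP($m$) with generator $\mathcal L$. A coupling of the SIP started from $\mathbf x$ and the SIP started from $\mathbf y$ is a process $\{(\mathbf X^S(t),\mathbf Y^S(t)):t\ge0\}$ on $(\mathbb Z^d)^n\times(\mathbb Z^d)^n$, defined on one probability space, with $\mathbf X^S(0)=\mathbf x$, $\mathbf Y^S(0)=\mathbf y$, whose first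 marginal process is the $n$-particle SIP started from $\mathbf x$ and whose second marginal process is the $n$-particle SIP started from $\mathbf y$. *)

theory Defs
  imports "HOL-Probability.Probability"
begin

text \<open>
  The rates \<open>q x y\<close> are only used for \<open>x \<noteq> y\<close>; the diagonal of the Q-matrix
  is minus the total jump rate.
\<close>

definition Q_matrix :: "('s \<Rightarrow> 's \<Rightarrow> real) \<Rightarrow> 's \<Rightarrow> 's \<Rightarrow> real" where
  "Q_matrix q x y = (if x = y then - (\<Sum>\<^sub>\<infinity>z\<in>UNIV - {x}. q x z) else q x y)"

text \<open>
  \<open>P t x\<close> is the law at time \<open>t\<close> of the chain started in \<open>x\<close>.  When the total jump
  rates \<open>- Q_matrix q x x\<close> are bounded in \<open>x\<close>, as for the inclusion process with a
  fixed number of particles, the derivatives at time \<open>0\<close> determine \<open>P\<close> for all \<open>t \<ge> 0\<close>.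
  (For unbounded rates this need not be so, and explosion would have to be considered.)
\<close>

definition transition_semigroup :: "('s \<Rightarrow> 's \<Rightarrow> real) \<Rightarrow> (real \<Rightarrow> 's \<Rightarrow> 's pmf) \<Rightarrow> bool" where
  "transition_semigroup q P \<longleftrightarrow>
     (\<forall>x. P 0 x = return_pmf x) \<and>
     (\<forall>s\<ge>0. \<forall>t\<ge>0. \<forall>x. P (s + t) x = bind_pmf (P s x) (P t)) \<and>
     (\<forall>x y. ((\<lambda>t. pmf (P t x) y) has_real_derivative Q_matrix q x y) (at_right 0))"

text \<open>Right-continuous with left limits, for the discrete topology on the state space.\<close>

definition cadlag_path :: "(real \<Rightarrow> 's) \<Rightarrow> bool" where
  "cadlag_path w \<longleftrightarrow>
     (\<forall>t\<ge>0. \<forall>\<^sub>F s in at_right t. w s = w t) \<and>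
     (\<forall>t>0. \<exists>z. \<forall>\<^sub>F s in at_left t. w s = z)"

text \<open>
  A process \<open>X\<close> on the probability space \<open>M\<close> is indexed by \<open>real\<close>, but only times \<open>t \<ge> 0\<close>
  matter.  The last conjunct is the Markov property with transition laws \<open>P\<close>, multiplied out:
  given \<open>X (t i) = z i\<close> for all \<open>i \<le> k\<close>, the law of \<open>X (t (Suc k))\<close> is
  \<open>P (t (Suc k) - t k) (z k)\<close>.
\<close>

definition markov_chain_from ::
    "('s \<Rightarrow> 's \<Rightarrow> real) \<Rightarrow> 's \<Rightarrow> 'w measure \<Rightarrow> (real \<Rightarrow> 'w \<Rightarrow> 's) \<Rightarrow> bool" where
  "markov_chain_from q x M X \<longleftrightarrow>
     prob_space M \<and>
     (\<forall>t\<ge>0. X t \<in> measurable M (count_space UNIV)) \<and>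
     (\<forall>\<omega>\<in>space M. X 0 \<omega> = x \<and> cadlag_path (\<lambda>t. X t \<omega>)) \<and>
     (\<exists>P. transition_semigroup q P \<and>
        (\<forall>k (t :: nat \<Rightarrow> real) z. 0 \<le> t 0 \<and> (\<forall>i\<le>k. t i \<le> t (Suc i)) \<longrightarrow>
           measure M {\<omega> \<in> space M. \<forall>i\<le>Suc k. X (t i) \<omega> = z i} =
           measure M {\<omega> \<in> space M. \<forall>i\<le>k. X (t i) \<omega> = z i} *
             pmf (P (t (Suc k) - t k) (z k)) (z (Suc k))))"

text \<open>
  The lattice \<open>\<int>\<^sup>d\<close> is \<open>int ^ 'd\<close> with \<open>d = CARD('d)\<close>, and states of \<open>n\<close> labelled particles
  are elements of \<open>int ^ 'd ^ 'n\<close> with \<open>n = CARD('n)\<close>.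
\<close>

definition l1_norm :: "int ^ 'd \<Rightarrow> int" where
  "l1_norm x = (\<Sum>i\<in>UNIV. \<bar>x $ i\<bar>)"

definition nn_kernel :: "int ^ 'd \<Rightarrow> int ^ 'd \<Rightarrow> real" where
  "nn_kernel x y = (if l1_norm (x - y) = 1 then 1 / (2 * real CARD('d)) else 0)"

definition particle_jump_rate :: "real \<Rightarrow> int ^ 'd ^ 'n \<Rightarrow> 'n \<Rightarrow> int ^ 'd \<Rightarrow> real" where
  "particle_jump_rate m z i y = nn_kernel (z $ i) y * (m / 2 + real (card {j. z $ j = y}))"

definition move_particle :: "int ^ 'd ^ 'n \<Rightarrow> 'n \<Rightarrow> int ^ 'd \<Rightarrow> int ^ 'd ^ 'n" where
  "move_particle z i y = (\<chi> j. if j = i then y else z $ j)"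

text \<open>
  A jump of particle \<open>i\<close> from \<open>z\<close> to \<open>z'\<close> can only be the jump to the site \<open>z' $ i\<close>.
\<close>

definition sip_rate :: "real \<Rightarrow> int ^ 'd ^ 'n \<Rightarrow> int ^ 'd ^ 'n \<Rightarrow> real" where
  "sip_rate m z z' =
     (\<Sum>i | z' = move_particle z i (z' $ i). particle_jump_rate m z i (z' $ i))"

definition sip_coupling ::
    "real \<Rightarrow> int ^ 'd ^ 'n \<Rightarrow> int ^ 'd ^ 'n \<Rightarrow> 'w measure \<Rightarrow>
     (real \<Rightarrow> 'w \<Rightarrow> int ^ 'd ^ 'n) \<Rightarrow> (real \<Rightarrow> 'w \<Rightarrow> int ^ 'd ^ 'n) \<Rightarrow> bool" where
  "sip_coupling m x y M X Y \<longleftrightarrow>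
     markov_chain_from (sip_rate m) x M X \<and> markov_chain_from (sip_rate m) y M Y"

definition coupling_time :: "(real \<Rightarrow> 'w \<Rightarrow> 's) \<Rightarrow> (real \<Rightarrow> 'w \<Rightarrow> 's) \<Rightarrow> 'w \<Rightarrow> ereal" where
  "coupling_time X Y \<omega> = (INF t\<in>{t. 0 \<le> t \<and> (\<forall>s\<ge>t. X s \<omega> = Y s \<omega>)}. ereal t)"

end

theory Submission imports Defs "HOL-Complex_Analysis.Great_Picard"
begin

text \<open>
  The total jump rates are bounded, so the process is a discrete chain run by a Poisson clock,
  and it suffices to couple the discrete skeletons.  The labelled skeleton is a lazy walk on the
  lattice of dimension \<open>N = n d\<close> that is reversible and uniformly elliptic, with a weight bounded
  above and below.  Its second moment grows at most linearly, since the attraction of particle \<open>i\<close> to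
  \<open>j\<close> and that of \<open>j\<close> to \<open>i\<close> cancel up to a negative term.  A Nash inequality
  bounds the \<open>\<ell>\<^sup>2\<close> norm of the heat kernel, hence the walk at time \<open>R\<^sup>2\<close> is
  spread over a positive fraction of a box of side of order \<open>R\<close>.  If a bounded harmonic function with
  supremum 1 and infimum 0 were not constant, then both \<open>{h \<ge> 1/2}\<close> and \<open>{h \<le> \<eta>}\<close> would fill
  a fixed fraction of such a box, however small \<open>\<eta>\<close> is; by the Poincare inequality this
  contradicts the bound on the energy of \<open>ln (h + \<eta>)\<close> given by the Caccioppoli inequality.  So
  bounded harmonic functions are constant.  Laziness and compactness turn this into convergence to
  0 of the total variation distance between the laws from any two starting points, and repeated
  attempts, each successful with probability at least 1/2, couple the two skeletons.  Running both
  skeletons by the same clock gives the coupling in continuous time.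
\<close>

section \<open>Poincare and Nash inequalities on the lattice\<close>

text \<open>The particles attract each other and are not independent walks that could be matched
  coordinate by coordinate; hence the detour through harmonic functions of the whole system. The
  logarithm is the point of the Liouville argument: it turns the ratio of 1/2 and
  \<open>\<eta>\<close> into a gap that tends to infinity as \<open>\<eta>\<close> tends to 0, while
  the energy bound is free of \<open>\<eta>\<close>. The heat kernel bound is uniform in the
  starting point, so two distant starting points only require a larger \<open>R\<close>. The
  Liouville property by itself says nothing about laws at a fixed time. Laziness makes the kernel
  the average of the identity and a contraction, so one more step changes the \<open>2 n\<close>-th
  iterate of a bounded function by at most a multiple of \<open>1 / sqrt n\<close>; limits of such
  iterates are harmonic. Coupling the laws at one time would leave the marginal processes
  undetermined. So coupled end points are joined by conditioned paths, in blocks whose deterministic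
  lengths carry no information about the other copy.\<close>

definition cube :: "('c::finite \<Rightarrow> int) \<Rightarrow> nat \<Rightarrow> ('c \<Rightarrow> int) set" where
  "cube lo r = {z. \<forall>c. lo c \<le> z c \<and> z c < lo c + int r}"

lemma cube_eq_PiE: "cube lo r = PiE UNIV (\<lambda>c. {lo c..<lo c + int r})"
  by (auto simp: cube_def PiE_def Pi_def)

lemma finite_cube [simp]: "finite (cube lo r)"
  unfolding cube_eq_PiE by (intro finite_PiE) auto

lemma card_cube: "card (cube (lo :: 'c::finite \<Rightarrow> int) r) = r ^ CARD('c)"
  unfolding cube_eq_PiE by (subst card_PiE) auto

text \<open>Cauchy-Schwarz on the telescoping sum from \<open>a\<close> to \<open>b\<close>: the
  segment has at most \<open>r\<close> edges, all among those of the interval.\<close>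

lemma int_path_square_le:
  fixes g :: "int \<Rightarrow> real"
  assumes "a \<in> {lo..<lo + int r}" "b \<in> {lo..<lo + int r}"
  shows "(g b - g a)\<^sup>2 \<le> real r * (\<Sum>e\<in>{lo..<lo + int r - 1}. (g (e + 1) - g e)\<^sup>2)"
proof -
  have *: "(g b - g a)\<^sup>2 \<le> real r * (\<Sum>e\<in>{lo..<lo + int r - 1}. (g (e + 1) - g e)\<^sup>2)"
    if "a \<in> {lo..<lo + int r}" "b \<in> {lo..<lo + int r}" "a \<le> b" for a b
  proof -
    have tele: "g b - g a = (\<Sum>e\<in>{a..<b}. g (e + 1) - g e)"
      using \<open>a \<le> b\<close>
    proof (induction b rule: int_ge_induct)
      case (step i)
      have "{a..<i + 1} = insert i {a..<i}" using step.hyps by auto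
      then show ?case using step.IH by simp
    qed simp
    have "(g b - g a)\<^sup>2 \<le> (\<Sum>e\<in>{a..<b}. (g (e + 1) - g e)\<^sup>2) * real (card {a..<b})"
      unfolding tele by (rule sum_squared_le_sum_of_squares)
    also have "\<dots> \<le> (\<Sum>e\<in>{lo..<lo + int r - 1}. (g (e + 1) - g e)\<^sup>2) * real r"
      using that by (intro mult_mono sum_mono2 sum_nonneg) auto
    finally show ?thesis by (simp add: mult.commute)
  qed
  show ?thesis
    using *[of a b] *[of b a] assms by (cases "a \<le> b") (auto simp: power2_commute)
qed

text \<open>Each edge is counted once, at its lower end, whereas \<open>energy\<close> below runs
  over oriented edges.\<close>

definition cube_energy :: "('c::finite \<Rightarrow> int) \<Rightarrow> nat \<Rightarrow> (('c \<Rightarrow> int) \<Rightarrow> real) \<Rightarrow> 'c \<Rightarrow> real" where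
  "cube_energy lo r f c =
     (\<Sum>u | u \<in> cube lo r \<and> u(c := u c + 1) \<in> cube lo r. (f (u(c := u c + 1)) - f u)\<^sup>2)"

lemma cube_energy_nonneg: "0 \<le> cube_energy lo r f c"
  unfolding cube_energy_def by (intro sum_nonneg) auto

text \<open>On the line through \<open>u\<close> in direction \<open>c\<close>,
  \<open>int_path_square_le\<close> costs a factor \<open>r\<close>. Every edge is then used by
  \<open>r\<close> base points \<open>u\<close> of its line and by all \<open>r ^ N\<close> choices
  of \<open>u'\<close>, with N the dimension; hence the exponent N + 2.\<close>

lemma sum_resample_coordinate_le:
  fixes f :: "('c::finite \<Rightarrow> int) \<Rightarrow> real"
  shows "(\<Sum>u\<in>cube lo r. \<Sum>u'\<in>cube lo r. (f (u(c := u' c)) - f u)\<^sup>2)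
          \<le> real r ^ (CARD('c) + 2) * cube_energy lo r f c"
proof -
  let ?Q = "cube lo r" and ?J = "{lo c..<lo c + int r - 1}" and ?I = "{lo c..<lo c + int r}"
  define \<psi> where "\<psi> v = (f (v(c := v c + 1)) - f v)\<^sup>2" for v
  let ?E = "{u. u \<in> ?Q \<and> u(c := u c + 1) \<in> ?Q}"
  have fE: "finite ?E" by (rule finite_subset[of _ ?Q]) auto
  have H: "(\<Sum>u\<in>?Q. \<Sum>e\<in>?J. \<psi> (u(c := e))) \<le> real r * sum \<psi> ?E"
  proof -
    \<comment> \<open>Exchanging \<open>u c\<close> with the edge position \<open>e\<close> loses
      nothing, so \<open>?m\<close> is injective; its second component has only \<open>r\<close>
      values, so each edge is met at most \<open>r\<close> times.\<close>
    let ?m = "\<lambda>(u, e). (u(c := e), u c)"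
    have inj: "inj_on ?m (?Q \<times> ?J)"
    proof (rule inj_onI, clarsimp)
      fix u e u' e'
      assume a: "u(c := e) = u'(c := e')" "u c = u' c"
      have "u x = u' x" for x using fun_cong[OF a(1), of x] a(2) by (cases "x = c") auto
      then show "u = u' \<and> e = e'" using fun_cong[OF a(1), of c] by auto
    qed
    have "(\<Sum>u\<in>?Q. \<Sum>e\<in>?J. \<psi> (u(c := e))) = (\<Sum>p\<in>?Q \<times> ?J. \<psi> (fst (?m p)))"
      by (simp add: sum.cartesian_product split_def)
    also have "\<dots> = (\<Sum>p\<in>?m ` (?Q \<times> ?J). \<psi> (fst p))"
      by (simp add: sum.reindex[OF inj])
    also have "\<dots> \<le> (\<Sum>p\<in>?E \<times> ?I. \<psi> (fst p))"
      using fE by (intro sum_mono2) (auto simp: cube_def \<psi>_def)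
    also have "\<dots> = (\<Sum>v\<in>?E. \<Sum>a\<in>?I. \<psi> v)"
      unfolding sum.cartesian_product by (simp add: split_def)
    also have "\<dots> = real r * sum \<psi> ?E"
      by (simp add: sum_distrib_left)
    finally show ?thesis .
  qed
  have "(\<Sum>u\<in>?Q. \<Sum>u'\<in>?Q. (f (u(c := u' c)) - f u)\<^sup>2)
        \<le> (\<Sum>u\<in>?Q. \<Sum>u'\<in>?Q. real r * (\<Sum>e\<in>?J. \<psi> (u(c := e))))"
  proof (intro sum_mono)
    fix u u' assume "u \<in> ?Q" "u' \<in> ?Q"
    then show "(f (u(c := u' c)) - f u)\<^sup>2 \<le> real r * (\<Sum>e\<in>?J. \<psi> (u(c := e)))"
      using int_path_square_le[of "u c" "lo c" r "u' c" "\<lambda>a. f (u(c := a))"]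
      by (auto simp: cube_def \<psi>_def)
  qed
  also have "\<dots> = real r ^ CARD('c) * real r * (\<Sum>u\<in>?Q. \<Sum>e\<in>?J. \<psi> (u(c := e)))"
    by (simp add: card_cube sum_distrib_left mult.assoc)
  also have "\<dots> \<le> real r ^ CARD('c) * real r * (real r * sum \<psi> ?E)"
    by (intro mult_left_mono H) auto
  finally show ?thesis
    by (simp add: cube_energy_def \<psi>_def power_add power2_eq_square mult_ac)
qed

text \<open>The coordinates of \<open>z\<close> are replaced by those of \<open>z'\<close> one at a
  time. Each replacement resamples one coordinate, and each use of \<open>(a - c)\<^sup>2 \<le> 2 *
  (a - b)\<^sup>2 + 2 * (b - c)\<^sup>2\<close> doubles the constant, which gives
  \<open>2 ^ CARD('c)\<close>.\<close>

lemma poincare_cube: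
  fixes f :: "('c::finite \<Rightarrow> int) \<Rightarrow> real"
  shows "(\<Sum>z\<in>cube lo r. \<Sum>z'\<in>cube lo r. (f z' - f z)\<^sup>2)
          \<le> 2 ^ CARD('c) * real r ^ (CARD('c) + 2) * (\<Sum>c\<in>UNIV. cube_energy lo r f c)"
proof -
  let ?Q = "cube lo r"
  define ov :: "'c set \<Rightarrow> ('c \<Rightarrow> int) \<Rightarrow> ('c \<Rightarrow> int) \<Rightarrow> 'c \<Rightarrow> int"
    where "ov A z z' = (\<lambda>c. if c \<in> A then z' c else z c)" for A z z'
  define D where "D c = (\<Sum>u\<in>?Q. \<Sum>u'\<in>?Q. (f (u(c := u' c)) - f u)\<^sup>2)" for c
  have D0: "0 \<le> D c" for c unfolding D_def by (intro sum_nonneg) auto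
  have "(\<Sum>z\<in>?Q. \<Sum>z'\<in>?Q. (f (ov A z z') - f z)\<^sup>2) \<le> 2 ^ card A * (\<Sum>c\<in>A. D c)"
    if "finite A" for A
    using that
  proof (induction A)
    case empty
    show ?case by (simp add: ov_def)
  next
    case (insert c A)
    \<comment> \<open>Exchanging the coordinates in \<open>A\<close> between \<open>z\<close> and
      \<open>z'\<close> permutes the pairs of points of the cube, so the step from \<open>A\<close>
      to \<open>insert c A\<close> costs exactly \<open>D c\<close>.\<close>
    let ?m = "\<lambda>(z, z'). (ov A z z', ov A z' z)"
    have bij: "bij_betw ?m (?Q \<times> ?Q) (?Q \<times> ?Q)"
      by (rule bij_betwI[where g = ?m]) (auto simp: cube_def ov_def)
    have upd: "ov (insert c A) z z' = (ov A z z')(c := ov A z' z c)" for z z'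
      using insert.hyps by (auto simp: ov_def)
    have first: "(\<Sum>z\<in>?Q. \<Sum>z'\<in>?Q. (f (ov (insert c A) z z') - f (ov A z z'))\<^sup>2) = D c"
      unfolding D_def upd
      using sum.reindex_bij_betw[OF bij, of "\<lambda>(u, u'). (f (u(c := u' c)) - f u)\<^sup>2"]
      by (simp add: sum.cartesian_product split_def)
    have "(\<Sum>z\<in>?Q. \<Sum>z'\<in>?Q. (f (ov (insert c A) z z') - f z)\<^sup>2)
      \<le> (\<Sum>z\<in>?Q. \<Sum>z'\<in>?Q. 2 * (f (ov (insert c A) z z') - f (ov A z z'))\<^sup>2
                              + 2 * (f (ov A z z') - f z)\<^sup>2)"
    proof (intro sum_mono)
      fix z z'
      have "(a - c)\<^sup>2 \<le> 2 * (a - b)\<^sup>2 + 2 * (b - c)\<^sup>2" for a b c :: real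
        using sum_squares_ge_zero[of "(a - b) - (b - c)" 0] by (simp add: power2_eq_square algebra_simps)
      then show "(f (ov (insert c A) z z') - f z)\<^sup>2
          \<le> 2 * (f (ov (insert c A) z z') - f (ov A z z'))\<^sup>2 + 2 * (f (ov A z z') - f z)\<^sup>2" .
    qed
    also have "\<dots> = 2 * D c + 2 * (\<Sum>z\<in>?Q. \<Sum>z'\<in>?Q. (f (ov A z z') - f z)\<^sup>2)"
      by (simp add: sum.distrib first flip: sum_distrib_left)
    also have "\<dots> \<le> 2 * D c + 2 * (2 ^ card A * (\<Sum>c\<in>A. D c))"
      using insert.IH by simp
    also have "\<dots> \<le> 2 * 2 ^ card A * D c + 2 * (2 ^ card A * (\<Sum>c\<in>A. D c))"
      using D0[of c] mult_right_mono[of 1 "2 ^ card A" "D c"] by simp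
    also have "\<dots> = 2 ^ card (insert c A) * (\<Sum>c\<in>insert c A. D c)"
      using insert.hyps by (simp add: algebra_simps)
    finally show ?case .
  qed
  from this[of UNIV] have "(\<Sum>z\<in>?Q. \<Sum>z'\<in>?Q. (f z' - f z)\<^sup>2) \<le> 2 ^ CARD('c) * (\<Sum>c\<in>UNIV. D c)"
    by (simp add: ov_def)
  also have "\<dots> \<le> 2 ^ CARD('c) * (\<Sum>c\<in>UNIV. real r ^ (CARD('c) + 2) * cube_energy lo r f c)"
    unfolding D_def by (intro mult_left_mono sum_mono sum_resample_coordinate_le) auto
  finally show ?thesis by (simp add: sum_distrib_left mult.assoc)
qed

lemma infsum_finite_support:
  assumes "finite A" "\<And>z. z \<notin> A \<Longrightarrow> f z = 0"
  shows "infsum f UNIV = sum f A"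
  using assms infsum_cong_neutral[of A UNIV f f] by (simp add: infsum_finite)

text \<open>The double sum of \<open>(g z' - g z)\<^sup>2\<close> is \<open>2 * r ^ N\<close> times
  the sum of squares minus twice the squared sum. Poincare bounds it, and the squared sum is at most
  the squared \<open>\<ell>\<^sup>1\<close> norm.\<close>

lemma nash_cube:
  fixes g :: "('c::finite \<Rightarrow> int) \<Rightarrow> real"
  assumes r: "r > 0"
  shows "(\<Sum>z\<in>cube lo r. (g z)\<^sup>2) \<le> 2 ^ CARD('c) * real r ^ 2 * (\<Sum>c\<in>UNIV. cube_energy lo r g c)
           + (\<Sum>z\<in>cube lo r. \<bar>g z\<bar>)\<^sup>2 / real r ^ CARD('c)"
proof -
  let ?Q = "cube lo r" and ?n = "real r ^ CARD('c)" and ?E = "\<Sum>c\<in>UNIV. cube_energy lo r g c"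
  have n: "?n > 0" using r by simp
  have E0: "0 \<le> ?E" by (intro sum_nonneg cube_energy_nonneg)
  have "(\<Sum>z\<in>?Q. \<Sum>z'\<in>?Q. (g z' - g z)\<^sup>2)
      = (\<Sum>z\<in>?Q. \<Sum>z'\<in>?Q. (g z')\<^sup>2 + (g z)\<^sup>2 - 2 * (g z * g z'))"
    by (simp add: power2_diff algebra_simps)
  also have "\<dots> = 2 * ?n * (\<Sum>z\<in>?Q. (g z)\<^sup>2) - 2 * (\<Sum>z\<in>?Q. g z)\<^sup>2"
    by (simp add: sum.distrib sum_subtractf card_cube power2_eq_square sum_product
                  flip: sum_distrib_left)
  finally have "2 * ?n * (\<Sum>z\<in>?Q. (g z)\<^sup>2)
      \<le> 2 * (\<Sum>z\<in>?Q. g z)\<^sup>2 + 2 ^ CARD('c) * real r ^ (CARD('c) + 2) * ?E"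
    using poincare_cube[where f = g and lo = lo and r = r] by simp
  also have "(\<Sum>z\<in>?Q. g z)\<^sup>2 \<le> (\<Sum>z\<in>?Q. \<bar>g z\<bar>)\<^sup>2"
    by (intro abs_le_square_iff[THEN iffD1]) (use sum_abs[of g ?Q] in \<open>simp add: sum_nonneg\<close>)
  also have "2 ^ CARD('c) * real r ^ (CARD('c) + 2) * ?E \<le> 2 * (2 ^ CARD('c) * real r ^ (CARD('c) + 2) * ?E)"
    using E0 by simp
  finally have "?n * (\<Sum>z\<in>?Q. (g z)\<^sup>2) \<le> (\<Sum>z\<in>?Q. \<bar>g z\<bar>)\<^sup>2 + ?n * (2 ^ CARD('c) * real r ^ 2 * ?E)"
    by (simp add: power_add algebra_simps power2_eq_square)
  then have "(\<Sum>z\<in>?Q. (g z)\<^sup>2) \<le> ((\<Sum>z\<in>?Q. \<bar>g z\<bar>)\<^sup>2 + ?n * (2 ^ CARD('c) * real r ^ 2 * ?E)) / ?n"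
    using n by (simp add: pos_le_divide_eq mult.commute)
  then show ?thesis using n by (simp add: add_divide_distrib)
qed

section \<open>The Liouville property of elliptic reversible walks\<close>

definition move :: "('c \<Rightarrow> int) \<Rightarrow> 'c \<times> int \<Rightarrow> ('c \<Rightarrow> int)" where
  "move z e = z(fst e := z (fst e) + snd e)"

definition dirs :: "('c \<times> int) set" where "dirs = UNIV \<times> {1, -1}"

definition opp :: "'c \<times> int \<Rightarrow> 'c \<times> int" where "opp e = (fst e, - snd e)"

lemma finite_dirs [simp]: "finite (dirs :: ('c::finite \<times> int) set)"
  by (simp add: dirs_def)

lemma opp_dirs [simp]: "opp e \<in> dirs \<longleftrightarrow> e \<in> dirs"
  by (cases e) (auto simp: opp_def dirs_def)

lemma opp_opp [simp]: "opp (opp e) = e"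
  by (simp add: opp_def)

lemma move_opp [simp]: "move (move z e) (opp e) = z" "move (move z (opp e)) e = z"
  by (auto simp: move_def opp_def)

lemma bij_move: "bij (\<lambda>z. move z e)"
  by (rule o_bij[of "\<lambda>z. move z (opp e)"]) auto

lemma finite_move_preimage [simp]: "finite A \<Longrightarrow> finite {z. move z e \<in> A}"
  using finite_vimageI[OF _ bij_is_inj[OF bij_move[of e]], of A] by (simp add: vimage_def)

text \<open>If \<open>g\<close> vanishes off \<open>A\<close>, then \<open>K g\<close> and the edge
  differences of \<open>g\<close> vanish off \<open>halo A\<close>; this turns the infinite sums
  below into finite ones.\<close>

definition halo :: "('c::finite \<Rightarrow> int) set \<Rightarrow> ('c \<Rightarrow> int) set" where
  "halo A = A \<union> (\<Union>e\<in>dirs. {z. move z e \<in> A})"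

lemma finite_halo [simp]: "finite A \<Longrightarrow> finite (halo A)"
  unfolding halo_def by (intro finite_UnI finite_UN_I finite_move_preimage) auto

lemma subset_halo: "A \<subseteq> halo A" by (auto simp: halo_def)

text \<open>Reversal of oriented edges, \<open>(z, e)\<close> to \<open>(move z e, opp e)\<close>,
  is an involution; for fixed \<open>e\<close> it is a translation of the lattice.\<close>

lemma infsum_dirs_swap:
  fixes \<Phi> :: "('c::finite \<Rightarrow> int) \<Rightarrow> 'c \<times> int \<Rightarrow> real"
  assumes A: "finite A" and supp: "\<And>z e. e \<in> dirs \<Longrightarrow> z \<notin> A \<Longrightarrow> \<Phi> z e = 0"
  shows "(\<Sum>\<^sub>\<infinity>z. \<Sum>e\<in>dirs. \<Phi> (move z e) (opp e)) = (\<Sum>\<^sub>\<infinity>z. \<Sum>e\<in>dirs. \<Phi> z e)"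
proof -
  have "(\<Sum>\<^sub>\<infinity>z. \<Sum>e\<in>dirs. \<Phi> (move z e) (opp e)) = (\<Sum>z\<in>halo A. \<Sum>e\<in>dirs. \<Phi> (move z e) (opp e))"
    using A by (intro infsum_finite_support) (auto intro!: sum.neutral supp simp: halo_def)
  also have "\<dots> = (\<Sum>e\<in>dirs. \<Sum>z\<in>halo A. \<Phi> (move z e) (opp e))"
    by (rule sum.swap)
  also have "\<dots> = (\<Sum>e\<in>dirs. \<Sum>z\<in>A. \<Phi> z (opp e))"
  proof (rule sum.cong[OF refl])
    fix e :: "'c \<times> int" assume e: "e \<in> dirs"
    have "(\<Sum>z\<in>halo A. \<Phi> (move z e) (opp e)) = (\<Sum>z | move z e \<in> A. \<Phi> (move z e) (opp e))"
      using A e by (intro sum.mono_neutral_right) (auto simp: halo_def supp)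
    also have "\<dots> = (\<Sum>z\<in>A. \<Phi> z (opp e))"
      by (rule sum.reindex_bij_witness[where i = "\<lambda>z. move z (opp e)" and j = "\<lambda>z. move z e"]) auto
    finally show "(\<Sum>z\<in>halo A. \<Phi> (move z e) (opp e)) = (\<Sum>z\<in>A. \<Phi> z (opp e))" .
  qed
  also have "\<dots> = (\<Sum>z\<in>A. \<Sum>e\<in>dirs. \<Phi> z (opp e))"
    by (rule sum.swap)
  also have "\<dots> = (\<Sum>z\<in>A. \<Sum>e\<in>dirs. \<Phi> z e)"
    by (intro sum.cong refl sum.reindex_bij_witness[where i = opp and j = opp]) auto
  also have "\<dots> = (\<Sum>\<^sub>\<infinity>z. \<Sum>e\<in>dirs. \<Phi> z e)"
    using A by (intro infsum_finite_support[symmetric]) (auto intro!: sum.neutral supp)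
  finally show ?thesis .
qed

text \<open>\<open>\<kappa>\<close> is the ellipticity constant, and \<open>drift\<close> bounds the
  growth of the expected squared norm in one step, where \<open>e\<close> changes only the
  coordinate \<open>fst e\<close>. The remaining probability is spent standing still.\<close>

locale elliptic_walk =
  fixes q :: "('c::finite \<Rightarrow> int) \<Rightarrow> 'c \<times> int \<Rightarrow> real" and w :: "('c \<Rightarrow> int) \<Rightarrow> real"
    and \<kappa> lo hi C :: real
  assumes \<kappa>: "0 < \<kappa>" "\<And>z e. e \<in> dirs \<Longrightarrow> \<kappa> \<le> q z e"
    and lazy: "\<And>z. (\<Sum>e\<in>dirs. q z e) \<le> 1 / 2"
    and reversible: "\<And>z e. e \<in> dirs \<Longrightarrow> w (move z e) * q (move z e) (opp e) = w z * q z e"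
    and w: "0 < lo" "\<And>z. lo \<le> w z" "\<And>z. w z \<le> hi"
    and drift: "\<And>z. (\<Sum>e\<in>dirs. q z e * ((move z e (fst e))\<^sup>2 - (z (fst e))\<^sup>2)) \<le> C"
begin

definition K :: "(('c \<Rightarrow> int) \<Rightarrow> real) \<Rightarrow> ('c \<Rightarrow> int) \<Rightarrow> real" where
  "K f z = f z + (\<Sum>e\<in>dirs. q z e * (f (move z e) - f z))"

text \<open>Every edge occurs twice, once in each orientation; hence the halves in
  \<open>energy_byparts\<close>.\<close>

definition energy :: "(('c \<Rightarrow> int) \<Rightarrow> real) \<Rightarrow> (('c \<Rightarrow> int) \<Rightarrow> real) \<Rightarrow> real" where
  "energy f g = (\<Sum>\<^sub>\<infinity>z. \<Sum>e\<in>dirs. w z * q z e * (f (move z e) - f z) * (g (move z e) - g z))"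

lemma q_pos: "e \<in> dirs \<Longrightarrow> 0 < q z e"
  using \<kappa>(1) \<kappa>(2)[of e z] by linarith

lemma w_pos: "0 < w z" using w(1) w(2)[of z] by linarith

lemma hi_pos: "0 < hi" using w_pos w(3) less_le_trans by blast

lemma K_convex: "K f z = (1 - (\<Sum>e\<in>dirs. q z e)) * f z + (\<Sum>e\<in>dirs. q z e * f (move z e))"
  by (simp add: K_def algebra_simps sum_subtractf sum_distrib_left sum_distrib_right)

lemma K_mono: "(\<And>z. f z \<le> g z) \<Longrightarrow> K f z \<le> K g z"
  unfolding K_convex using lazy[of z]
  by (intro add_mono mult_left_mono sum_mono) (auto simp: less_imp_le[OF q_pos])

lemma K_add: "K (\<lambda>z. f z + g z) z = K f z + K g z"
  by (simp add: K_def algebra_simps sum.distrib sum_subtractf)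

lemma K_cmult: "K (\<lambda>z. c * f z) z = c * K f z"
  by (simp add: K_def algebra_simps sum_distrib_left sum_subtractf)

lemma K_const [simp]: "K (\<lambda>z. c) = (\<lambda>z. c)"
  by (simp add: K_def fun_eq_iff)

lemma Kn_mono: "(\<And>z. f z \<le> g z) \<Longrightarrow> (K ^^ k) f z \<le> (K ^^ k) g z"
  by (induction k arbitrary: z) (auto intro: K_mono)

lemma Kn_add: "(K ^^ k) (\<lambda>z. f z + g z) = (\<lambda>z. (K ^^ k) f z + (K ^^ k) g z)"
  by (induction k) (auto simp: K_add)

lemma Kn_cmult: "(K ^^ k) (\<lambda>z. c * f z) = (\<lambda>z. c * (K ^^ k) f z)"
  by (induction k) (auto simp: K_cmult)

lemma Kn_const [simp]: "(K ^^ k) (\<lambda>z. c) = (\<lambda>z. c)"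
  by (induction k) auto

lemma Kn_harmonic: "K h = h \<Longrightarrow> (K ^^ k) h = h"
  by (induction k) auto

lemma K_supp: "(\<And>z. z \<notin> A \<Longrightarrow> g z = 0) \<Longrightarrow> z \<notin> halo A \<Longrightarrow> K g z = 0"
  by (auto simp: K_def halo_def intro!: sum.neutral)

text \<open>By reversibility \<open>w z * q z e\<close> is the same for an edge and its reversal. In
  both identities, adding to a summand the one of the reversed edge gives minus the energy density,
  so the sum is minus half the energy.\<close>

lemma energy_byparts:
  assumes A: "finite A" and g: "\<And>z. z \<notin> A \<Longrightarrow> g z = 0"
  shows "(\<Sum>\<^sub>\<infinity>z. w z * (K g z - g z) * h z) = - energy g h / 2"
    and "(\<Sum>\<^sub>\<infinity>z. w z * g z * (K h z - h z)) = - energy g h / 2"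
proof -
  have ens: "(\<Sum>\<^sub>\<infinity>z. \<Sum>e\<in>dirs. F z e) = (\<Sum>z\<in>halo A. \<Sum>e\<in>dirs. F z e)"
    if "\<And>z e. e \<in> dirs \<Longrightarrow> g z = 0 \<Longrightarrow> g (move z e) = 0 \<Longrightarrow> F z e = 0"
    for F :: "('c \<Rightarrow> int) \<Rightarrow> 'c \<times> int \<Rightarrow> real"
    using A by (intro infsum_finite_support) (auto intro!: sum.neutral that g simp: halo_def)
  have *: "(\<Sum>\<^sub>\<infinity>z. \<Sum>e\<in>dirs. \<Phi> z e) = - energy g h / 2"
    if \<Phi>0: "\<And>z e. e \<in> dirs \<Longrightarrow> g z = 0 \<Longrightarrow> g (move z e) = 0 \<Longrightarrow> \<Phi> z e = 0"
      and \<Phi>: "\<And>z e. e \<in> dirs \<Longrightarrow> \<Phi> z e + \<Phi> (move z e) (opp e)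
                = - (w z * q z e * (g (move z e) - g z) * (h (move z e) - h z))"
    for \<Phi> :: "('c \<Rightarrow> int) \<Rightarrow> 'c \<times> int \<Rightarrow> real"
  proof -
    have "(\<Sum>\<^sub>\<infinity>z. \<Sum>e\<in>dirs. \<Phi> (move z e) (opp e)) = (\<Sum>\<^sub>\<infinity>z. \<Sum>e\<in>dirs. \<Phi> z e)"
      using A by (intro infsum_dirs_swap[of "halo A"]) (auto intro!: \<Phi>0 g simp: halo_def)
    moreover have "(\<Sum>\<^sub>\<infinity>z. \<Sum>e\<in>dirs. \<Phi> z e) + (\<Sum>\<^sub>\<infinity>z. \<Sum>e\<in>dirs. \<Phi> (move z e) (opp e))
        = - energy g h"
    proof -
      have "\<Phi> (move z e) (opp e) = 0" if "e \<in> dirs" "g z = 0" "g (move z e) = 0" for z e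
        using \<Phi>[of e z] \<Phi>0[of e z] that by simp
      then show ?thesis unfolding energy_def
        by (subst (1 2 3) ens) (auto simp: \<Phi>0 \<Phi> simp flip: sum.distrib sum_negf)
    qed
    ultimately show ?thesis by simp
  qed
  have "(\<Sum>\<^sub>\<infinity>z. \<Sum>e\<in>dirs. w z * q z e * (g (move z e) - g z) * h z) = - energy g h / 2"
    by (rule *) (auto simp: reversible algebra_simps)
  then show "(\<Sum>\<^sub>\<infinity>z. w z * (K g z - g z) * h z) = - energy g h / 2"
    by (simp add: K_def sum_distrib_left sum_distrib_right mult_ac)
  have "(\<Sum>\<^sub>\<infinity>z. \<Sum>e\<in>dirs. w z * q z e * g z * (h (move z e) - h z)) = - energy g h / 2"
  proof (rule *)
    fix z and e :: "'c \<times> int" assume e: "e \<in> dirs"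
    show "w z * q z e * g z * (h (move z e) - h z) +
        w (move z e) * q (move z e) (opp e) * g (move z e) * (h (move (move z e) (opp e)) - h (move z e)) =
        - (w z * q z e * (g (move z e) - g z) * (h (move z e) - h z))"
      unfolding reversible[OF e] move_opp by (simp add: algebra_simps)
  qed auto
  then show "(\<Sum>\<^sub>\<infinity>z. w z * g z * (K h z - h z)) = - energy g h / 2"
    by (simp add: K_def sum_distrib_left sum_distrib_right mult_ac)
qed

text \<open>As a function of \<open>z\<close> this is the probability of reaching \<open>x\<close>
  from \<open>z\<close> in \<open>k\<close> steps. By reversibility
  \<open>w z * heat x k z / w x\<close> is the law at time \<open>k\<close> of the walk started in
  \<open>x\<close>, which is the content of \<open>heat_pair\<close>.\<close>

definition heat :: "('c \<Rightarrow> int) \<Rightarrow> nat \<Rightarrow> ('c \<Rightarrow> int) \<Rightarrow> real" where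
  "heat x k = (K ^^ k) (\<lambda>z. if z = x then 1 else 0)"

lemma heat_finite: "\<exists>A. finite A \<and> (\<forall>z. z \<notin> A \<longrightarrow> heat x k z = 0)"
proof (induction k)
  case 0
  show ?case by (rule exI[of _ "{x}"]) (auto simp: heat_def)
next
  case (Suc k)
  then obtain A where "finite A" "\<forall>z. z \<notin> A \<longrightarrow> heat x k z = 0" by blast
  then show ?case by (intro exI[of _ "halo A"]) (auto simp: heat_def intro!: K_supp[of A])
qed

lemma heat_nonneg: "0 \<le> heat x k z"
  using Kn_mono[of "\<lambda>_. 0" "\<lambda>z. if z = x then 1 else 0" k z] by (simp add: heat_def)

text \<open>\<open>K\<close> is self-adjoint with respect to the weight \<open>w\<close>: both
  identities of \<open>energy_byparts\<close> have the same right-hand side.\<close>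

lemma pair_Suc:
  assumes A: "finite A" and g: "\<And>z. z \<notin> A \<Longrightarrow> g z = 0"
  shows "(\<Sum>\<^sub>\<infinity>z. w z * K g z * h z) = (\<Sum>\<^sub>\<infinity>z. w z * g z * K h z)"
proof -
  have g': "K g z = 0" if "z \<notin> halo A" for z using K_supp[OF g that] .
  have g'': "g z = 0" if "z \<notin> halo A" for z using g that subset_halo[of A] by blast
  have "(\<Sum>z\<in>halo A. w z * (K g z - g z) * h z) = (\<Sum>z\<in>halo A. w z * g z * (K h z - h z))"
  proof -
    have "(\<Sum>\<^sub>\<infinity>z. w z * (K g z - g z) * h z) = (\<Sum>z\<in>halo A. w z * (K g z - g z) * h z)"
      "(\<Sum>\<^sub>\<infinity>z. w z * g z * (K h z - h z)) = (\<Sum>z\<in>halo A. w z * g z * (K h z - h z))"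
      using A by (auto intro!: infsum_finite_support simp: g' g'')
    then show ?thesis using energy_byparts[of A g h, OF A g] by simp
  qed
  then have "(\<Sum>z\<in>halo A. w z * K g z * h z) = (\<Sum>z\<in>halo A. w z * g z * K h z)"
    by (simp add: algebra_simps sum_subtractf)
  then show ?thesis using A
    by (subst (1 2) infsum_finite_support[of "halo A"]) (auto simp: g' g'')
qed

lemma heat_pair: "(\<Sum>\<^sub>\<infinity>z. w z * heat x k z * h z) = w x * (K ^^ k) h x"
proof (induction k arbitrary: h)
  case 0
  show ?case by (subst infsum_finite_support[of "{x}"]) (auto simp: heat_def)
next
  case (Suc k)
  obtain A where A: "finite A" "\<forall>z. z \<notin> A \<longrightarrow> heat x k z = 0" using heat_finite by blast
  have "(\<Sum>\<^sub>\<infinity>z. w z * heat x (Suc k) z * h z) = (\<Sum>\<^sub>\<infinity>z. w z * K (heat x k) z * h z)"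
    by (simp add: heat_def)
  also have "\<dots> = (\<Sum>\<^sub>\<infinity>z. w z * heat x k z * K h z)" using A by (intro pair_Suc) auto
  also have "\<dots> = w x * (K ^^ k) (K h) x" by (rule Suc.IH)
  finally show ?case by (simp add: funpow_swap1)
qed

lemma energy_nonneg: "0 \<le> energy g g"
  unfolding energy_def
  by (intro infsum_nonneg sum_nonneg)
     (auto simp: mult.assoc intro!: mult_nonneg_nonneg[OF less_imp_le[OF w_pos]] mult_nonneg_nonneg[OF less_imp_le[OF q_pos]])

text \<open>Jensen with a gain: \<open>K (g\<^sup>2) - (K g)\<^sup>2 = ?t - ?s\<^sup>2\<close>, and
  Cauchy-Schwarz with total jump probability at most 1/2 gives
  \<open>?s\<^sup>2 \<le> ?t / 2\<close>.\<close>

lemma K_square: "(K g z)\<^sup>2 \<le> K (\<lambda>z. (g z)\<^sup>2) z - (\<Sum>e\<in>dirs. q z e * (g (move z e) - g z)\<^sup>2) / 2"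
proof -
  let ?s = "\<Sum>e\<in>dirs. q z e * (g (move z e) - g z)"
  let ?t = "\<Sum>e\<in>dirs. q z e * (g (move z e) - g z)\<^sup>2"
  have t0: "0 \<le> ?t" by (intro sum_nonneg mult_nonneg_nonneg) (auto intro: less_imp_le[OF q_pos])
  have "?s\<^sup>2 = (\<Sum>e\<in>dirs. sqrt (q z e) * (sqrt (q z e) * (g (move z e) - g z)))\<^sup>2"
    by (intro arg_cong[where f = "\<lambda>x. x\<^sup>2"] sum.cong refl)
       (simp add: less_imp_le[OF q_pos] flip: mult.assoc)
  also have "\<dots> \<le> (\<Sum>e\<in>dirs. (sqrt (q z e))\<^sup>2) * (\<Sum>e\<in>dirs. (sqrt (q z e) * (g (move z e) - g z))\<^sup>2)"
    by (rule Cauchy_Schwarz_ineq_sum)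
  also have "\<dots> = (\<Sum>e\<in>dirs. q z e) * ?t"
    by (intro arg_cong2[where f = "(*)"] sum.cong refl)
       (auto simp: power_mult_distrib less_imp_le[OF q_pos])
  also have "\<dots> \<le> 1 / 2 * ?t" using lazy t0 by (intro mult_right_mono) auto
  finally have s: "?s\<^sup>2 \<le> ?t / 2" by simp
  have "K (\<lambda>z. (g z)\<^sup>2) z = (g z)\<^sup>2 + 2 * g z * ?s + ?t"
    by (simp add: K_def power2_eq_square algebra_simps sum.distrib sum_subtractf sum_distrib_left)
  moreover have "(K g z)\<^sup>2 = (g z)\<^sup>2 + 2 * g z * ?s + ?s\<^sup>2"
    by (simp add: K_def power2_sum)
  ultimately show ?thesis using s by simp
qed

definition norm2 :: "('c \<Rightarrow> int) \<Rightarrow> nat \<Rightarrow> real" where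
  "norm2 x k = (\<Sum>\<^sub>\<infinity>z. w z * (heat x k z)\<^sup>2)"

text \<open>\<open>K_square\<close> summed against \<open>w\<close>. The term
  \<open>K (g\<^sup>2)\<close> keeps its total mass because \<open>w\<close> is invariant, which is
  \<open>pair_Suc\<close> tested against 1.\<close>

lemma norm2_Suc: "norm2 x (Suc k) \<le> norm2 x k - energy (heat x k) (heat x k) / 2"
proof -
  obtain A where A: "finite A" "\<forall>z. z \<notin> A \<longrightarrow> heat x k z = 0" using heat_finite by blast
  let ?g = "heat x k" and ?H = "halo A"
  let ?t = "\<lambda>z. \<Sum>e\<in>dirs. q z e * (?g (move z e) - ?g z)\<^sup>2"
  have g: "?g z = 0" if "z \<notin> ?H" for z using A that subset_halo[of A] by blast
  have gm: "?g (move z e) = 0" if "z \<notin> ?H" "e \<in> dirs" for z e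
    using A that by (auto simp: halo_def)
  have Kg: "K ?g z = 0" if "z \<notin> ?H" for z using A that by (intro K_supp[of A]) auto
  have Kg2: "K (\<lambda>z. (?g z)\<^sup>2) z = 0" if "z \<notin> ?H" for z
    using A that by (intro K_supp[of A]) auto
  have "norm2 x (Suc k) = (\<Sum>z\<in>?H. w z * (K ?g z)\<^sup>2)"
    unfolding norm2_def heat_def using Kg A
    by (subst infsum_finite_support[of ?H]) (auto simp: heat_def)
  also have "\<dots> \<le> (\<Sum>z\<in>?H. w z * (K (\<lambda>z. (?g z)\<^sup>2) z - ?t z / 2))"
    by (intro sum_mono mult_left_mono K_square less_imp_le[OF w_pos])
  also have "\<dots> = (\<Sum>z\<in>?H. w z * K (\<lambda>z. (?g z)\<^sup>2) z) - (\<Sum>z\<in>?H. w z * ?t z) / 2"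
    by (simp add: right_diff_distrib sum_subtractf flip: sum_divide_distrib)
  also have "(\<Sum>z\<in>?H. w z * K (\<lambda>z. (?g z)\<^sup>2) z) = (\<Sum>\<^sub>\<infinity>z. w z * K (\<lambda>z. (?g z)\<^sup>2) z * 1)"
    using A by (subst infsum_finite_support[of ?H]) (auto simp: Kg2)
  also have "\<dots> = norm2 x k" unfolding norm2_def
    using A by (subst pair_Suc[of A]) auto
  also have "(\<Sum>z\<in>?H. w z * ?t z) = energy ?g ?g"
    unfolding energy_def using A
    by (subst infsum_finite_support[of ?H])
       (auto simp: g gm sum_distrib_left power2_eq_square mult_ac intro!: sum.neutral sum.cong)
  finally show ?thesis .
qed

end

text \<open>The lattice is tiled by cubes of side \<open>r\<close>, and \<open>nash_cube\<close> is
  summed over the tiles. Edges between different tiles are dropped, and the sum of the squared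
  masses of the tiles is at most the square of the total mass.\<close>

lemma nash_lattice:
  fixes g :: "('c::finite \<Rightarrow> int) \<Rightarrow> real"
  assumes r: "r > 0" and A: "finite A" and g: "\<And>z. z \<notin> A \<Longrightarrow> g z = 0"
  shows "(\<Sum>\<^sub>\<infinity>z. (g z)\<^sup>2) \<le> 2 ^ CARD('c) * real r ^ 2 * (\<Sum>\<^sub>\<infinity>z. \<Sum>c\<in>UNIV. (g (move z (c, 1)) - g z)\<^sup>2)
           + (\<Sum>\<^sub>\<infinity>z. \<bar>g z\<bar>)\<^sup>2 / real r ^ CARD('c)"
proof -
  define \<beta> :: "('c \<Rightarrow> int) \<Rightarrow> 'c \<Rightarrow> int" where "\<beta> z = (\<lambda>c. z c div int r)" for z
  define Q where "Q b = cube (\<lambda>c. int r * b c) r" for b :: "'c \<Rightarrow> int"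
  define B where "B = \<beta> ` halo A"
  define S where "S = (\<Union>b\<in>B. Q b)"
  have Q_iff: "z \<in> Q b \<longleftrightarrow> \<beta> z = b" for z b
  proof -
    have "int r * b c \<le> z c \<and> z c < int r * b c + int r \<longleftrightarrow> z c div int r = b c" for c
    proof
      assume "z c div int r = b c"
      then have "z c = int r * b c + z c mod int r" by (metis mult_div_mod_eq)
      then show "int r * b c \<le> z c \<and> z c < int r * b c + int r"
        using r by (smt (verit) of_nat_0_less_iff pos_mod_bound pos_mod_sign)
    next
      assume "int r * b c \<le> z c \<and> z c < int r * b c + int r"
      then show "z c div int r = b c"
        by (intro int_div_pos_eq[of _ _ _ "z c - int r * b c"]) auto
    qed
    then show ?thesis by (auto simp: Q_def \<beta>_def cube_def fun_eq_iff)
  qed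
  have fin: "finite B" "finite S" using A by (auto simp: B_def S_def Q_def)
  have HS: "halo A \<subseteq> S" by (auto simp: S_def B_def Q_iff)
  have group: "(\<Sum>b\<in>B. \<Sum>z\<in>Q b. F z) = (\<Sum>z\<in>S. F z)" for F :: "('c \<Rightarrow> int) \<Rightarrow> real"
  proof -
    have "(\<Sum>b\<in>B. \<Sum>z\<in>{z \<in> S. \<beta> z = b}. F z) = (\<Sum>z\<in>S. F z)"
      using fin by (intro sum.group) (auto simp: S_def Q_iff)
    moreover have "{z \<in> S. \<beta> z = b} = Q b" if "b \<in> B" for b
      using that by (auto simp: S_def Q_iff)
    ultimately show ?thesis by simp
  qed
  let ?D = "\<lambda>z. \<Sum>c\<in>UNIV. (g (move z (c, 1)) - g z)\<^sup>2"
  have g_S: "g z = 0" if "z \<notin> S" for z using HS subset_halo[of A] g that by blast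
  have D_S: "?D z = 0" if "z \<notin> S" for z
  proof -
    have "z \<notin> halo A" using HS that by blast
    then have "z \<notin> A" "\<And>c. move z (c, 1) \<notin> A" by (auto simp: halo_def dirs_def)
    then show ?thesis by (simp add: g)
  qed
  have "(\<Sum>\<^sub>\<infinity>z. (g z)\<^sup>2) = (\<Sum>b\<in>B. \<Sum>z\<in>Q b. (g z)\<^sup>2)"
    unfolding group using fin by (intro infsum_finite_support) (auto simp: g_S)
  also have "\<dots> \<le> (\<Sum>b\<in>B. 2 ^ CARD('c) * real r ^ 2 * (\<Sum>z\<in>Q b. ?D z)
                    + (\<Sum>z\<in>Q b. \<bar>g z\<bar>)\<^sup>2 / real r ^ CARD('c))"
  proof (rule sum_mono)
    fix b
    have "(\<Sum>c\<in>UNIV. cube_energy (\<lambda>c. int r * b c) r g c)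
        \<le> (\<Sum>c\<in>UNIV. \<Sum>z\<in>Q b. (g (move z (c, 1)) - g z)\<^sup>2)"
    proof (rule sum_mono)
      fix c
      have "cube_energy (\<lambda>c. int r * b c) r g c
        = (\<Sum>z | z \<in> Q b \<and> z(c := z c + 1) \<in> Q b. (g (move z (c, 1)) - g z)\<^sup>2)"
        by (simp add: cube_energy_def Q_def move_def)
      also have "\<dots> \<le> (\<Sum>z\<in>Q b. (g (move z (c, 1)) - g z)\<^sup>2)"
        by (rule sum_mono2) (auto simp: Q_def)
      finally show "cube_energy (\<lambda>c. int r * b c) r g c \<le> (\<Sum>z\<in>Q b. (g (move z (c, 1)) - g z)\<^sup>2)" .
    qed
    also have "\<dots> = (\<Sum>z\<in>Q b. ?D z)" by (rule sum.swap)
    finally have "2 ^ CARD('c) * real r ^ 2 * (\<Sum>c\<in>UNIV. cube_energy (\<lambda>c. int r * b c) r g c)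
        \<le> 2 ^ CARD('c) * real r ^ 2 * (\<Sum>z\<in>Q b. ?D z)"
      by (intro mult_left_mono) auto
    then show "(\<Sum>z\<in>Q b. (g z)\<^sup>2) \<le> 2 ^ CARD('c) * real r ^ 2 * (\<Sum>z\<in>Q b. ?D z)
                    + (\<Sum>z\<in>Q b. \<bar>g z\<bar>)\<^sup>2 / real r ^ CARD('c)"
      using nash_cube[OF r, where lo = "\<lambda>c. int r * b c" and g = g] unfolding Q_def by linarith
  qed
  also have "\<dots> = 2 ^ CARD('c) * real r ^ 2 * (\<Sum>b\<in>B. \<Sum>z\<in>Q b. ?D z)
                 + (\<Sum>b\<in>B. (\<Sum>z\<in>Q b. \<bar>g z\<bar>)\<^sup>2) / real r ^ CARD('c)"
    by (simp add: sum.distrib sum_distrib_left sum_divide_distrib)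
  also have "(\<Sum>b\<in>B. (\<Sum>z\<in>Q b. \<bar>g z\<bar>)\<^sup>2) \<le> (\<Sum>b\<in>B. \<Sum>z\<in>Q b. \<bar>g z\<bar>)\<^sup>2"
  proof -
    have "L2_set (\<lambda>b. \<Sum>z\<in>Q b. \<bar>g z\<bar>) B \<le> (\<Sum>b\<in>B. \<Sum>z\<in>Q b. \<bar>g z\<bar>)"
      by (intro L2_set_le_sum sum_nonneg) auto
    then have "(L2_set (\<lambda>b. \<Sum>z\<in>Q b. \<bar>g z\<bar>) B)\<^sup>2 \<le> (\<Sum>b\<in>B. \<Sum>z\<in>Q b. \<bar>g z\<bar>)\<^sup>2"
      by (intro power_mono) auto
    then show ?thesis by (simp add: L2_set_def sum_nonneg)
  qed
  also have "(\<Sum>b\<in>B. \<Sum>z\<in>Q b. \<bar>g z\<bar>) = (\<Sum>\<^sub>\<infinity>z. \<bar>g z\<bar>)"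
    unfolding group using fin by (intro infsum_finite_support[symmetric]) (auto simp: g_S)
  also have "(\<Sum>b\<in>B. \<Sum>z\<in>Q b. ?D z) = (\<Sum>\<^sub>\<infinity>z. ?D z)"
    unfolding group using fin D_S by (intro infsum_finite_support[symmetric]) auto
  finally show ?thesis by (simp add: divide_right_mono)
qed

text \<open>Both sides depend on \<open>x / y\<close> only. For \<open>s = sqrt (x / y)\<close>,
  taken at least 1, the right side is \<open>(2 * (s - 1 / s))\<^sup>2\<close>, the left side is
  \<open>(2 * ln s)\<^sup>2\<close>, and \<open>ln s \<le> s - 1 \<le> s - 1 / s\<close>.\<close>

lemma ln_diff_square_le:
  fixes x y :: real
  assumes "0 < x" "0 < y"
  shows "(ln x - ln y)\<^sup>2 \<le> 4 * ((x - y)\<^sup>2 / (x * y))"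
proof -
  have *: "(ln x - ln y)\<^sup>2 \<le> 4 * ((x - y)\<^sup>2 / (x * y))" if "0 < y" "y \<le> x" for x y :: real
  proof -
    define s where "s = sqrt (x / y)"
    have s: "1 \<le> s" "x = s\<^sup>2 * y" using that by (auto simp: s_def)
    then have "ln x - ln y = 2 * ln s" using that by (simp add: ln_mult ln_realpow)
    moreover have "ln s \<le> s - 1 / s"
      using ln_le_minus_one[of s] s(1) by (smt (verit) divide_le_eq_1)
    moreover have "0 \<le> ln s" using s(1) by simp
    ultimately have "(ln x - ln y)\<^sup>2 \<le> (2 * (s - 1 / s))\<^sup>2" by (intro power_mono) auto
    also have "\<dots> = 4 * ((x - y)\<^sup>2 / (x * y))"
      using s that by (simp add: field_simps power2_eq_square)
    finally show ?thesis .
  qed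
  show ?thesis
    using *[of x y] *[of y x] assms by (cases "y \<le> x") (auto simp: power2_commute mult.commute)
qed

text \<open>A product, so that a single step changes only one factor.\<close>

definition cutoff :: "nat \<Rightarrow> ('c::finite \<Rightarrow> int) \<Rightarrow> real" where
  "cutoff R z = (\<Prod>c\<in>UNIV. max 0 (min 1 (2 - \<bar>real_of_int (z c)\<bar> / real R)))"

lemma cutoff_one: "(\<And>c. \<bar>z c\<bar> \<le> int R) \<Longrightarrow> R > 0 \<Longrightarrow> cutoff R z = 1"
proof -
  assume a: "\<And>c. \<bar>z c\<bar> \<le> int R" "R > 0"
  have "max 0 (min 1 (2 - \<bar>real_of_int (z c)\<bar> / real R)) = 1" for c
  proof -
    have "\<bar>real_of_int (z c)\<bar> \<le> real R" using a(1)[of c] by linarith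
    then have "\<bar>real_of_int (z c)\<bar> / real R \<le> 1" using a(2) by simp
    then show ?thesis by linarith
  qed
  then show ?thesis by (simp add: cutoff_def)
qed

lemma cutoff_zero: "\<bar>z c\<bar> \<ge> 2 * int R \<Longrightarrow> R > 0 \<Longrightarrow> cutoff R z = 0"
proof -
  assume a: "\<bar>z c\<bar> \<ge> 2 * int R" "R > 0"
  have "2 * real R \<le> \<bar>real_of_int (z c)\<bar>" using a(1) by linarith
  then have "2 \<le> \<bar>real_of_int (z c)\<bar> / real R" using a(2) by (simp add: pos_le_divide_eq)
  then have "max 0 (min 1 (2 - \<bar>real_of_int (z c)\<bar> / real R)) = 0" by linarith
  then show ?thesis unfolding cutoff_def by (intro prod_zero) auto
qed

lemma cutoff_lipschitz:
  assumes "R > 0" "e \<in> dirs"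
  shows "\<bar>cutoff R (move z e) - cutoff R z\<bar> \<le> 1 / real R"
proof -
  define \<psi> :: "int \<Rightarrow> real" where "\<psi> a = max 0 (min 1 (2 - \<bar>real_of_int a\<bar> / real R))" for a
  have cut: "cutoff R z = (\<Prod>c\<in>UNIV. \<psi> (z c))" for z :: "'a \<Rightarrow> int"
    by (simp add: cutoff_def \<psi>_def)
  have \<psi>01: "0 \<le> \<psi> a" "\<psi> a \<le> 1" for a by (auto simp: \<psi>_def)
  have clamp: "\<bar>max 0 (min 1 (2 - u)) - max 0 (min 1 (2 - v))\<bar> \<le> \<bar>u - v\<bar>" for u v :: real
    by (auto simp: max_def min_def abs_if)
  have lip: "\<bar>\<psi> a - \<psi> b\<bar> \<le> \<bar>real_of_int a - real_of_int b\<bar> / real R" for a b :: int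
  proof -
    have "\<bar>\<psi> a - \<psi> b\<bar> \<le> \<bar>\<bar>real_of_int a\<bar> / real R - \<bar>real_of_int b\<bar> / real R\<bar>"
      unfolding \<psi>_def by (rule clamp)
    also have "\<dots> = \<bar>\<bar>real_of_int a\<bar> - \<bar>real_of_int b\<bar>\<bar> / real R"
      by (simp flip: diff_divide_distrib)
    also have "\<dots> \<le> \<bar>real_of_int a - real_of_int b\<bar> / real R"
      by (intro divide_right_mono) auto
    finally show ?thesis .
  qed
  obtain c s where e: "e = (c, s)" and s: "\<bar>s\<bar> = 1" using assms(2) by (auto simp: dirs_def)
  let ?P = "\<Prod>c\<in>UNIV - {c}. \<psi> (z c)"
  have P: "0 \<le> ?P" "?P \<le> 1" by (auto intro!: prod_nonneg prod_le_1 \<psi>01)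
  have "cutoff R (move z e) = \<psi> (z c + s) * (\<Prod>c\<in>UNIV - {c}. \<psi> (move z e c))"
    unfolding cut by (subst prod.remove[of _ c]) (auto simp: move_def e)
  also have "(\<Prod>c\<in>UNIV - {c}. \<psi> (move z e c)) = ?P"
    by (rule prod.cong) (auto simp: move_def e)
  moreover have "cutoff R z = \<psi> (z c) * ?P"
    unfolding cut by (subst prod.remove[of _ c]) auto
  ultimately have eq: "cutoff R (move z e) - cutoff R z = (\<psi> (z c + s) - \<psi> (z c)) * ?P"
    by (simp add: left_diff_distrib)
  have "\<bar>real_of_int (z c + s) - real_of_int (z c)\<bar> = 1" using s by linarith
  then have "\<bar>\<psi> (z c + s) - \<psi> (z c)\<bar> \<le> 1 / real R" using lip by metis
  then have "\<bar>\<psi> (z c + s) - \<psi> (z c)\<bar> * ?P \<le> 1 / real R * 1"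
    using P by (intro mult_mono) auto
  then show ?thesis using P by (simp add: eq abs_mult)
qed

section \<open>Decay of the heat kernel and diffusive spread\<close>

context elliptic_walk
begin

lemma lo_le_hi: "lo \<le> hi" using w(2,3) order_trans by blast

lemma norm2_nonneg: "0 \<le> norm2 x k"
  unfolding norm2_def by (intro infsum_nonneg) (simp add: less_imp_le[OF w_pos])

lemma \<kappa>_le: "\<kappa> \<le> 1 / 2"
proof -
  obtain e :: "'c \<times> int" where e: "e \<in> dirs" by (auto simp: dirs_def)
  have "\<kappa> \<le> q undefined e" using e by (rule \<kappa>)
  also have "\<dots> \<le> (\<Sum>e\<in>dirs. q undefined e)"
    using e by (intro member_le_sum) (auto simp: less_imp_le[OF q_pos])
  also have "\<dots> \<le> 1 / 2" by (rule lazy)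
  finally show ?thesis .
qed

text \<open>Testing \<open>heat_pair\<close> with the constant 1 gives the \<open>w\<close>-mass
  exactly \<open>w x\<close>; the bounds on \<open>w\<close> convert it to counting measure.\<close>

lemma heat_l1: "(\<Sum>\<^sub>\<infinity>z. \<bar>heat x k z\<bar>) \<le> hi / lo"
proof -
  obtain A where A: "finite A" "\<forall>z. z \<notin> A \<longrightarrow> heat x k z = 0" using heat_finite by blast
  have "lo * (\<Sum>\<^sub>\<infinity>z. \<bar>heat x k z\<bar>) = (\<Sum>z\<in>A. lo * \<bar>heat x k z\<bar>)"
    using A by (subst infsum_finite_support[of A]) (auto simp: sum_distrib_left)
  also have "\<dots> \<le> (\<Sum>z\<in>A. w z * heat x k z)"
    using w heat_nonneg by (intro sum_mono) (auto simp: abs_of_nonneg intro!: mult_right_mono)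
  also have "\<dots> = (\<Sum>\<^sub>\<infinity>z. w z * heat x k z * 1)"
    using A by (subst infsum_finite_support[of A]) auto
  also have "\<dots> = w x" by (subst heat_pair) simp
  also have "\<dots> \<le> hi" by (rule w)
  finally show ?thesis using w(1) by (simp add: pos_le_divide_eq mult.commute)
qed

text \<open>Collects the constants of \<open>norm2_step\<close>: \<open>hi\<close> from comparing
  \<open>norm2\<close> with the unweighted norm, a power of 2 from Nash,
  \<open>lo * \<kappa>\<close> from comparing the energies, and one more factor 2 from
  \<open>norm2_Suc\<close>. \<open>V\<close> is the \<open>\<ell>\<^sup>1\<close> term of Nash with
  \<open>heat_l1\<close> inserted.\<close>

definition c\<^sub>0 :: real where "c\<^sub>0 = lo * \<kappa> / (2 ^ (CARD('c) + 1) * hi)"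
definition V :: real where "V = hi * (hi / lo)\<^sup>2"

lemma c0: "0 < c\<^sub>0" "c\<^sub>0 \<le> 1"
proof -
  show "0 < c\<^sub>0" using w(1) \<kappa>(1) hi_pos by (simp add: c\<^sub>0_def)
  have "lo * \<kappa> \<le> 1 * hi" using mult_mono[OF lo_le_hi \<kappa>_le] \<kappa>(1) w(1) hi_pos by auto
  also have "\<dots> \<le> 2 ^ (CARD('c) + 1) * hi" using hi_pos one_le_power[of "2::real" "CARD('c) + 1"] by (intro mult_right_mono[of 1, simplified]) auto
  finally show "c\<^sub>0 \<le> 1" using hi_pos by (simp add: c\<^sub>0_def)
qed

text \<open>Nash at a fixed scale \<open>r\<close> is linear: the excess of \<open>norm2\<close>
  over the level \<open>V / r ^ N\<close> is at most a multiple of \<open>r\<^sup>2\<close> times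
  the energy, and \<open>norm2_Suc\<close> removes half of the energy in one step.\<close>

lemma norm2_step:
  assumes r: "r > 0"
  shows "norm2 x (Suc k) - V / real r ^ CARD('c)
     \<le> (1 - c\<^sub>0 / real r ^ 2) * (norm2 x k - V / real r ^ CARD('c))"
proof -
  obtain A where A: "finite A" "\<And>z. z \<notin> A \<Longrightarrow> heat x k z = 0" using heat_finite by blast
  let ?g = "heat x k" and ?H = "halo A" and ?N = "CARD('c)"
  let ?D = "\<Sum>\<^sub>\<infinity>z. \<Sum>c\<in>UNIV. (?g (move z (c, 1)) - ?g z)\<^sup>2"
  have g: "?g z = 0" if "z \<notin> ?H" for z using A that subset_halo[of A] by blast
  have gm: "?g (move z e) = 0" if "z \<notin> ?H" "e \<in> dirs" for z e
    using A that by (auto simp: halo_def)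
  have D: "lo * \<kappa> * ?D \<le> energy ?g ?g"
  proof -
    have "lo * \<kappa> * ?D = (\<Sum>z\<in>?H. \<Sum>c\<in>UNIV. lo * \<kappa> * (?g (move z (c, 1)) - ?g z)\<^sup>2)"
      using A g gm by (subst infsum_finite_support[of ?H]) (auto simp: sum_distrib_left dirs_def)
    also have "\<dots> \<le> (\<Sum>z\<in>?H. \<Sum>c\<in>UNIV. w z * q z (c, 1) * (?g (move z (c, 1)) - ?g z)\<^sup>2)"
      using w \<kappa> by (intro sum_mono mult_right_mono mult_mono) (auto simp: dirs_def less_imp_le[OF w_pos])
    also have "\<dots> = (\<Sum>z\<in>?H. \<Sum>e\<in>UNIV \<times> {1}. w z * q z e * (?g (move z e) - ?g z)\<^sup>2)"
      by (intro sum.cong refl sum.reindex_bij_witness[where i = fst and j = "\<lambda>c. (c, 1)"]) auto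
    also have "\<dots> \<le> (\<Sum>z\<in>?H. \<Sum>e\<in>dirs. w z * q z e * (?g (move z e) - ?g z)\<^sup>2)"
      by (intro sum_mono sum_mono2)
         (auto simp: dirs_def intro!: mult_nonneg_nonneg less_imp_le[OF w_pos] less_imp_le[OF q_pos])
    also have "\<dots> = energy ?g ?g" unfolding energy_def using A g gm
      by (subst infsum_finite_support[of ?H]) (auto simp: power2_eq_square mult_ac intro!: sum.neutral)
    finally show ?thesis .
  qed
  have "norm2 x k \<le> hi * (\<Sum>\<^sub>\<infinity>z. (?g z)\<^sup>2)"
  proof -
    have "norm2 x k = (\<Sum>z\<in>A. w z * (?g z)\<^sup>2)"
      unfolding norm2_def using A by (intro infsum_finite_support) auto
    also have "\<dots> \<le> (\<Sum>z\<in>A. hi * (?g z)\<^sup>2)" using w by (intro sum_mono mult_right_mono) auto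
    also have "\<dots> = hi * (\<Sum>\<^sub>\<infinity>z. (?g z)\<^sup>2)"
      using A by (subst infsum_finite_support[of A]) (auto simp: sum_distrib_left)
    finally show ?thesis .
  qed
  also have "(\<Sum>\<^sub>\<infinity>z. (?g z)\<^sup>2) \<le> 2 ^ ?N * real r ^ 2 * ?D + (\<Sum>\<^sub>\<infinity>z. \<bar>?g z\<bar>)\<^sup>2 / real r ^ ?N"
    using A by (intro nash_lattice[OF r]) auto
  also have "(\<Sum>\<^sub>\<infinity>z. \<bar>?g z\<bar>)\<^sup>2 \<le> (hi / lo)\<^sup>2"
    by (intro power_mono heat_l1 infsum_nonneg) auto
  finally have "norm2 x k \<le> hi * (2 ^ ?N * real r ^ 2 * ?D + (hi / lo)\<^sup>2 / real r ^ ?N)"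
    using hi_pos by (simp add: divide_right_mono)
  then have "norm2 x k - V / real r ^ ?N \<le> hi * 2 ^ ?N * real r ^ 2 * ?D"
    by (simp add: V_def algebra_simps)
  then have "c\<^sub>0 / real r ^ 2 * (norm2 x k - V / real r ^ ?N) \<le> c\<^sub>0 / real r ^ 2 * (hi * 2 ^ ?N * real r ^ 2 * ?D)"
    using c0 by (intro mult_left_mono) auto
  also have "\<dots> = lo * \<kappa> * ?D / 2"
    using hi_pos r by (simp add: c\<^sub>0_def field_simps)
  also have "\<dots> \<le> energy ?g ?g / 2" using D by simp
  finally show ?thesis using norm2_Suc[of x k] by (simp add: algebra_simps)
qed

lemma norm2_steps:
  assumes r: "r > 0"
  shows "norm2 x (k + n) \<le> V / real r ^ CARD('c) + exp (- c\<^sub>0 * real n / real r ^ 2) * norm2 x k"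
proof -
  let ?v = "V / real r ^ CARD('c)" and ?q = "1 - c\<^sub>0 / real r ^ 2"
  have v: "0 \<le> ?v" using hi_pos by (simp add: V_def)
  have "1 \<le> real r ^ 2" using r by (intro one_le_power) simp
  then have "c\<^sub>0 \<le> real r ^ 2" using c0 by linarith
  \<comment> \<open>\<open>c\<^sub>0 \<le> 1\<close> keeps the contraction factor nonnegative, so
    that the one-step inequality can be iterated.\<close>
  then have q: "0 \<le> ?q" using r by simp
  have "norm2 x (k + n) - ?v \<le> ?q ^ n * (norm2 x k - ?v)"
  proof (induction n)
    case (Suc n)
    have "norm2 x (k + Suc n) - ?v \<le> ?q * (norm2 x (k + n) - ?v)"
      using norm2_step[OF r, of x "k + n"] by simp
    also have "\<dots> \<le> ?q * (?q ^ n * (norm2 x k - ?v))" using q Suc.IH by (rule mult_left_mono[rotated])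
    finally show ?case by (simp add: mult.assoc)
  qed simp
  also have "\<dots> \<le> ?q ^ n * norm2 x k" using v q by (intro mult_left_mono) auto
  also have "\<dots> \<le> exp (- c\<^sub>0 / real r ^ 2) ^ n * norm2 x k"
    using q exp_ge_add_one_self[of "- c\<^sub>0 / real r ^ 2"] norm2_nonneg
    by (intro mult_right_mono power_mono) auto
  also have "\<dots> = exp (- c\<^sub>0 * real n / real r ^ 2) * norm2 x k"
    by (simp add: mult_ac flip: exp_of_nat_mult)
  finally show ?thesis by simp
qed

text \<open>
  Between the times \<open>a 4\<^sup>j\<close> and \<open>a 4\<^sup>j\<^sup>+\<^sup>1\<close> the Nash inequality is used at the single scale \<open>2\<^sup>j\<close>;
  a large \<open>a\<close> makes the contraction beat the factor \<open>2\<^sup>N\<close> lost from one \<open>j\<close> to the next.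
\<close>

lemma norm2_decay:
  "\<exists>a>0. \<exists>M>0. \<forall>j x. norm2 x (a * 4 ^ j) \<le> M / (2 ^ j) ^ CARD('c)"
proof -
  let ?N = "CARD('c)"
  \<comment> \<open>From \<open>a * 4 ^ j\<close> to \<open>a * 4 ^ Suc j\<close> there are
    \<open>3 * a * 4 ^ j\<close> steps, which at scale \<open>2 ^ j\<close> contract by
    \<open>exp (- c\<^sub>0 * 3 * a)\<close>. Asking for half of the factor
    \<open>1 / 2 ^ ?N\<close> leaves the other half to the \<open>V\<close> term.\<close>
  obtain a :: nat where a: "exp (- c\<^sub>0 * 3 * real a) \<le> 1 / 2 / 2 ^ ?N" "a > 0"
  proof -
    obtain a :: nat where a: "real a > ln (2 * 2 ^ ?N) / (3 * c\<^sub>0)" using reals_Archimedean2 by blast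
    then have "ln (2 * 2 ^ ?N) < c\<^sub>0 * 3 * real a" using c0 by (simp add: field_simps)
    then have "exp (- c\<^sub>0 * 3 * real a) \<le> exp (- ln (2 * 2 ^ ?N))" by simp
    also have "\<dots> = 1 / 2 / 2 ^ ?N" by (simp add: exp_minus field_simps)
    finally have "exp (- c\<^sub>0 * 3 * real a) \<le> 1 / 2 / 2 ^ ?N" .
    moreover have "a > 0"
    proof -
      have "1 \<le> 2 * (2::real) ^ ?N" using one_le_power[of "2::real" ?N] by linarith
      then have "0 \<le> ln (2 * 2 ^ ?N :: real)" by simp
      then have "0 \<le> ln (2 * 2 ^ ?N) / (3 * c\<^sub>0)" using c0 by simp
      then show ?thesis using a by linarith
    qed
    ultimately show thesis by (rule that)
  qed
  \<comment> \<open>\<open>hi\<close> covers \<open>j = 0\<close>, where \<open>norm2\<close> is at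
    most \<open>w x\<close>; the second summand makes the \<open>V\<close> term at most half of the
    next bound.\<close>
  define M where "M = hi + 2 * 2 ^ ?N * V"
  have V0: "0 \<le> V" using hi_pos by (simp add: V_def)
  then have "0 \<le> 2 * 2 ^ ?N * V" by simp
  then have M: "0 < M" "hi \<le> M" "V \<le> M / 2 / 2 ^ ?N" using hi_pos by (auto simp: M_def field_simps)
  have "norm2 x (a * 4 ^ j) \<le> M / (2 ^ j) ^ ?N" for j x
  proof (induction j)
    case 0
    have "norm2 x a \<le> norm2 x 0"
    proof (induction a)
      case (Suc a)
      then show ?case using norm2_Suc[of x a] energy_nonneg[of "heat x a"] by linarith
    qed simp
    also have "\<dots> = w x" unfolding norm2_def
      by (subst infsum_finite_support[of "{x}"]) (auto simp: heat_def)
    finally show ?case using w(3)[of x] M by simp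
  next
    case (Suc j)
    have "norm2 x (a * 4 ^ Suc j) = norm2 x (a * 4 ^ j + 3 * a * 4 ^ j)" by (simp add: algebra_simps)
    also have "\<dots> \<le> V / real (2 ^ j) ^ ?N
        + exp (- c\<^sub>0 * real (3 * a * 4 ^ j) / real (2 ^ j) ^ 2) * norm2 x (a * 4 ^ j)"
      by (rule norm2_steps) simp
    also have "- c\<^sub>0 * real (3 * a * 4 ^ j) / real (2 ^ j) ^ 2 = - c\<^sub>0 * 3 * real a"
      by (simp add: power_mult_distrib[symmetric] power2_eq_square)
    also have "exp (- c\<^sub>0 * 3 * real a) * norm2 x (a * 4 ^ j) \<le> 1 / 2 / 2 ^ ?N * (M / (2 ^ j) ^ ?N)"
      using a Suc.IH norm2_nonneg by (intro mult_mono) auto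
    also have "V / real (2 ^ j) ^ ?N \<le> M / 2 / 2 ^ ?N / (2 ^ j) ^ ?N"
      using divide_right_mono[OF M(3), of "(2 ^ j) ^ ?N"] by simp
    finally show ?case by (simp add: field_simps power_mult_distrib)
  qed
  then show ?thesis using a(2) M(1) by blast
qed

text \<open>Cauchy-Schwarz: a small \<open>\<ell>\<^sup>2\<close> norm forbids concentration, so a
  set that carries half of the law at time \<open>k\<close> has many points.\<close>

lemma card_lower_bound:
  assumes F: "finite F" and half: "1 / 2 \<le> (K ^^ k) (indicator F) x"
  shows "lo\<^sup>2 / 4 \<le> real (card F) * hi * norm2 x k"
proof -
  obtain A where A: "finite A" "\<And>z. z \<notin> A \<Longrightarrow> heat x k z = 0" using heat_finite by blast
  have "lo / 2 \<le> w x * (K ^^ k) (indicator F) x"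
    using mult_mono[OF w(2)[of x] half] w(1) w_pos[of x] by simp
  also have "\<dots> = (\<Sum>\<^sub>\<infinity>z. w z * heat x k z * indicator F z)" by (rule heat_pair[symmetric])
  also have "\<dots> = (\<Sum>z\<in>F. w z * heat x k z)"
    using F by (subst infsum_finite_support[of F]) (auto simp: indicator_def)
  finally have "(lo / 2)\<^sup>2 \<le> (\<Sum>z\<in>F. w z * heat x k z)\<^sup>2"
    using w(1) by (intro power_mono) auto
  also have "\<dots> \<le> (\<Sum>z\<in>F. (w z * heat x k z)\<^sup>2) * card F"
    by (rule sum_squared_le_sum_of_squares)
  also have "(\<Sum>z\<in>F. (w z * heat x k z)\<^sup>2) \<le> (\<Sum>z\<in>F. hi * (w z * (heat x k z)\<^sup>2))"
  proof (rule sum_mono)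
    fix z
    have "(w z * heat x k z)\<^sup>2 = w z * (w z * (heat x k z)\<^sup>2)" by (simp add: power2_eq_square)
    also have "\<dots> \<le> hi * (w z * (heat x k z)\<^sup>2)"
      using w(3) w_pos by (intro mult_right_mono) (auto simp: less_imp_le)
    finally show "(w z * heat x k z)\<^sup>2 \<le> hi * (w z * (heat x k z)\<^sup>2)" .
  qed
  also have "\<dots> \<le> (\<Sum>z\<in>F \<union> A. hi * (w z * (heat x k z)\<^sup>2))"
    using F A hi_pos w_pos by (intro sum_mono2) (auto simp: less_imp_le)
  also have "\<dots> = hi * norm2 x k"
    unfolding norm2_def using F A
    by (subst infsum_finite_support[of "F \<union> A"]) (auto simp: sum_distrib_left)
  finally have "(lo / 2)\<^sup>2 \<le> hi * norm2 x k * real (card F)" by (simp add: mult_right_mono)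
  then show ?thesis by (simp add: power_divide mult_ac)
qed

text \<open>Chebyshev: the expected squared norm grows by at most \<open>C\<close> in a step, and
  outside the box the squared norm is at least \<open>R\<^sup>2\<close>.\<close>

lemma exit_probability:
  assumes "R > 0"
  shows "(K ^^ k) (indicator (- {z. \<forall>c. \<bar>z c\<bar> \<le> int R})) x
          \<le> ((\<Sum>c\<in>UNIV. (real_of_int (x c))\<^sup>2) + real k * C) / (real R)\<^sup>2"
proof -
  let ?Q = "\<lambda>z. \<Sum>c\<in>UNIV. (real_of_int (z c))\<^sup>2"
  have KQ: "K ?Q z \<le> ?Q z + C" for z
  proof -
    have "?Q (move z e) - ?Q z = real_of_int ((move z e (fst e))\<^sup>2 - (z (fst e))\<^sup>2)" for e
    proof -
      have "?Q (move z e) = (real_of_int (move z e (fst e)))\<^sup>2 + (\<Sum>c\<in>UNIV - {fst e}. (real_of_int (move z e c))\<^sup>2)"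
        by (rule sum.remove) auto
      also have "(\<Sum>c\<in>UNIV - {fst e}. (real_of_int (move z e c))\<^sup>2) = (\<Sum>c\<in>UNIV - {fst e}. (real_of_int (z c))\<^sup>2)"
        by (rule sum.cong) (auto simp: move_def)
      also have "\<dots> = ?Q z - (real_of_int (z (fst e)))\<^sup>2"
        by (subst (2) sum.remove[of _ "fst e"]) auto
      finally show ?thesis by simp
    qed
    then show ?thesis using drift[of z] by (simp add: K_def)
  qed
  have KnQ: "(K ^^ k) ?Q x \<le> ?Q x + real k * C" for x
  proof (induction k arbitrary: x)
    case (Suc k)
    have "(K ^^ Suc k) ?Q x \<le> K (\<lambda>z. ?Q z + real k * C) x"
      using Suc.IH by (auto intro: K_mono)
    also have "\<dots> = K ?Q x + real k * C" by (simp add: K_add)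
    also have "\<dots> \<le> ?Q x + C + real k * C" using KQ by simp
    finally show ?case by (simp add: algebra_simps)
  qed simp
  have ind: "indicator (- {z. \<forall>c. \<bar>z c\<bar> \<le> int R}) z \<le> 1 / (real R)\<^sup>2 * ?Q z" for z :: "'c \<Rightarrow> int"
  proof (cases "\<forall>c. \<bar>z c\<bar> \<le> int R")
    case False
    then obtain c where "int R \<le> \<bar>z c\<bar>" by (metis linear)
    then have "real R \<le> \<bar>real_of_int (z c)\<bar>" by linarith
    then have "(real R)\<^sup>2 \<le> \<bar>real_of_int (z c)\<bar>\<^sup>2" by (intro power_mono) auto
    also have "\<dots> \<le> ?Q z" using member_le_sum[of c UNIV "\<lambda>c. (real_of_int (z c))\<^sup>2"] by simp
    finally show ?thesis using False assms by (simp add: divide_simps)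
  qed (simp add: sum_nonneg)
  have "(K ^^ k) (indicator (- {z. \<forall>c. \<bar>z c\<bar> \<le> int R})) x \<le> (K ^^ k) (\<lambda>z. 1 / (real R)\<^sup>2 * ?Q z) x"
    by (intro Kn_mono ind)
  also have "\<dots> = 1 / (real R)\<^sup>2 * (K ^^ k) ?Q x" by (simp only: Kn_cmult)
  also have "\<dots> \<le> 1 / (real R)\<^sup>2 * (?Q x + real k * C)" using KnQ by (intro mult_left_mono) auto
  finally show ?thesis by simp
qed

end

section \<open>Energy of the logarithm and the Liouville theorem\<close>

context elliptic_walk
begin

lemma box_eq_cube: "{z. \<forall>c. \<bar>z c\<bar> \<le> int R} = cube (\<lambda>_::'c. - int R) (2 * R + 1)"
  unfolding cube_def by (auto simp: abs_le_iff) (smt (verit))+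

text \<open>
  Test harmonicity of \<open>v\<close> against \<open>\<phi>\<^sup>2 / v\<close>.  On an edge with end values \<open>v, v'\<close> and \<open>\<phi>, \<phi>'\<close>,
  \<open>(\<phi>'\<^sup>2 / v' - \<phi>\<^sup>2 / v) (v' - v) = (\<phi>' - \<phi>)\<^sup>2 - (\<phi>' v - \<phi> v')\<^sup>2 / (v v')\<close>,
  and where \<open>\<phi> = 1\<close> the last term dominates the squared gradient of \<open>ln v\<close>.
\<close>

lemma log_caccioppoli:
  assumes v: "K v = v" "\<And>z. 0 < v z" and R: "R > 0"
  shows "(\<Sum>c\<in>UNIV. cube_energy (\<lambda>_. - int R) (2 * R + 1) (\<lambda>z. ln (v z)) c)
          \<le> 2 * hi * 7 ^ CARD('c) / (lo * \<kappa>) * real R ^ CARD('c) / (real R)\<^sup>2"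
proof -
  define \<phi> :: "('c \<Rightarrow> int) \<Rightarrow> real" where "\<phi> = cutoff R"
  \<comment> \<open>Three nested boxes: \<open>\<phi>\<close> is 1 on \<open>?B\<close> and vanishes
    off \<open>?A\<close>, and \<open>?T\<close> contains \<open>halo ?A\<close>, hence every edge
    on which \<open>\<phi>\<close> is not 0 at both ends. The bound
    \<open>6 * R + 1 \<le> 7 * R\<close> on the side of \<open>?T\<close> gives the 7.\<close>
  let ?B = "{z :: 'c \<Rightarrow> int. \<forall>c. \<bar>z c\<bar> \<le> int R}"
  let ?Q = "cube (\<lambda>_::'c. - int R) (2 * R + 1)"
  let ?A = "{z :: 'c \<Rightarrow> int. \<forall>c. \<bar>z c\<bar> \<le> int (2 * R)}"
  let ?T = "{z :: 'c \<Rightarrow> int. \<forall>c. \<bar>z c\<bar> \<le> int (3 * R)}"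
  have fin: "finite ?A" "finite ?T" unfolding box_eq_cube by auto
  have \<phi>A: "\<phi> z = 0" if "z \<notin> ?A" for z
  proof -
    from that obtain c where "\<not> \<bar>z c\<bar> \<le> int (2 * R)" by blast
    then have "2 * int R \<le> \<bar>z c\<bar>" by simp
    then show ?thesis using R unfolding \<phi>_def by (intro cutoff_zero) auto
  qed
  have HT: "halo ?A \<subseteq> ?T"
  proof
    fix z assume "z \<in> halo ?A"
    then consider "z \<in> ?A" | e where "e \<in> dirs" "move z e \<in> ?A" by (auto simp: halo_def)
    then show "z \<in> ?T"
    proof cases
      case 1
      then show ?thesis by (auto intro: order_trans)
    next
      case 2
      have "\<bar>z c\<bar> \<le> int (3 * R)" for c
      proof -
        have "\<bar>move z e c\<bar> \<le> int (2 * R)" "\<bar>snd e\<bar> = 1" using 2 by (auto simp: dirs_def)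
        then show ?thesis using R by (cases "c = fst e") (auto simp: move_def)
      qed
      then show ?thesis by blast
    qed
  qed
  have out: "\<phi> z = 0" "e \<in> dirs \<Longrightarrow> \<phi> (move z e) = 0" if "z \<notin> ?T" for z e
  proof -
    have z: "z \<notin> halo ?A" using that HT by blast
    show "\<phi> z = 0" using z subset_halo[of ?A] by (intro \<phi>A) blast
    show "\<phi> (move z e) = 0" if "e \<in> dirs" using z that by (intro \<phi>A) (auto simp: halo_def)
  qed
  define g where "g z = (\<phi> z)\<^sup>2 / v z" for z
  define P where "P z e = w z * q z e * (\<phi> (move z e) - \<phi> z)\<^sup>2" for z e
  define S where "S z e = w z * q z e * ((\<phi> (move z e) * v z - \<phi> z * v (move z e))\<^sup>2 / (v z * v (move z e)))" for z e
  have S0: "0 \<le> S z e" if "e \<in> dirs" for z e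
    using v(2)[of z] v(2)[of "move z e"] q_pos[OF that, of z] w_pos[of z] by (simp add: S_def)
  have "energy g v = 0"
    using energy_byparts(2)[of ?A g v] fin \<phi>A v(1) by (simp add: g_def)
  moreover have "energy g v = (\<Sum>z\<in>?T. \<Sum>e\<in>dirs. P z e - S z e)"
  proof -
    have alg: "w z * q z e * (g (move z e) - g z) * (v (move z e) - v z) = P z e - S z e" for z e
      using v(2)[of z] v(2)[of "move z e"]
      by (simp add: g_def P_def S_def field_simps power2_eq_square)
    show ?thesis unfolding energy_def alg using fin(2)
      by (rule infsum_finite_support) (auto intro!: sum.neutral simp: P_def S_def out)
  qed
  ultimately have eq: "(\<Sum>z\<in>?T. \<Sum>e\<in>dirs. S z e) = (\<Sum>z\<in>?T. \<Sum>e\<in>dirs. P z e)"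
    by (simp add: sum_subtractf)
  have "(\<Sum>z\<in>?T. \<Sum>e\<in>dirs. P z e) \<le> (\<Sum>z\<in>?T. hi / 2 / (real R)\<^sup>2)"
  proof (rule sum_mono)
    fix z
    have "(\<Sum>e\<in>dirs. P z e) \<le> (\<Sum>e\<in>dirs. hi * q z e * (1 / (real R)\<^sup>2))"
    proof (rule sum_mono)
      fix e :: "'c \<times> int" assume e: "e \<in> dirs"
      have "(\<phi> (move z e) - \<phi> z)\<^sup>2 = \<bar>\<phi> (move z e) - \<phi> z\<bar>\<^sup>2" by simp
      also have "\<dots> \<le> (1 / real R)\<^sup>2"
        unfolding \<phi>_def using R e by (intro power_mono cutoff_lipschitz) auto
      finally show "P z e \<le> hi * q z e * (1 / (real R)\<^sup>2)"
        unfolding P_def using q_pos[OF e, of z] w_pos[of z] w(3)[of z] hi_pos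
        by (intro mult_mono) (auto simp: power_divide)
    qed
    also have "\<dots> = hi / (real R)\<^sup>2 * (\<Sum>e\<in>dirs. q z e)"
      by (simp add: sum_distrib_left sum_divide_distrib)
    also have "\<dots> \<le> hi / (real R)\<^sup>2 * (1 / 2)"
      using hi_pos by (intro mult_left_mono lazy) auto
    finally show "(\<Sum>e\<in>dirs. P z e) \<le> hi / 2 / (real R)\<^sup>2" by simp
  qed
  also have "\<dots> = real ((2 * (3 * R) + 1) ^ CARD('c)) * (hi / 2 / (real R)\<^sup>2)"
    unfolding box_eq_cube by (simp add: card_cube)
  also have "\<dots> \<le> (7 * real R) ^ CARD('c) * (hi / 2 / (real R)\<^sup>2)"
  proof (intro mult_right_mono)
    show "real ((2 * (3 * R) + 1) ^ CARD('c)) \<le> (7 * real R) ^ CARD('c)"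
      unfolding of_nat_power using R by (intro power_mono) auto
  qed (use hi_pos in auto)
  finally have up: "(\<Sum>z\<in>?T. \<Sum>e\<in>dirs. S z e) \<le> (7 * real R) ^ CARD('c) * (hi / 2 / (real R)\<^sup>2)"
    unfolding eq .
  have "(lo * \<kappa> / 4) * (\<Sum>c\<in>UNIV. cube_energy (\<lambda>_. - int R) (2 * R + 1) (\<lambda>z. ln (v z)) c)
     = (\<Sum>c\<in>UNIV. \<Sum>u | u \<in> ?Q \<and> u(c := u c + 1) \<in> ?Q. lo * \<kappa> / 4 * (ln (v (u(c := u c + 1))) - ln (v u))\<^sup>2)"
    unfolding cube_energy_def by (simp add: sum_distrib_left)
  also have "\<dots> \<le> (\<Sum>c\<in>UNIV. \<Sum>u | u \<in> ?Q \<and> u(c := u c + 1) \<in> ?Q. S u (c, 1))"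
  proof (intro sum_mono)
    fix c u assume "u \<in> {u. u \<in> ?Q \<and> u(c := u c + 1) \<in> ?Q}"
    then have "u \<in> ?B" "move u (c, 1) \<in> ?B" by (auto simp: box_eq_cube move_def)
    then have one: "\<phi> u = 1" "\<phi> (move u (c, 1)) = 1"
      using R by (auto simp: \<phi>_def intro!: cutoff_one)
    let ?v = "v u" and ?v' = "v (move u (c, 1))"
    have "(ln ?v' - ln ?v)\<^sup>2 / 4 \<le> (?v - ?v')\<^sup>2 / (?v * ?v')"
      using ln_diff_square_le[of ?v' ?v] v(2) by (simp add: power2_commute mult.commute)
    then have "lo * \<kappa> * ((ln ?v' - ln ?v)\<^sup>2 / 4) \<le> w u * q u (c, 1) * ((?v - ?v')\<^sup>2 / (?v * ?v'))"
      using w \<kappa> q_pos[of "(c, 1)" u] w_pos[of u] by (intro mult_mono) (auto simp: dirs_def)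
    then show "lo * \<kappa> / 4 * (ln (v (u(c := u c + 1))) - ln (v u))\<^sup>2 \<le> S u (c, 1)"
      by (simp add: S_def one) (simp add: move_def)
  qed
  also have "\<dots> \<le> (\<Sum>c\<in>UNIV. \<Sum>u\<in>?T. S u (c, 1))"
  proof (intro sum_mono sum_mono2)
    show "{u. u \<in> ?Q \<and> u(c := u c + 1) \<in> ?Q} \<subseteq> ?T" for c
      unfolding box_eq_cube[symmetric] by (auto intro: order_trans)
  qed (use fin in \<open>auto simp: dirs_def intro!: S0\<close>)
  also have "\<dots> = (\<Sum>u\<in>?T. \<Sum>c\<in>UNIV. S u (c, 1))" by (rule sum.swap)
  also have "\<dots> = (\<Sum>u\<in>?T. \<Sum>e\<in>UNIV \<times> {1}. S u e)"
    by (intro sum.cong refl sum.reindex_bij_witness[where i = fst and j = "\<lambda>c. (c, 1)"]) auto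
  also have "\<dots> \<le> (\<Sum>u\<in>?T. \<Sum>e\<in>dirs. S u e)"
    by (intro sum_mono sum_mono2) (auto intro!: S0 simp: dirs_def)
  also note up
  finally have "(lo * \<kappa> / 4) * (\<Sum>c\<in>UNIV. cube_energy (\<lambda>_. - int R) (2 * R + 1) (\<lambda>z. ln (v z)) c)
     \<le> (7 * real R) ^ CARD('c) * (hi / 2 / (real R)\<^sup>2)" .
  then have "(\<Sum>c\<in>UNIV. cube_energy (\<lambda>_. - int R) (2 * R + 1) (\<lambda>z. ln (v z)) c)
     \<le> (7 * real R) ^ CARD('c) * (hi / 2 / (real R)\<^sup>2) / (lo * \<kappa> / 4)"
    using w(1) \<kappa>(1) by (subst pos_le_divide_eq) (auto simp: mult.commute)
  also have "\<dots> = 2 * hi * 7 ^ CARD('c) / (lo * \<kappa>) * real R ^ CARD('c) / (real R)\<^sup>2"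
    by (simp add: power_mult_distrib mult_ac)
  finally show ?thesis .
qed

text \<open>Poincare contributes \<open>R ^ (N + 2)\<close> and the logarithmic energy
  \<open>R ^ N / R\<^sup>2\<close>. The product is the squared volume of the box up to a constant,
  so at no scale can two sets of positive density be separated by a large gap \<open>T\<close> of
  \<open>ln v\<close>. The constant is \<open>2 * 3\<^sup>2 * (2 * 3 * 7) ^ N\<close>, apart from
  \<open>hi / (lo * \<kappa>)\<close>.\<close>

lemma box_poincare_log:
  assumes v: "K v = v" "\<And>z. 0 < v z" and R: "R > 0"
    and F: "F1 \<subseteq> {z. \<forall>c. \<bar>z c\<bar> \<le> int R}" "F2 \<subseteq> {z. \<forall>c. \<bar>z c\<bar> \<le> int R}"
    and T: "0 \<le> T" "\<And>z z'. z \<in> F1 \<Longrightarrow> z' \<in> F2 \<Longrightarrow> T \<le> ln (v z) - ln (v z')"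
  shows "real (card F1) * real (card F2) * T\<^sup>2
          \<le> 18 * hi * 42 ^ CARD('c) / (lo * \<kappa>) * (real R ^ CARD('c))\<^sup>2"
proof -
  let ?Q = "cube (\<lambda>_::'c. - int R) (2 * R + 1)" and ?N = "CARD('c)"
  have "real (card F1) * real (card F2) * T\<^sup>2 = (\<Sum>z'\<in>F2. \<Sum>z\<in>F1. T\<^sup>2)" by simp
  also have "\<dots> \<le> (\<Sum>z'\<in>F2. \<Sum>z\<in>F1. (ln (v z) - ln (v z'))\<^sup>2)"
    using T by (intro sum_mono power_mono) auto
  also have "\<dots> \<le> (\<Sum>z'\<in>?Q. \<Sum>z\<in>F1. (ln (v z) - ln (v z'))\<^sup>2)"
    using F unfolding box_eq_cube by (intro sum_mono2) (auto intro!: sum_nonneg)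
  also have "\<dots> \<le> (\<Sum>z'\<in>?Q. \<Sum>z\<in>?Q. (ln (v z) - ln (v z'))\<^sup>2)"
    using F unfolding box_eq_cube by (intro sum_mono sum_mono2) auto
  also have "\<dots> \<le> 2 ^ ?N * real (2 * R + 1) ^ (?N + 2)
      * (\<Sum>c\<in>UNIV. cube_energy (\<lambda>_. - int R) (2 * R + 1) (\<lambda>z. ln (v z)) c)"
    by (rule poincare_cube)
  also have "\<dots> \<le> 2 ^ ?N * (3 * real R) ^ (?N + 2)
      * (2 * hi * 7 ^ ?N / (lo * \<kappa>) * real R ^ ?N / (real R)\<^sup>2)"
    using R by (intro mult_mono mult_left_mono power_mono log_caccioppoli[OF v R])
      (auto intro!: sum_nonneg cube_energy_nonneg)
  also have "\<dots> = 18 * hi * (2 ^ ?N * 3 ^ ?N * 7 ^ ?N) / (lo * \<kappa>) * (real R ^ ?N)\<^sup>2"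
    using R w(1) \<kappa>(1) by (simp add: power_add power_mult_distrib field_simps power2_eq_square)
  also have "2 ^ ?N * 3 ^ ?N * 7 ^ ?N = (42::real) ^ ?N"
    by (simp flip: power_mult_distrib)
  finally show ?thesis .
qed

text \<open>\<open>D\<close> depends on the walk only. With \<open>\<eta> = exp (- T) / 4\<close>,
  Markov's inequality shows that at a suitable time the walk from \<open>x\<close> is in
  \<open>{h \<ge> 1 / 2}\<close> and the walk from \<open>y\<close> in
  \<open>{h \<le> \<eta>}\<close>, inside one box, each with probability at least 1/2. So both sets
  have positive density there, and \<open>ln (h + \<eta>)\<close> differs by \<open>T\<close>
  between them. The square in the hypothesis on \<open>h y\<close> pays for Markov's
  inequality.\<close>

lemma oscillation_bound:
  "\<exists>D. \<forall>T>0. \<forall>h x y. K h = h \<longrightarrow> (\<forall>z. 0 \<le> h z \<and> h z \<le> 1) \<longrightarrow> 7 / 8 \<le> h x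
      \<longrightarrow> h y \<le> (exp (- T) / 4)\<^sup>2 \<longrightarrow> T\<^sup>2 \<le> D"
proof -
  let ?N = "CARD('c)"
  obtain a M where a: "a > 0" and M: "M > 0" and decay: "\<And>j x. norm2 x (a * 4 ^ j) \<le> M / (2 ^ j) ^ ?N"
    using norm2_decay by blast
  \<comment> \<open>Makes the drift up to time \<open>a * 4 ^ j\<close> at most an eighth of
    \<open>R\<^sup>2\<close> for the radius \<open>R = L * 2 ^ j\<close>.\<close>
  obtain L :: nat where L: "real L \<ge> 8 * real a * \<bar>C\<bar> + 1" using real_arch_simple by blast
  have L1: "L > 0"
  proof -
    have "0 \<le> 8 * real a * \<bar>C\<bar>" by simp
    then have "0 < real L" using L by linarith
    then show ?thesis by simp
  qed
  have L2: "8 * real a * \<bar>C\<bar> \<le> (real L)\<^sup>2"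
  proof -
    have "real L \<le> real L * real L" using L1 by simp
    then show ?thesis using L by (simp add: power2_eq_square)
  qed
  \<comment> \<open>The density forced by \<open>card_lower_bound\<close> when \<open>norm2\<close>
    is at most \<open>M / (2 ^ j) ^ ?N\<close>.\<close>
  define b where "b = lo\<^sup>2 / (4 * hi * M)"
  have b: "b > 0" using w(1) hi_pos M by (simp add: b_def)
  define D where "D = 18 * hi * 42 ^ ?N / (lo * \<kappa>) * (real L ^ ?N)\<^sup>2 / b\<^sup>2"
  have "T\<^sup>2 \<le> D" if T: "T > 0" and h: "K h = h" "\<And>z. 0 \<le> h z" "\<And>z. h z \<le> 1"
    and x: "7 / 8 \<le> h x" and y: "h y \<le> (exp (- T) / 4)\<^sup>2" for T h x y
  proof -
    \<comment> \<open>Chosen so that \<open>ln (1 / 2) - ln (2 * \<eta>) = T\<close>.\<close>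
    define \<eta> where "\<eta> = exp (- T) / 4"
    have \<eta>: "0 < \<eta>" "\<eta> \<le> 1 / 4" using T by (auto simp: \<eta>_def)
    let ?s = "\<lambda>x::'c \<Rightarrow> int. \<Sum>c\<in>UNIV. (real_of_int (x c))\<^sup>2"
    \<comment> \<open>\<open>x\<close> and \<open>y\<close> are arbitrary; a large \<open>j\<close>
      makes their distance from the origin small at the scale of the box.\<close>
    obtain j :: nat where j: "8 * (?s x + ?s y) < 4 ^ j"
      using real_arch_pow[of 4 "8 * (?s x + ?s y)"] by auto
    define k where "k = a * 4 ^ j"
    define R where "R = L * 2 ^ j"
    have R: "R > 0" using L1 by (simp add: R_def)
    have R2: "(real R)\<^sup>2 = (real L)\<^sup>2 * 4 ^ j"
      by (simp add: R_def power_mult_distrib power2_eq_square flip: power_mult_distrib)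
    let ?B = "{z :: 'c \<Rightarrow> int. \<forall>c. \<bar>z c\<bar> \<le> int R}"
    have exit: "(K ^^ k) (indicator (- ?B)) u \<le> 1 / 4" if "8 * ?s u \<le> 4 ^ j" for u
    proof -
      have "?s u + real k * C \<le> (real R)\<^sup>2 / 4"
      proof -
        have "real k * C \<le> real k * \<bar>C\<bar>" by (intro mult_left_mono) auto
        also have "\<dots> = (8 * real a * \<bar>C\<bar>) * 4 ^ j / 8" by (simp add: k_def)
        also have "\<dots> \<le> (real L)\<^sup>2 * 4 ^ j / 8" using L2 by simp
        finally have "real k * C \<le> (real R)\<^sup>2 / 8" by (simp add: R2)
        moreover have "1 * 4 ^ j \<le> (real L)\<^sup>2 * 4 ^ j" using L1 by (intro mult_right_mono) auto
        then have "?s u \<le> (real R)\<^sup>2 / 8" using that unfolding R2 by linarith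
        ultimately show ?thesis by simp
      qed
      then have "(?s u + real k * C) / (real R)\<^sup>2 \<le> 1 / 4" using R by (simp add: field_simps)
      then show ?thesis using exit_probability[OF R, of k u] by linarith
    qed
    have large: "b * (2 ^ j) ^ ?N \<le> real (card F)"
      if F: "finite F" and half: "1 / 2 \<le> (K ^^ k) (indicator F) u" for F u
    proof -
      have "lo\<^sup>2 / 4 \<le> real (card F) * hi * norm2 u k" by (rule card_lower_bound[OF F half])
      also have "\<dots> \<le> real (card F) * hi * (M / (2 ^ j) ^ ?N)"
        unfolding k_def using hi_pos by (intro mult_left_mono decay) auto
      finally show ?thesis using hi_pos M by (simp add: b_def field_simps)
    qed
    \<comment> \<open>Union bound: outside \<open>G\<close>, either the walk has left the box or
      \<open>f\<close> is at least 1, and each alternative costs at most 1/4.\<close>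
    have three: "(K ^^ k) (indicator G) u \<ge> 1 / 2"
      if "(K ^^ k) f u \<le> 1 / 4" "(K ^^ k) (indicator (- ?B)) u \<le> 1 / 4"
         "\<And>z. 1 \<le> indicator G z + f z + indicator (- ?B) z" for G f u
    proof -
      have "1 = (K ^^ k) (\<lambda>z. 1) u" by simp
      also have "\<dots> \<le> (K ^^ k) (\<lambda>z. indicator G z + f z + indicator (- ?B) z) u"
        by (intro Kn_mono that)
      also have "\<dots> = (K ^^ k) (indicator G) u + (K ^^ k) f u + (K ^^ k) (indicator (- ?B)) u"
        by (simp only: Kn_add)
      finally show ?thesis using that by linarith
    qed
    define F1 where "F1 = ?B \<inter> {z. h z \<ge> 1 / 2}"
    define F2 where "F2 = ?B \<inter> {z. h z \<le> \<eta>}"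
    have fin: "finite F1" "finite F2" unfolding F1_def F2_def box_eq_cube by auto
    have s0: "0 \<le> ?s u" for u by (intro sum_nonneg) auto
    have ex: "8 * ?s x \<le> 4 ^ j" "8 * ?s y \<le> 4 ^ j" using j s0[of x] s0[of y] by auto
    have "1 / 2 \<le> (K ^^ k) (indicator F1) x"
    proof (rule three)
      \<comment> \<open>\<open>2 - 2 * h\<close> is harmonic and dominates the indicator of
        \<open>{h < 1 / 2}\<close>; the value 7/8 makes it at most 1/4 at \<open>x\<close>.\<close>
      have "(K ^^ k) (\<lambda>z. 2 + (-2) * h z) x = 2 + (- 2) * h x"
        using Kn_harmonic[OF h(1)] by (simp only: Kn_add Kn_cmult Kn_const)
      then show "(K ^^ k) (\<lambda>z. 2 + (-2) * h z) x \<le> 1 / 4" using x by simp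
      show "1 \<le> indicator F1 z + (2 + (-2) * h z) + indicator (- ?B) z" for z
        using h(3)[of z] by (auto simp: F1_def indicator_def)
    qed (rule exit[OF ex(1)])
    then have c1: "b * (2 ^ j) ^ ?N \<le> real (card F1)" by (rule large[OF fin(1)])
    have "1 / 2 \<le> (K ^^ k) (indicator F2) y"
    proof (rule three)
      have "(K ^^ k) (\<lambda>z. 1 / \<eta> * h z) y = 1 / \<eta> * h y"
        using Kn_harmonic[OF h(1)] by (simp only: Kn_cmult)
      also have "\<dots> \<le> 1 / \<eta> * \<eta>\<^sup>2" using y \<eta> by (intro mult_left_mono) (auto simp: \<eta>_def)
      also have "\<dots> \<le> 1 / 4" using \<eta> by (simp add: power2_eq_square)
      finally show "(K ^^ k) (\<lambda>z. 1 / \<eta> * h z) y \<le> 1 / 4" .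
      show "1 \<le> indicator F2 z + 1 / \<eta> * h z + indicator (- ?B) z" for z
        using h(2)[of z] \<eta> by (auto simp: F2_def indicator_def field_simps)
    qed (rule exit[OF ex(2)])
    then have c2: "b * (2 ^ j) ^ ?N \<le> real (card F2)" by (rule large[OF fin(2)])
    define v where "v z = h z + \<eta>" for z
    have "real (card F1) * real (card F2) * T\<^sup>2
          \<le> 18 * hi * 42 ^ CARD('c) / (lo * \<kappa>) * (real R ^ CARD('c))\<^sup>2"
    proof (rule box_poincare_log[OF _ _ R])
      show "K v = v" using h(1) by (simp add: v_def[abs_def] K_add fun_eq_iff)
      show "0 < v z" for z using h(2)[of z] \<eta> by (simp add: v_def)
      fix z z' assume "z \<in> F1" "z' \<in> F2"
      then have "1 / 2 \<le> v z" "v z' \<le> 2 * \<eta>" "0 < v z'"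
        using \<eta> h(2)[of z'] by (auto simp: F1_def F2_def v_def)
      then have "ln (1 / 2) \<le> ln (v z)" "ln (v z') \<le> ln (2 * \<eta>)" using \<eta> by auto
      moreover have "ln (1 / 2) - ln (2 * \<eta>) = T"
        by (simp add: \<eta>_def ln_div)
      ultimately show "T \<le> ln (v z) - ln (v z')" by linarith
    qed (use T in \<open>auto simp: F1_def F2_def\<close>)
    moreover have "(b * (2 ^ j) ^ ?N) * (b * (2 ^ j) ^ ?N) * T\<^sup>2 \<le> real (card F1) * real (card F2) * T\<^sup>2"
      using b c1 c2 by (intro mult_right_mono mult_mono) auto
    ultimately have "b\<^sup>2 * T\<^sup>2 * ((2 ^ j) ^ ?N)\<^sup>2
        \<le> 18 * hi * 42 ^ CARD('c) / (lo * \<kappa>) * (real L ^ ?N)\<^sup>2 * ((2 ^ j) ^ ?N)\<^sup>2"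
      by (simp add: R_def power_mult_distrib power2_eq_square mult_ac)
    then have "b\<^sup>2 * T\<^sup>2 \<le> 18 * hi * 42 ^ CARD('c) / (lo * \<kappa>) * (real L ^ ?N)\<^sup>2"
      by (rule mult_right_le_imp_le) simp
    then show ?thesis using b unfolding D_def by (subst pos_le_divide_eq) (auto simp: mult.commute[of "T\<^sup>2"])
  qed
  then show ?thesis by blast
qed

text \<open>Rescaled to infimum 0 and supremum 1, a nonconstant \<open>h\<close> comes arbitrarily
  close to both, attained or not. So \<open>oscillation_bound\<close> would apply with every
  \<open>T\<close>, and \<open>T = \<bar>D\<bar> + 1\<close> already violates it.\<close>

theorem liouville:
  assumes h: "K h = h" and bdd: "\<And>z. \<bar>h z\<bar> \<le> B"
  shows "h x = h y"
proof (rule ccontr)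
  assume ne: "h x \<noteq> h y"
  have ba: "bdd_above (range h)" "bdd_below (range h)"
    using bdd by (auto intro!: bdd_aboveI[of _ B] bdd_belowI[of _ "- B"] simp: abs_le_iff) (smt (verit) bdd)+
  define s where "s = Sup (range h)"
  define i where "i = Inf (range h)"
  have si: "i \<le> h z" "h z \<le> s" for z
    using ba by (auto simp: s_def i_def intro: cInf_lower cSup_upper)
  have lt: "i < s" using si[of x] si[of y] ne by linarith
  define g where "g z = (1 / (s - i)) * h z + (- i / (s - i))" for z
  have g_eq: "g z = (h z - i) / (s - i)" for z using lt by (simp add: g_def diff_divide_distrib)
  have "K g z = (1 / (s - i)) * K h z + (- i / (s - i))" for z
    unfolding g_def[abs_def] by (simp only: K_add K_cmult K_const)
  then have Kg: "K g = g" by (simp add: h g_def fun_eq_iff)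
  have g01: "0 \<le> g z" "g z \<le> 1" for z using si[of z] lt by (auto simp: g_eq)
  have high: "\<exists>z. 1 - \<epsilon> \<le> g z" if "\<epsilon> > 0" for \<epsilon>
  proof -
    have "s - \<epsilon> * (s - i) < s" using that lt by simp
    then obtain z where "s - \<epsilon> * (s - i) < h z" unfolding s_def
      using less_cSup_iff[OF _ ba(1), of "s - \<epsilon> * (s - i)"] by (auto simp: s_def)
    then show ?thesis using lt by (intro exI[of _ z]) (simp add: g_eq field_simps)
  qed
  have low: "\<exists>z. g z \<le> \<epsilon>" if "\<epsilon> > 0" for \<epsilon>
  proof -
    have "i < i + \<epsilon> * (s - i)" using that lt by simp
    then obtain z where "h z < i + \<epsilon> * (s - i)" unfolding i_def
      using cInf_less_iff[OF _ ba(2), of "i + \<epsilon> * (s - i)"] by (auto simp: i_def)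
    then show ?thesis using lt by (intro exI[of _ z]) (simp add: g_eq field_simps)
  qed
  obtain D where D: "\<And>T h x y. T > 0 \<Longrightarrow> K h = h \<Longrightarrow> (\<And>z. 0 \<le> h z \<and> h z \<le> 1) \<Longrightarrow> 7 / 8 \<le> h x
      \<Longrightarrow> h y \<le> (exp (- T) / 4)\<^sup>2 \<Longrightarrow> T\<^sup>2 \<le> D"
    using oscillation_bound by blast
  define T where "T = \<bar>D\<bar> + 1"
  obtain z where z: "7 / 8 \<le> g z" using high[of "1 / 8"] by auto
  obtain z' where z': "g z' \<le> (exp (- T) / 4)\<^sup>2" using low[of "(exp (- T) / 4)\<^sup>2"] by auto
  have "T\<^sup>2 \<le> D" using g01 by (intro D[OF _ Kg _ z z']) (auto simp: T_def)
  moreover have "T * 1 \<le> T * T" by (intro mult_left_mono) (auto simp: T_def)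
  then have "D < T\<^sup>2" by (simp add: T_def power2_eq_square)
  ultimately show False by simp
qed

end

section \<open>Coupling the discrete skeleton\<close>

text \<open>The estimate of the central weight by \<open>1 / sqrt (2 * n + 1)\<close>, squared.
  Consecutive central coefficients have ratio \<open>2 * (2 * n + 1) / (n + 1)\<close>, and
  \<open>(2 * n + 1) * (2 * n + 3) \<le> (2 * n + 2)\<^sup>2\<close> closes the induction.\<close>

lemma central_binomial_square_le: "(real ((2 * n) choose n))\<^sup>2 * (2 * real n + 1) \<le> (4 ^ n)\<^sup>2"
proof (induction n)
  case (Suc n)
  have "Suc (2 * n) - n = Suc n" by simp
  then have "Suc (2 * n) choose n = Suc (2 * n) choose Suc n"
    using binomial_symmetric[of n "Suc (2 * n)"] by simp
  moreover have "(2 * Suc n) choose Suc n = (Suc (2 * n) choose n) + (Suc (2 * n) choose Suc n)"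
    by simp
  ultimately have "(2 * Suc n) choose Suc n = 2 * (Suc (2 * n) choose Suc n)"
    by linarith
  moreover have "Suc n * (Suc (2 * n) choose Suc n) = Suc (2 * n) * ((2 * n) choose n)"
    using Suc_times_binomial_eq[of "2 * n" n] by (simp only: mult.commute)
  ultimately have "Suc n * ((2 * Suc n) choose Suc n) = 2 * (Suc (2 * n) * ((2 * n) choose n))"
    by (simp only: mult.left_commute)
  then have "Suc n * ((2 * Suc n) choose Suc n) = 2 * (2 * n + 1) * ((2 * n) choose n)"
    by (simp only: mult.assoc Suc_eq_plus1)
  then have eq: "real (Suc n) * real ((2 * Suc n) choose Suc n) = 2 * (2 * real n + 1) * real ((2 * n) choose n)"
    by (metis (mono_tags, opaque_lifting) of_nat_1 of_nat_add of_nat_mult of_nat_numeral)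
  define b b' where "b = real ((2 * n) choose n)" and "b' = real ((2 * Suc n) choose Suc n)"
  have "(real (Suc n) * b')\<^sup>2 * (2 * real n + 3) = 4 * (2 * real n + 1) * (2 * real n + 3) * (b\<^sup>2 * (2 * real n + 1))"
    unfolding b_def b'_def eq by (simp add: power2_eq_square algebra_simps)
  also have "\<dots> \<le> 16 * (real (Suc n))\<^sup>2 * (4 ^ n)\<^sup>2"
  proof (rule mult_mono)
    show "4 * (2 * real n + 1) * (2 * real n + 3) \<le> 16 * (real (Suc n))\<^sup>2"
      by (simp add: power2_eq_square algebra_simps)
  qed (use Suc.IH in \<open>auto simp: b_def\<close>)
  also have "\<dots> = (real (Suc n))\<^sup>2 * (4 ^ Suc n)\<^sup>2" by (simp add: power_mult_distrib)
  finally have "(real (Suc n))\<^sup>2 * (b'\<^sup>2 * (2 * real n + 3)) \<le> (real (Suc n))\<^sup>2 * (4 ^ Suc n)\<^sup>2"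
    by (simp only: power_mult_distrib mult.assoc)
  then have "b'\<^sup>2 * (2 * real n + 3) \<le> (4 ^ Suc n)\<^sup>2"
    by (rule mult_left_le_imp_le) (auto intro: zero_less_power)
  then show ?case by (simp add: b'_def algebra_simps)
qed simp

text \<open>Summation by parts leaves \<open>b 0\<close> and the increments of \<open>b\<close>, all
  nonnegative, times values of \<open>a\<close>; in absolute value they add up to at most
  \<open>b n\<close>.\<close>

lemma abel_monotone_bound:
  fixes a b :: "nat \<Rightarrow> real"
  assumes "0 \<le> b 0" "\<And>j. j < n \<Longrightarrow> b j \<le> b (Suc j)" "\<And>j. j \<le> n \<Longrightarrow> \<bar>a j\<bar> \<le> 1"
  shows "\<bar>(\<Sum>j<n. b j * (a (Suc j) - a j)) - b n * a n\<bar> \<le> b n"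
  using assms
proof (induction n)
  case 0
  then show ?case by (simp add: abs_mult mult_left_le)
next
  case (Suc n)
  have "(\<Sum>j<Suc n. b j * (a (Suc j) - a j)) - b (Suc n) * a (Suc n)
      = ((\<Sum>j<n. b j * (a (Suc j) - a j)) - b n * a n) + (b n - b (Suc n)) * a (Suc n)"
    by (simp add: algebra_simps)
  moreover have "\<bar>(b n - b (Suc n)) * a (Suc n)\<bar> \<le> b (Suc n) - b n"
    using Suc.prems(2)[of n] Suc.prems(3)[of "Suc n"] by (simp add: abs_mult mult_left_le)
  moreover have "\<bar>(\<Sum>j<n. b j * (a (Suc j) - a j)) - b n * a n\<bar> \<le> b n"
    using Suc by simp
  ultimately show ?case by linarith
qed

text \<open>A row of even index increases up to the middle and is symmetric. Each half is treated by
  \<open>abel_monotone_bound\<close> and contributes the middle coefficient at most twice; hence the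
  4.\<close>

lemma binomial_difference_sum_le:
  fixes a :: "nat \<Rightarrow> real"
  assumes a: "\<And>j. \<bar>a j\<bar> \<le> 1"
  shows "\<bar>\<Sum>j\<le>2 * n. real ((2 * n) choose j) * (a (Suc j) - a j)\<bar> \<le> 4 * real ((2 * n) choose n)"
proof -
  let ?b = "\<lambda>j. real ((2 * n) choose j)"
  have mono: "?b j \<le> ?b (Suc j)" if "j < n" for j
    using binomial_mono[of j "Suc j" "2 * n"] that by (metis of_nat_le_iff Suc_leI le_add2 mult_le_mono2 plus_1_eq_Suc)
  \<comment> \<open>Reflection of the second half; the offset \<open>2 * n + 1\<close> sends the
    increment at \<open>j\<close> to minus the increment at \<open>2 * n - j\<close>.\<close>
  define a' where "a' i = a (2 * n + 1 - i)" for i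
  have 1: "\<bar>(\<Sum>j<n. ?b j * (a (Suc j) - a j)) - ?b n * a n\<bar> \<le> ?b n"
    by (rule abel_monotone_bound) (use mono a in \<open>auto simp del: of_nat_le_iff\<close>)
  have 2: "\<bar>(\<Sum>j<n. ?b j * (a' (Suc j) - a' j)) - ?b n * a' n\<bar> \<le> ?b n"
    by (rule abel_monotone_bound) (use mono a in \<open>auto simp: a'_def simp del: of_nat_le_iff\<close>)
  have "(\<Sum>j\<le>2 * n. ?b j * (a (Suc j) - a j))
      = (\<Sum>j<n. ?b j * (a (Suc j) - a j)) + (\<Sum>j\<in>{n..2 * n}. ?b j * (a (Suc j) - a j))"
    by (subst sum.union_disjoint[symmetric]) (auto intro!: sum.cong)
  also have "(\<Sum>j\<in>{n..2 * n}. ?b j * (a (Suc j) - a j)) = (\<Sum>j\<in>{..n}. - (?b j * (a' (Suc j) - a' j)))"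
    by (rule sum.reindex_bij_witness[where i = "\<lambda>i. 2 * n - i" and j = "\<lambda>i. 2 * n - i"])
       (auto simp: a'_def Suc_diff_le binomial_symmetric[symmetric] algebra_simps)
  also have "\<dots> = - (\<Sum>j<n. ?b j * (a' (Suc j) - a' j)) - ?b n * (a' (Suc n) - a' n)"
    by (simp add: sum_negf flip: lessThan_Suc_atMost)
  finally have *: "(\<Sum>j\<le>2 * n. ?b j * (a (Suc j) - a j)) =
     ((\<Sum>j<n. ?b j * (a (Suc j) - a j)) - ?b n * a n) + ?b n * a n
     - ((\<Sum>j<n. ?b j * (a' (Suc j) - a' j)) - ?b n * a' n) - ?b n * a' (Suc n)"
    by (simp add: algebra_simps)
  have "\<bar>?b n * a n\<bar> \<le> ?b n" "\<bar>?b n * a' (Suc n)\<bar> \<le> ?b n"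
    using a by (auto simp: abs_mult a'_def intro!: mult_left_le)
  with 1 2 show ?thesis unfolding * by linarith
qed

section \<open>Kernels of finite support and total variation\<close>

primrec kern_pow :: "('s \<Rightarrow> 's pmf) \<Rightarrow> nat \<Rightarrow> 's \<Rightarrow> 's pmf" where
  "kern_pow K 0 x = return_pmf x"
| "kern_pow K (Suc k) x = bind_pmf (K x) (kern_pow K k)"

text \<open>This is the expectation only for finite support, since a sum over an infinite set is 0
  by convention.\<close>

definition kern_op :: "('s \<Rightarrow> 's pmf) \<Rightarrow> ('s \<Rightarrow> real) \<Rightarrow> 's \<Rightarrow> real" where
  "kern_op K f x = (\<Sum>y\<in>set_pmf (K x). pmf (K x) y * f y)"

lemma exists_pmf_finite:
  assumes "finite A" "\<And>z. 0 \<le> f z" "\<And>z. z \<notin> A \<Longrightarrow> f z = 0" "sum f A = 1"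
  shows "\<exists>p. \<forall>z. pmf p z = f z"
proof -
  have "(\<integral>\<^sup>+z. ennreal (f z) \<partial>count_space UNIV) = (\<Sum>z\<in>A. ennreal (f z))"
    using assms by (intro nn_integral_count_space'[of A]) auto
  also have "\<dots> = 1" using assms by (simp add: sum_ennreal)
  finally have "pmf (embed_pmf f) z = f z" for z using assms by (intro pmf_embed_pmf) auto
  then show ?thesis by blast
qed

text \<open>The maximal coupling: with probability \<open>a\<close>, the mass of the pointwise
  minimum, both components are one draw from the normalised overlap; otherwise they are independent
  draws from the normalised excesses.\<close>

lemma exists_half_coupling:
  fixes p q :: "'s pmf"
  assumes fin: "finite (set_pmf p)" "finite (set_pmf q)"
    and close: "\<And>A. measure_pmf.prob p A - measure_pmf.prob q A \<le> 1 / 2"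
  shows "\<exists>C. map_pmf fst C = p \<and> map_pmf snd C = q \<and> 1 / 2 \<le> measure_pmf.prob C {(a, b). a = b}"
\<comment> \<open>Equal laws are split off, since their excesses have mass \<open>1 - a = 0\<close>
  and cannot be normalised.\<close>
proof (cases "p = q")
  case True
  have "measure_pmf.prob (map_pmf (\<lambda>z. (z, z)) p) {(a, b). a = b} = 1"
    by (simp add: measure_map_pmf vimage_def)
  with True show ?thesis
    by (intro exI[of _ "map_pmf (\<lambda>z. (z, z)) p"]) (simp add: map_pmf_comp)
next
  case False
  define A where "A = set_pmf p \<union> set_pmf q"
  have A: "finite A" "\<And>z. z \<notin> A \<Longrightarrow> pmf p z = 0" "\<And>z. z \<notin> A \<Longrightarrow> pmf q z = 0"
    using fin by (auto simp: A_def set_pmf_iff)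
  have sp: "sum (pmf p) A = 1" "sum (pmf q) A = 1"
    using fin by (auto intro!: sum_pmf_eq_1 simp: A_def)
  define r where "r z = min (pmf p z) (pmf q z)" for z
  define a where "a = sum r A"
  have ra: "0 \<le> r z" "r z \<le> pmf p z" "r z \<le> pmf q z" for z by (auto simp: r_def)
  have a_half: "1 / 2 \<le> a"
  proof -
    \<comment> \<open>The set on which \<open>p\<close> exceeds \<open>q\<close> realises the
      largest difference of probabilities, which is \<open>1 - a\<close>.\<close>
    let ?D = "{z \<in> A. pmf p z > pmf q z}"
    have "1 - a = (\<Sum>z\<in>A. pmf p z - r z)" using sp by (simp add: a_def sum_subtractf)
    also have "\<dots> = (\<Sum>z\<in>?D. pmf p z - r z)"
      using A by (intro sum.mono_neutral_right) (auto simp: r_def)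
    also have "\<dots> = (\<Sum>z\<in>?D. pmf p z - pmf q z)" by (intro sum.cong) (auto simp: r_def)
    also have "\<dots> = measure_pmf.prob p ?D - measure_pmf.prob q ?D"
      using A by (simp add: measure_measure_pmf_finite sum_subtractf)
    also have "\<dots> \<le> 1 / 2" by (rule close)
    finally show ?thesis by simp
  qed
  have a_less: "a < 1"
  proof (rule ccontr)
    assume "\<not> a < 1"
    then have le: "(\<Sum>z\<in>A. pmf p z - r z) \<le> 0" "(\<Sum>z\<in>A. pmf q z - r z) \<le> 0"
      using sp by (auto simp: a_def sum_subtractf)
    have "pmf p z = r z \<and> pmf q z = r z" if "z \<in> A" for z
    proof -
      have "(\<Sum>z\<in>A. pmf p z - r z) = 0" "(\<Sum>z\<in>A. pmf q z - r z) = 0"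
        using le ra by (auto intro!: antisym sum_nonneg)
      then show ?thesis
        using sum_nonneg_eq_0_iff[of A "\<lambda>z. pmf p z - r z"] sum_nonneg_eq_0_iff[of A "\<lambda>z. pmf q z - r z"]
          ra A(1) that by auto
    qed
    then have "p = q" using A by (intro pmf_eqI) metis
    with False show False by simp
  qed
  obtain m where m: "\<And>z. pmf m z = r z / a"
    using exists_pmf_finite[of A "\<lambda>z. r z / a"] A ra a_half
    by (auto simp: r_def a_def simp flip: sum_divide_distrib)
  obtain p' where p': "\<And>z. pmf p' z = (pmf p z - r z) / (1 - a)"
    using exists_pmf_finite[of A "\<lambda>z. (pmf p z - r z) / (1 - a)"] A ra a_less sp
    by (auto simp: r_def a_def sum_subtractf simp flip: sum_divide_distrib)
  obtain q' where q': "\<And>z. pmf q' z = (pmf q z - r z) / (1 - a)"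
    using exists_pmf_finite[of A "\<lambda>z. (pmf q z - r z) / (1 - a)"] A ra a_less sp
    by (auto simp: r_def a_def sum_subtractf simp flip: sum_divide_distrib)
  define C where "C = bind_pmf (bernoulli_pmf a) (\<lambda>b. if b then map_pmf (\<lambda>z. (z, z)) m else pair_pmf p' q')"
  have bern: "pmf (bind_pmf (bernoulli_pmf a) f) z = a * pmf (f True) z + (1 - a) * pmf (f False) z"
    for f :: "bool \<Rightarrow> 's pmf" and z
    using a_half a_less by (simp add: pmf_bind)
  have "map_pmf fst C = bind_pmf (bernoulli_pmf a) (\<lambda>b. if b then m else p')"
    unfolding C_def map_bind_pmf by (intro bind_pmf_cong refl) (simp add: map_pmf_comp map_fst_pair_pmf)
  also have "\<dots> = p" using a_half a_less by (intro pmf_eqI) (simp add: bern m p')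
  finally have 1: "map_pmf fst C = p" .
  have "map_pmf snd C = bind_pmf (bernoulli_pmf a) (\<lambda>b. if b then m else q')"
    unfolding C_def map_bind_pmf by (intro bind_pmf_cong refl) (simp add: map_pmf_comp map_snd_pair_pmf)
  also have "\<dots> = q" using a_half a_less by (intro pmf_eqI) (simp add: bern m q')
  finally have 2: "map_pmf snd C = q" .
  have "measure_pmf.prob C {(a, b). a = b} = pmf (map_pmf (\<lambda>(a, b). a = b) C) True"
    by (simp add: pmf_map vimage_def split_def)
  also have "map_pmf (\<lambda>(a, b). a = b) C = bind_pmf (bernoulli_pmf a)
     (\<lambda>b. if b then return_pmf True else map_pmf (\<lambda>(a, b). a = b) (pair_pmf p' q'))"
    unfolding C_def map_bind_pmf by (intro bind_pmf_cong refl) (simp add: map_pmf_comp)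
  also have "a \<le> pmf \<dots> True"
    using a_half a_less by (simp add: pmf_bind)
  finally have "1 / 2 \<le> measure_pmf.prob C {(a, b). a = b}" using a_half by linarith
  with 1 2 show ?thesis by blast
qed

locale lazy_liouville_kernel =
  fixes K :: "'s::countable \<Rightarrow> 's pmf"
  assumes finite_K: "\<And>x. finite (set_pmf (K x))"
    and lazy_K: "\<And>x. 1 / 2 \<le> pmf (K x) x"
    and liouville_K: "\<And>h x y. (\<And>x. kern_op K h x = h x) \<Longrightarrow> (\<And>x. \<bar>h x\<bar> \<le> 1) \<Longrightarrow> h x = h y"
begin

abbreviation T where "T \<equiv> kern_op K"

text \<open>\<open>T\<close> is the average of the identity and the contraction \<open>U\<close>, by laziness.\<close>

definition U :: "('s \<Rightarrow> real) \<Rightarrow> 's \<Rightarrow> real" where "U f x = 2 * T f x - f x"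

lemma T_add: "T (\<lambda>x. f x + g x) x = T f x + T g x"
  by (simp add: kern_op_def algebra_simps sum.distrib)

lemma T_cmult: "T (\<lambda>x. c * f x) x = c * T f x"
  by (simp add: kern_op_def algebra_simps sum_distrib_left)

lemma T_mono: "(\<And>x. f x \<le> g x) \<Longrightarrow> T f x \<le> T g x"
  unfolding kern_op_def by (intro sum_mono mult_left_mono) auto

lemma T_const: "T (\<lambda>_. c) x = c"
  by (simp add: kern_op_def finite_K sum_pmf_eq_1 flip: sum_distrib_right)

lemma Tn_between: "(\<And>x. lo \<le> f x \<and> f x \<le> hi) \<Longrightarrow> lo \<le> (T ^^ k) f x \<and> (T ^^ k) f x \<le> hi"
proof (induction k arbitrary: x)
  case (Suc k)
  then have "T (\<lambda>_. lo) x \<le> T ((T ^^ k) f) x" "T ((T ^^ k) f) x \<le> T (\<lambda>_. hi) x"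
    by (auto intro!: T_mono)
  then show ?case by (simp add: T_const)
qed auto

text \<open>\<open>U\<close> is again a Markov operator: by laziness the weight
  \<open>2 * pmf (K x) x - 1\<close> that it puts on \<open>x\<close> is nonnegative.\<close>

lemma U_bounded: assumes "\<And>x. \<bar>f x\<bar> \<le> 1" shows "\<bar>U f x\<bar> \<le> 1"
proof -
  let ?S = "set_pmf (K x)" and ?p = "pmf (K x)"
  have x: "x \<in> ?S" using lazy_K[of x] by (auto simp: set_pmf_iff)
  have sum1: "?p x + (\<Sum>y\<in>?S - {x}. ?p y) = 1"
    using sum.remove[OF finite_K x, of ?p] by (simp add: sum_pmf_eq_1 finite_K)
  have "U f x = (2 * ?p x - 1) * f x + 2 * (\<Sum>y\<in>?S - {x}. ?p y * f y)"
    unfolding U_def kern_op_def using sum.remove[OF finite_K x, of "\<lambda>y. ?p y * f y"]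
    by (simp add: algebra_simps)
  also have "\<bar>\<dots>\<bar> \<le> (2 * ?p x - 1) * 1 + 2 * (\<Sum>y\<in>?S - {x}. ?p y)"
  proof -
    have "\<bar>(2 * ?p x - 1) * f x\<bar> \<le> (2 * ?p x - 1) * 1"
      using lazy_K[of x] assms[of x] by (simp add: abs_mult mult_left_le)
    moreover have "\<bar>\<Sum>y\<in>?S - {x}. ?p y * f y\<bar> \<le> (\<Sum>y\<in>?S - {x}. ?p y)"
      by (rule order_trans[OF sum_abs]) (intro sum_mono, simp add: abs_mult mult_left_le assms)
    ultimately show ?thesis by linarith
  qed
  also have "(\<Sum>y\<in>?S - {x}. ?p y) = 1 - ?p x" using sum1 by linarith
  finally show ?thesis by simp
qed

lemma Un_bounded: assumes "\<And>x. \<bar>f x\<bar> \<le> 1" shows "\<bar>(U ^^ k) f x\<bar> \<le> 1"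
  by (induction k arbitrary: x) (auto intro: U_bounded assms)

lemma T_eq_U: "T f x = (f x + U f x) / 2"
  by (simp add: U_def)

lemma U_sum: "U (\<lambda>x. \<Sum>j\<in>A. c j * f j x) x = (\<Sum>j\<in>A. c j * U (f j) x)" if "finite A"
  using that
proof (induction A)
  case empty
  show ?case by (simp add: U_def kern_op_def)
next
  case (insert i A)
  then show ?case by (simp add: U_def T_add T_cmult algebra_simps)
qed

text \<open>The binomial theorem for \<open>T = (1 + U) / 2\<close>; Pascal's rule is the induction
  step.\<close>

lemma Tn_binomial: "(T ^^ k) f x = (\<Sum>j\<le>k. real (k choose j) * (U ^^ j) f x) / 2 ^ k"
proof (induction k arbitrary: x)
  case (Suc k)
  define u where "u j = (U ^^ j) f x" for j
  have Tfun: "(T ^^ k) f = (\<lambda>x. \<Sum>j\<le>k. (real (k choose j) / 2 ^ k) * (U ^^ j) f x)"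
    using Suc.IH by (simp add: fun_eq_iff sum_divide_distrib)
  have "(T ^^ Suc k) f x = ((\<Sum>j\<le>k. (real (k choose j) / 2 ^ k) * u j)
      + (\<Sum>j\<le>k. (real (k choose j) / 2 ^ k) * u (Suc j))) / 2"
    unfolding funpow.simps comp_apply T_eq_U Tfun U_sum[OF finite_atMost] by (simp add: u_def)
  also have "\<dots> = ((\<Sum>j\<le>k. real (k choose j) * u j) + (\<Sum>j\<le>k. real (k choose j) * u (Suc j))) / 2 ^ Suc k"
    by (simp add: sum_divide_distrib add_divide_distrib mult.commute[of 2])
  also have "(\<Sum>j\<le>k. real (k choose j) * u j) + (\<Sum>j\<le>k. real (k choose j) * u (Suc j))
      = (\<Sum>j\<le>Suc k. real (Suc k choose j) * u j)"
  proof -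
    have "(\<Sum>j\<le>Suc k. real (Suc k choose j) * u j)
       = u 0 + (\<Sum>j\<le>k. real (k choose j) * u (Suc j)) + (\<Sum>j\<le>k. real (k choose Suc j) * u (Suc j))"
      by (subst sum.atMost_Suc_shift) (simp add: algebra_simps sum.distrib)
    also have "u 0 + (\<Sum>j\<le>k. real (k choose j) * u (Suc j)) + (\<Sum>j\<le>k. real (k choose Suc j) * u (Suc j))
      = (\<Sum>j\<le>k. real (k choose j) * u (Suc j)) + (\<Sum>j\<le>Suc k. real (k choose j) * u j)"
      by (subst sum.atMost_Suc_shift) simp
    also have "(\<Sum>j\<le>Suc k. real (k choose j) * u j) = (\<Sum>j\<le>k. real (k choose j) * u j)" by simp
    finally show ?thesis by simp
  qed
  finally show ?case by (simp add: u_def)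
qed simp

text \<open>\<open>T - 1 = (U - 1) / 2\<close> turns the increment into consecutive differences of
  \<open>U\<close>-iterates with binomial weights. These cancel up to the order of the central
  weight, uniformly in \<open>f\<close> and \<open>x\<close>.\<close>

lemma T_increment_small:
  assumes f: "\<And>x. \<bar>f x\<bar> \<le> 1"
  shows "\<bar>T ((T ^^ (2 * n)) f) x - (T ^^ (2 * n)) f x\<bar> \<le> 2 / sqrt (2 * real n + 1)"
proof -
  define b where "b = real ((2 * n) choose n)"
  let ?c = "\<lambda>j. real ((2 * n) choose j) / 2 ^ (2 * n)" and ?F = "(T ^^ (2 * n)) f"
  have F: "?F = (\<lambda>x. \<Sum>j\<le>2 * n. ?c j * (U ^^ j) f x)"
    by (simp add: fun_eq_iff Tn_binomial sum_divide_distrib)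
  have "U ?F x = (\<Sum>j\<le>2 * n. ?c j * (U ^^ Suc j) f x)"
    unfolding F U_sum[OF finite_atMost] by simp
  moreover have "?F x = (\<Sum>j\<le>2 * n. ?c j * (U ^^ j) f x)" by (simp add: F)
  moreover have "T ?F x - ?F x = (U ?F x - ?F x) / 2"
    by (simp add: T_eq_U field_simps)
  ultimately have "T ?F x - ?F x
     = (\<Sum>j\<le>2 * n. ?c j * (U ^^ Suc j) f x - ?c j * (U ^^ j) f x) / 2"
    by (simp only: sum_subtractf)
  also have "\<dots> = (\<Sum>j\<le>2 * n. real ((2 * n) choose j) * ((U ^^ Suc j) f x - (U ^^ j) f x)) / 2 ^ (2 * n) / 2"
    by (simp add: sum_divide_distrib diff_divide_distrib right_diff_distrib del: funpow.simps)
  also have "\<bar>\<dots>\<bar> \<le> 4 * b / 2 ^ (2 * n) / 2"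
  proof -
    have "\<bar>\<Sum>j\<le>2 * n. real ((2 * n) choose j) * ((U ^^ Suc j) f x - (U ^^ j) f x)\<bar> \<le> 4 * b"
      unfolding b_def using Un_bounded[of f, OF f] by (rule binomial_difference_sum_le)
    then have "\<bar>\<Sum>j\<le>2 * n. real ((2 * n) choose j) * ((U ^^ Suc j) f x - (U ^^ j) f x)\<bar> / 2 ^ (2 * n) / 2
       \<le> 4 * b / 2 ^ (2 * n) / 2"
      by (intro divide_right_mono) auto
    then show ?thesis by (simp only: abs_divide) simp
  qed
  also have "\<dots> = 2 * (b / 4 ^ n)" by (simp add: power_mult)
  also have "b / 4 ^ n \<le> 1 / sqrt (2 * real n + 1)"
  proof -
    have "b\<^sup>2 * (2 * real n + 1) \<le> (4 ^ n)\<^sup>2" unfolding b_def by (rule central_binomial_square_le)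
    then have "sqrt (b\<^sup>2 * (2 * real n + 1)) \<le> sqrt ((4 ^ n)\<^sup>2)" by (rule real_sqrt_le_mono)
    then have "b * sqrt (2 * real n + 1) \<le> 4 ^ n" by (simp add: real_sqrt_mult b_def)
    then show ?thesis by (simp add: field_simps)
  qed
  finally show ?thesis by simp
qed

text \<open>Compactness: counterexamples \<open>f n\<close> give
  \<open>g n = (T ^^ (2 * n)) (f n)\<close>, and a diagonal subsequence converges at every point of
  the countable state space. By \<open>T_increment_small\<close> the limit is harmonic, hence
  constant, yet it keeps the gap between \<open>x\<close> and \<open>y\<close>.\<close>

lemma forgets_start:
  "\<exists>n. \<forall>f. (\<forall>z. 0 \<le> f z \<and> f z \<le> 1) \<longrightarrow> (T ^^ (2 * n)) f x - (T ^^ (2 * n)) f y \<le> 1 / 2"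
proof (rule ccontr)
  assume "\<not> ?thesis"
  then have "\<forall>n. \<exists>f. (\<forall>z. 0 \<le> f z \<and> f z \<le> 1) \<and> 1 / 2 < (T ^^ (2 * n)) f x - (T ^^ (2 * n)) f y"
    by (metis not_le)
  then obtain f where f: "\<And>n z. 0 \<le> f n z \<and> f n z \<le> (1::real)"
    and gap: "\<And>n. 1 / 2 < (T ^^ (2 * n)) (f n) x - (T ^^ (2 * n)) (f n) y"
    by metis
  define g where "g n = (T ^^ (2 * n)) (f n)" for n
  have g01: "0 \<le> g n z" "g n z \<le> 1" for n z using Tn_between[of 0 "f n" 1] f by (auto simp: g_def)
  obtain k :: "nat \<Rightarrow> nat" where k: "strict_mono k" and conv: "\<And>z. \<exists>l. (\<lambda>n. g (k n) z) \<longlonglongrightarrow> l"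
    using function_convergent_subsequence[of UNIV g 1] g01 by (auto simp: abs_le_iff intro: order_trans)
  define h where "h z = lim (\<lambda>n. g (k n) z)" for z
  have h: "(\<lambda>n. g (k n) z) \<longlonglongrightarrow> h z" for z
    unfolding h_def using conv[of z] by (auto simp: limI)
  have hb: "\<bar>h z\<bar> \<le> 1" for z
    using LIMSEQ_le_const[OF h, of 0] LIMSEQ_le_const2[OF h, of z 1] g01 by (auto simp: abs_le_iff)
  have Th: "T h z = h z" for z
  proof -
    have 1: "(\<lambda>n. T (g (k n)) z) \<longlonglongrightarrow> T h z"
      unfolding kern_op_def by (intro tendsto_intros h)
    have "(\<lambda>n. T (g (k n)) z - g (k n) z) \<longlonglongrightarrow> 0"
    proof (rule Lim_null_comparison)
      have "\<bar>f n z\<bar> \<le> 1" for n z using f[of n z] by simp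
      then show "\<forall>\<^sub>F n in sequentially. norm (T (g (k n)) z - g (k n) z) \<le> 2 / sqrt (2 * real (k n) + 1)"
        using T_increment_small by (simp add: g_def)
      have "(\<lambda>n. 2 / sqrt (2 * real n + 1)) \<longlonglongrightarrow> 0" by real_asymp
      then show "(\<lambda>n. 2 / sqrt (2 * real (k n) + 1)) \<longlonglongrightarrow> 0"
        using LIMSEQ_subseq_LIMSEQ[OF _ k] by (force simp: o_def)
    qed
    then have "(\<lambda>n. T (g (k n)) z - g (k n) z + g (k n) z) \<longlonglongrightarrow> 0 + h z" by (intro tendsto_add h)
    then show ?thesis using LIMSEQ_unique[OF 1] by simp
  qed
  have "h x = h y" using Th hb by (rule liouville_K)
  moreover have "1 / 2 \<le> h x - h y"
    using gap by (intro LIMSEQ_le_const[OF tendsto_diff[OF h h]]) (auto simp: g_def less_imp_le)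
  ultimately show False by simp
qed

lemma finite_kern_pow: "finite (set_pmf (kern_pow K k x))"
  by (induction k arbitrary: x) (auto simp: finite_K)

lemma prob_kern_pow: "measure_pmf.prob (kern_pow K k x) A = (T ^^ k) (indicator A) x"
proof (induction k arbitrary: x)
  case (Suc k)
  have "measure_pmf.prob (kern_pow K (Suc k) x) A
      = measure_pmf.expectation (K x) (\<lambda>y. measure_pmf.prob (kern_pow K k y) A)"
    unfolding kern_pow.simps measure_pmf_bind
    by (rule measure_pmf.measure_bind[where N = "count_space UNIV"]) (auto simp: space_subprob_algebra
        prob_space_imp_subprob_space measure_pmf.prob_space_axioms)
  also have "\<dots> = T ((T ^^ k) (indicator A)) x"
    by (subst integral_measure_pmf[of "set_pmf (K x)"]) (auto simp: finite_K Suc.IH kern_op_def[of K _ x])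
  finally show ?case by simp
qed (simp add: indicator_def)

text \<open>For \<open>k \<ge> 2 * n\<close>, all but \<open>2 * n\<close> of the steps are absorbed
  into the test function, which still has values in [0, 1]; this is why \<open>forgets_start\<close>
  speaks of functions rather than sets.\<close>

lemma exists_coupling:
  "\<exists>k0. \<forall>k\<ge>k0. \<exists>C. map_pmf fst C = kern_pow K k x \<and> map_pmf snd C = kern_pow K k y \<and>
     1 / 2 \<le> measure_pmf.prob C {(a, b). a = b}"
proof -
  obtain n where n: "\<And>f. (\<And>z. 0 \<le> f z \<and> f z \<le> 1) \<Longrightarrow> (T ^^ (2 * n)) f x - (T ^^ (2 * n)) f y \<le> 1 / 2"
    using forgets_start by blast
  have "\<exists>C. map_pmf fst C = kern_pow K k x \<and> map_pmf snd C = kern_pow K k y \<and>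
     1 / 2 \<le> measure_pmf.prob C {(a, b). a = b}" if "2 * n \<le> k" for k
  proof (rule exists_half_coupling)
    fix A :: "'s set"
    have k: "(T ^^ k) (indicator A) z = (T ^^ (2 * n)) ((T ^^ (k - 2 * n)) (indicator A)) z" for z
      using that by (simp flip: funpow_add comp_apply[of "T ^^ (2 * n)"])
    show "measure_pmf.prob (kern_pow K k x) A - measure_pmf.prob (kern_pow K k y) A \<le> 1 / 2"
      unfolding prob_kern_pow k by (intro n Tn_between) (auto simp: indicator_def)
  qed (rule finite_kern_pow)+
  then show ?thesis by blast
qed

end

text \<open>Ionescu-Tulcea for a time-dependent kernel. The laws of consecutive pairs are enough for
  the application, where the state is the whole history.\<close>

lemma exists_markov_sequence:
  fixes \<kappa> :: "nat \<Rightarrow> 'a::countable \<Rightarrow> 'a pmf"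
  shows "\<exists>M. prob_space M \<and> (\<forall>j. (\<lambda>\<omega>. \<omega> j) \<in> measurable M (count_space UNIV)) \<and>
    (\<forall>F :: 'a \<Rightarrow> ennreal. (\<integral>\<^sup>+\<omega>. F (\<omega> 0) \<partial>M) = F x0) \<and>
    (\<forall>j. \<forall>F :: 'a \<Rightarrow> 'a \<Rightarrow> ennreal.
       (\<integral>\<^sup>+\<omega>. F (\<omega> j) (\<omega> (Suc j)) \<partial>M) = (\<integral>\<^sup>+\<omega>. (\<integral>\<^sup>+y. F (\<omega> j) y \<partial>\<kappa> j (\<omega> j)) \<partial>M))"
proof -
  let ?C = "count_space (UNIV :: 'a set)"
  define P where "P i \<omega> = measure_pmf (case i of 0 \<Rightarrow> return_pmf x0 | Suc j \<Rightarrow> \<kappa> j (\<omega> j))"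
    for i and \<omega> :: "nat \<Rightarrow> 'a"
  interpret IT: Ionescu_Tulcea P "\<lambda>_. ?C"
  proof (rule Ionescu_Tulcea.intro)
    show "P i \<in> measurable (PiM {0..<i} (\<lambda>_. ?C)) (subprob_algebra ?C)" for i
    proof (cases i)
      case 0
      then show ?thesis by (simp add: P_def[abs_def] measure_pmf_in_subprob_algebra)
    next
      case (Suc j)
      have "(\<lambda>\<omega>. \<omega> j) \<in> measurable (PiM {0..<i} (\<lambda>_. ?C)) ?C"
        using Suc by (intro measurable_component_singleton) auto
      moreover have "(\<lambda>a. measure_pmf (\<kappa> j a)) \<in> measurable ?C (subprob_algebra ?C)"
        by (simp add: measure_pmf_in_subprob_algebra)
      ultimately show ?thesis
        unfolding P_def Suc nat.case by (rule measurable_compose)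
    qed
  qed (simp add: P_def measure_pmf.prob_space_axioms)
  let ?M = "IT.PF.lim" and ?u = "\<lambda>_::nat. undefined :: 'a"
  have sets_M: "sets ?M = sets (PiM UNIV (\<lambda>_. ?C))" by simp
  have comp: "(\<lambda>\<omega>. \<omega> j) \<in> measurable ?M ?C" for j
    unfolding measurable_cong_sets[OF sets_M refl] by (rule measurable_component_singleton) simp
  have restr: "(\<lambda>\<omega>. restrict \<omega> {0..<n}) \<in> measurable ?M (PiM {0..<n} (\<lambda>_. ?C))" for n
    unfolding measurable_cong_sets[OF sets_M refl] by (rule measurable_restrict_subset) simp
  have u: "?u \<in> space (PiM {0..<0} (\<lambda>_. ?C))" by (simp add: space_PiM)
  have setsC: "sets (IT.C 0 n ?u) = sets (PiM {0..<n} (\<lambda>_. ?C))" for n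
    using IT.sets_C[OF u, of n] by simp
  have distr: "distr ?M (PiM {0..<n} (\<lambda>_. ?C)) (\<lambda>\<omega>. restrict \<omega> {0..<n}) = IT.C 0 n ?u" for n
  proof (rule measure_eqI)
    fix A assume "A \<in> sets (distr ?M (PiM {0..<n} (\<lambda>_. ?C)) (\<lambda>\<omega>. restrict \<omega> {0..<n}))"
    then have A: "A \<in> sets (PiM {0..<n} (\<lambda>_. ?C))" by simp
    have "emeasure (IT.CI {0..<n}) A = emeasure (IT.C 0 n ?u) (IT.PF.emb {0..<n} {0..<n} A)"
      using A by (intro IT.emeasure_CI) auto
    also have "IT.PF.emb {0..<n} {0..<n} A = A"
      by (rule prod_emb_id) (use sets.sets_into_space[OF A] in \<open>simp add: space_PiM\<close>)
    finally show "emeasure (distr ?M (PiM {0..<n} (\<lambda>_. ?C)) (\<lambda>\<omega>. restrict \<omega> {0..<n})) A = emeasure (IT.C 0 n ?u) A"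
      by (simp add: IT.distr_lim)
  qed (simp add: setsC)
  interpret CP: prob_space "IT.C 0 n ?u" for n using u by (rule IT.prob_space_C)
  have "prob_space (distr ?M (PiM {0..<0} (\<lambda>_. ?C)) (\<lambda>\<omega>. restrict \<omega> {0..<0}))"
    unfolding distr by (rule CP.prob_space_axioms)
  then have prob: "prob_space ?M" by (rule prob_space_distrD[OF restr])
  have via_C: "(\<integral>\<^sup>+\<omega>. F (\<omega> j) (\<omega> j') \<partial>?M) = (\<integral>\<^sup>+f. F (f j) (f j') \<partial>IT.C 0 n ?u)"
    if "j < n" "j' < n" for F :: "'a \<Rightarrow> 'a \<Rightarrow> ennreal" and j j' n
  proof -
    have meas: "(\<lambda>f. F (f j) (f j')) \<in> borel_measurable (PiM {0..<n} (\<lambda>_. ?C))"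
    proof -
      have "(\<lambda>f. (f j, f j')) \<in> measurable (PiM {0..<n} (\<lambda>_. ?C)) (?C \<Otimes>\<^sub>M ?C)"
        using that by (intro measurable_Pair measurable_component_singleton) auto
      then have "(\<lambda>f. (f j, f j')) \<in> measurable (PiM {0..<n} (\<lambda>_. ?C)) (count_space UNIV)"
        by (simp add: pair_measure_countable)
      from measurable_compose[OF this, of "\<lambda>p. F (fst p) (snd p)" borel] show ?thesis by simp
    qed
    show ?thesis unfolding distr[symmetric]
      using meas that by (subst nn_integral_distr[OF restr]) auto
  qed
  have Csuc: "(\<integral>\<^sup>+f. G f \<partial>IT.C 0 (Suc n) ?u) = (\<integral>\<^sup>+f. (\<integral>\<^sup>+y. G (f(n := y)) \<partial>P n f) \<partial>IT.C 0 n ?u)"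
    if G: "G \<in> borel_measurable (PiM {0..<Suc n} (\<lambda>_. ?C))" for G n
  proof -
    have "(\<integral>\<^sup>+f. G f \<partial>IT.C 0 (Suc n) ?u) = (\<integral>\<^sup>+f. (\<integral>\<^sup>+g. G g \<partial>IT.eP n f) \<partial>IT.C 0 n ?u)"
      unfolding IT.C.simps using G IT.measurable_eP[of n]
      by (subst nn_integral_bind[where B = "PiM {0..<Suc n} (\<lambda>_. ?C)"])
         (auto simp: measurable_cong_sets[OF setsC refl])
    also have "\<dots> = (\<integral>\<^sup>+f. (\<integral>\<^sup>+y. G (f(n := y)) \<partial>P n f) \<partial>IT.C 0 n ?u)"
      using G sets_eq_imp_space_eq[OF setsC[of n]] by (intro nn_integral_cong IT.nn_integral_eP) auto
    finally show ?thesis .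
  qed
  have "(\<integral>\<^sup>+\<omega>. F (\<omega> 0) \<partial>?M) = F x0" for F :: "'a \<Rightarrow> ennreal"
  proof -
    have "(\<integral>\<^sup>+\<omega>. F (\<omega> 0) \<partial>?M) = (\<integral>\<^sup>+f. F (f 0) \<partial>IT.C 0 (Suc 0) ?u)"
      using via_C[of 0 "Suc 0" 0 "\<lambda>a b. F a"] by simp
    also have "\<dots> = (\<integral>\<^sup>+f. (\<integral>\<^sup>+y. F y \<partial>P 0 f) \<partial>IT.C 0 0 ?u)"
      by (subst Csuc) (auto intro!: measurable_compose[OF measurable_component_singleton])
    also have "\<dots> = F x0" using CP.emeasure_space_1[of 0] by (simp add: P_def)
    finally show ?thesis .
  qed
  moreover have "(\<integral>\<^sup>+\<omega>. F (\<omega> j) (\<omega> (Suc j)) \<partial>?M) = (\<integral>\<^sup>+\<omega>. (\<integral>\<^sup>+y. F (\<omega> j) y \<partial>\<kappa> j (\<omega> j)) \<partial>?M)"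
    for F :: "'a \<Rightarrow> 'a \<Rightarrow> ennreal" and j
  proof -
    have meas: "(\<lambda>f. F (f j) (f (Suc j))) \<in> borel_measurable (PiM {0..<Suc (Suc j)} (\<lambda>_. ?C))"
    proof -
      have "(\<lambda>f. (f j, f (Suc j))) \<in> measurable (PiM {0..<Suc (Suc j)} (\<lambda>_. ?C)) (?C \<Otimes>\<^sub>M ?C)"
        by (intro measurable_Pair measurable_component_singleton) auto
      then have "(\<lambda>f. (f j, f (Suc j))) \<in> measurable (PiM {0..<Suc (Suc j)} (\<lambda>_. ?C)) (count_space UNIV)"
        by (simp add: pair_measure_countable)
      from measurable_compose[OF this, of "\<lambda>p. F (fst p) (snd p)" borel] show ?thesis by simp
    qed
    have "(\<integral>\<^sup>+\<omega>. F (\<omega> j) (\<omega> (Suc j)) \<partial>?M) = (\<integral>\<^sup>+f. F (f j) (f (Suc j)) \<partial>IT.C 0 (Suc (Suc j)) ?u)"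
      by (rule via_C) auto
    also have "\<dots> = (\<integral>\<^sup>+f. (\<integral>\<^sup>+y. F (f j) y \<partial>P (Suc j) f) \<partial>IT.C 0 (Suc j) ?u)"
      by (subst Csuc[OF meas]) simp
    also have "\<dots> = (\<integral>\<^sup>+f. (\<integral>\<^sup>+y. F (f j) y \<partial>\<kappa> j (f j)) \<partial>IT.C 0 (Suc j) ?u)"
      by (simp add: P_def)
    also have "\<dots> = (\<integral>\<^sup>+\<omega>. (\<integral>\<^sup>+y. F (\<omega> j) y \<partial>\<kappa> j (\<omega> j)) \<partial>?M)"
      by (rule via_C[symmetric, where F = "\<lambda>a b. \<integral>\<^sup>+y. F a y \<partial>\<kappa> j a" and j' = j]) auto
    finally show ?thesis .
  qed
  ultimately show ?thesis using prob comp by blast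
qed

text \<open>The start \<open>x\<close> is left out of the list, so that blocks concatenate; the
  current state is \<open>last (x # L)\<close>, also for the empty list.\<close>

primrec path_pmf :: "('s \<Rightarrow> 's pmf) \<Rightarrow> nat \<Rightarrow> 's \<Rightarrow> 's list pmf" where
  "path_pmf K 0 x = return_pmf []"
| "path_pmf K (Suc k) x = bind_pmf (K x) (\<lambda>y. map_pmf (Cons y) (path_pmf K k y))"

lemma length_path: "L \<in> set_pmf (path_pmf K k x) \<Longrightarrow> length L = k"
  by (induction k arbitrary: x L) auto

lemma finite_path: "(\<And>x. finite (set_pmf (K x))) \<Longrightarrow> finite (set_pmf (path_pmf K k x))"
  by (induction k arbitrary: x) auto

lemma path_add:
  "path_pmf K (k + l) x = bind_pmf (path_pmf K k x) (\<lambda>L. map_pmf (append L) (path_pmf K l (last (x # L))))"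
proof (induction k arbitrary: x)
  case 0
  show ?case by (simp add: bind_return_pmf map_pmf_idI)
next
  case (Suc k)
  have Cons_append: "(@) (y # L) = (\<lambda>M. y # L @ M)" for y :: 'a and L by auto
  show ?case
    by (simp add: Suc.IH bind_assoc_pmf map_bind_pmf bind_map_pmf map_pmf_comp Cons_append)
qed

lemma path_take: "map_pmf (take k) (path_pmf K (k + l) x) = path_pmf K k x"
proof -
  have "map_pmf (take k) (path_pmf K (k + l) x)
      = bind_pmf (path_pmf K k x) (\<lambda>L. map_pmf (\<lambda>L'. L) (path_pmf K l (last (x # L))))"
    unfolding path_add map_bind_pmf map_pmf_comp
    by (intro bind_pmf_cong map_pmf_cong refl) (auto dest: length_path)
  then show ?thesis by (simp add: map_pmf_const bind_return_pmf')
qed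

lemma path_last: "map_pmf (\<lambda>L. last (x # L)) (path_pmf K k x) = kern_pow K k x"
proof (induction k arbitrary: x)
  case (Suc k)
  show ?case unfolding path_pmf.simps kern_pow.simps map_bind_pmf map_pmf_comp
    by (intro bind_pmf_cong refl) (simp add: Suc.IH[symmetric])
qed simp

text \<open>A coupling of the end points extends to the paths: given the pair of end points, draw
  two independent paths, each from its law \<open>D\<close> conditioned on the end point.\<close>

lemma bridge:
  assumes C: "map_pmf fst C = kern_pow K k x" "map_pmf snd C = kern_pow K k y"
  shows "\<exists>B. map_pmf fst B = path_pmf K k x \<and> map_pmf snd B = path_pmf K k y \<and>
    map_pmf (\<lambda>(a, b). (last (x # a), last (y # b))) B = C"
proof -
  define D where "D x a = cond_pmf (path_pmf K k x) {L. a = last (x # L)}" for x a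
  have ne: "set_pmf (path_pmf K k x) \<inter> {L. a = last (x # L)} \<noteq> {}" if "a \<in> set_pmf (kern_pow K k x)" for x a
    using that unfolding path_last[symmetric] by auto
  have bindD: "bind_pmf (kern_pow K k x) (D x) = path_pmf K k x" for x
    unfolding D_def
  proof (rule bind_cond_pmf_cancel[where R = "\<lambda>a L. a = last (x # L)"])
    fix a L assume "a = last (x # L)"
    then show "measure_pmf.prob (path_pmf K k x) {L. a = last (x # L)}
       = measure_pmf.prob (kern_pow K k x) {a. a = last (x # L)}"
      unfolding path_last[symmetric] by (auto simp: vimage_def measure_map_pmf intro!: arg_cong2[where f = measure])
  qed (use ne in \<open>auto simp flip: path_last\<close>)
  define B where "B = bind_pmf C (\<lambda>(a, b). pair_pmf (D x a) (D y b))"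
  have "map_pmf fst B = bind_pmf (map_pmf fst C) (D x)"
    unfolding B_def map_bind_pmf bind_map_pmf by (intro bind_pmf_cong refl) (auto simp: map_fst_pair_pmf)
  then have 1: "map_pmf fst B = path_pmf K k x" by (simp add: C bindD)
  have "map_pmf snd B = bind_pmf (map_pmf snd C) (D y)"
    unfolding B_def map_bind_pmf bind_map_pmf by (intro bind_pmf_cong refl) (auto simp: map_snd_pair_pmf)
  then have 2: "map_pmf snd B = path_pmf K k y" by (simp add: C bindD)
  have "map_pmf (\<lambda>(a, b). (last (x # a), last (y # b))) B = bind_pmf C return_pmf"
    unfolding B_def map_bind_pmf
  proof (intro bind_pmf_cong refl)
    fix p assume p: "p \<in> set_pmf C"
    obtain a b where ab: "p = (a, b)" by (cases p)
    have "a \<in> set_pmf (kern_pow K k x)" "b \<in> set_pmf (kern_pow K k y)"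
      using p ab unfolding C[symmetric] by force+
    then have sD: "set_pmf (D x a) \<subseteq> {L. a = last (x # L)}" "set_pmf (D y b) \<subseteq> {L. b = last (y # L)}"
      unfolding D_def using ne by (auto simp: set_cond_pmf)
    have "map_pmf (\<lambda>(a, b). (last (x # a), last (y # b))) (pair_pmf (D x a) (D y b))
        = map_pmf (\<lambda>_. (a, b)) (pair_pmf (D x a) (D y b))"
      using sD by (intro map_pmf_cong refl) (auto simp: subset_iff)
    then show "map_pmf (\<lambda>(a, b). (last (x # a), last (y # b))) (case p of (a, b) \<Rightarrow> pair_pmf (D x a) (D y b))
        = return_pmf p"
      by (simp add: ab map_pmf_const)
  qed
  then show ?thesis using 1 2 by (intro exI[of _ B]) (simp add: bind_return_pmf')
qed

text \<open>Failure is judged only at the end of the block; the last clause makes a meeting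
  permanent.\<close>

definition good_block :: "('s \<Rightarrow> 's pmf) \<Rightarrow> nat \<Rightarrow> 's \<Rightarrow> 's \<Rightarrow> ('s list \<times> 's list) pmf \<Rightarrow> bool" where
  "good_block K k x y B \<longleftrightarrow> map_pmf fst B = path_pmf K k x \<and> map_pmf snd B = path_pmf K k y \<and>
     measure_pmf.prob B {(a, b). last (x # a) \<noteq> last (y # b)} \<le> 1 / 2 \<and>
     (x = y \<longrightarrow> (\<forall>(a, b)\<in>set_pmf B. a = b))"

section \<open>Blocks, stages and the coupled skeletons\<close>

context lazy_liouville_kernel
begin

text \<open>The threshold depends on the pair; admitting all larger lengths lets finitely many pairs
  share one length.\<close>

lemma exists_good_block: "\<exists>k0. \<forall>k\<ge>k0. \<exists>B. good_block K k x y B"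
proof (cases "x = y")
  case True
  have "good_block K k x y (map_pmf (\<lambda>L. (L, L)) (path_pmf K k x))" for k
    using True by (auto simp: good_block_def map_pmf_comp measure_map_pmf vimage_def)
  then show ?thesis by blast
next
  case False
  obtain k0 where k0: "\<And>k. k \<ge> k0 \<Longrightarrow> \<exists>C. map_pmf fst C = kern_pow K k x \<and> map_pmf snd C = kern_pow K k y \<and>
     1 / 2 \<le> measure_pmf.prob C {(a, b). a = b}"
    using exists_coupling[of x y] by blast
  have "\<exists>B. good_block K k x y B" if "k \<ge> k0" for k
  proof -
    from k0[OF that] obtain C where C: "map_pmf fst C = kern_pow K k x" "map_pmf snd C = kern_pow K k y"
      "1 / 2 \<le> measure_pmf.prob C {(a, b). a = b}" by blast
    obtain B where B: "map_pmf fst B = path_pmf K k x" "map_pmf snd B = path_pmf K k y"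
      "map_pmf (\<lambda>(a, b). (last (x # a), last (y # b))) B = C"
      using bridge[OF C(1,2)] by blast
    have "measure_pmf.prob B {(a, b). last (x # a) \<noteq> last (y # b)} = measure_pmf.prob C (- {(a, b). a = b})"
      unfolding B(3)[symmetric] measure_map_pmf by (rule arg_cong2[where f = measure]) auto
    also have "\<dots> = 1 - measure_pmf.prob C {(a, b). a = b}"
      by (subst measure_pmf.prob_compl[symmetric]) (auto simp: Compl_eq_Diff_UNIV)
    finally show ?thesis using B C(3) False by (intro exI[of _ B]) (auto simp: good_block_def)
  qed
  then show ?thesis by blast
qed

text \<open>The fallback to independent paths gives the right marginals for every \<open>k\<close>,
  \<open>x\<close> and \<open>y\<close>.\<close>

definition block :: "nat \<Rightarrow> 's \<Rightarrow> 's \<Rightarrow> ('s list \<times> 's list) pmf" where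
  "block k x y = (if \<exists>B. good_block K k x y B then SOME B. good_block K k x y B
                  else pair_pmf (path_pmf K k x) (path_pmf K k y))"

lemma good_block_block: "\<exists>B. good_block K k x y B \<Longrightarrow> good_block K k x y (block k x y)"
  unfolding block_def by (simp add: someI_ex)

lemma block_marginals: "map_pmf fst (block k x y) = path_pmf K k x" "map_pmf snd (block k x y) = path_pmf K k y"
proof -
  have "map_pmf fst (block k x y) = path_pmf K k x \<and> map_pmf snd (block k x y) = path_pmf K k y"
  proof (cases "\<exists>B. good_block K k x y B")
    case True
    then have "good_block K k x y (block k x y)" by (rule good_block_block)
    then show ?thesis by (simp add: good_block_def)
  next
    case False
    then show ?thesis by (simp add: block_def map_fst_pair_pmf map_snd_pair_pmf)
  qed
  then show "map_pmf fst (block k x y) = path_pmf K k x" "map_pmf snd (block k x y) = path_pmf K k y" by auto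
qed

lemma finite_block: "finite (set_pmf (block k x y))"
proof (rule finite_subset)
  show "set_pmf (block k x y) \<subseteq> set_pmf (path_pmf K k x) \<times> set_pmf (path_pmf K k y)"
    unfolding block_marginals[of k x y, symmetric] by force
qed (simp add: finite_path finite_K)

definition extend :: "'s \<Rightarrow> 's \<Rightarrow> nat \<Rightarrow> 's list \<times> 's list \<Rightarrow> ('s list \<times> 's list) pmf" where
  "extend x y k L = map_pmf (\<lambda>(a, b). (fst L @ a, snd L @ b)) (block k (last (x # fst L)) (last (y # snd L)))"

lemma exists_block_length:
  assumes "finite S"
  shows "\<exists>k\<ge>1. \<forall>L\<in>S. \<exists>B. good_block K k (last (x # fst L)) (last (y # snd L)) B"
  using assms
proof (induction S)
  case empty
  show ?case by auto
next
  case (insert L S)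
  have "\<exists>k1. \<forall>k\<ge>k1. \<forall>L\<in>insert L S. \<exists>B. good_block K k (last (x # fst L)) (last (y # snd L)) B"
    using \<open>finite S\<close>
  proof (induction S)
    case empty
    show ?case using exists_good_block[of "last (x # fst L)" "last (y # snd L)"] by simp
  next
    case (insert L' S)
    then obtain k1 where k1: "\<forall>k\<ge>k1. \<forall>L\<in>insert L S. \<exists>B. good_block K k (last (x # fst L)) (last (y # snd L)) B"
      by blast
    obtain k2 where k2: "\<forall>k\<ge>k2. \<exists>B. good_block K k (last (x # fst L')) (last (y # snd L')) B"
      using exists_good_block by blast
    show ?case using k1 k2 by (intro exI[of _ "max k1 k2"]) auto
  qed
  then obtain k1 where "\<forall>k\<ge>k1. \<forall>L\<in>insert L S. \<exists>B. good_block K k (last (x # fst L)) (last (y # snd L)) B" by blast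
  then show ?case by (intro exI[of _ "max 1 k1"]) auto
qed

text \<open>
  All stages have finite support, so one block length serves every pair of current states, and
  the block boundaries are deterministic.
\<close>

definition block_length :: "'s \<Rightarrow> 's \<Rightarrow> ('s list \<times> 's list) pmf \<Rightarrow> nat" where
  "block_length x y \<mu> = (SOME k. k \<ge> 1 \<and> (\<forall>L\<in>set_pmf \<mu>. \<exists>B. good_block K k (last (x # fst L)) (last (y # snd L)) B))"

primrec stage :: "'s \<Rightarrow> 's \<Rightarrow> nat \<Rightarrow> ('s list \<times> 's list) pmf" where
  "stage x y 0 = return_pmf ([], [])"
| "stage x y (Suc j) = bind_pmf (stage x y j) (extend x y (block_length x y (stage x y j)))"

definition stage_time :: "'s \<Rightarrow> 's \<Rightarrow> nat \<Rightarrow> nat" where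
  "stage_time x y j = (\<Sum>i<j. block_length x y (stage x y i))"

lemma finite_stage: "finite (set_pmf (stage x y j))"
  by (induction j) (auto simp: extend_def finite_block)

lemma block_length:
  "1 \<le> block_length x y (stage x y j)"
  "L \<in> set_pmf (stage x y j) \<Longrightarrow> good_block K (block_length x y (stage x y j)) (last (x # fst L)) (last (y # snd L))
     (block (block_length x y (stage x y j)) (last (x # fst L)) (last (y # snd L)))"
proof -
  have *: "1 \<le> block_length x y (stage x y j) \<and>
    (\<forall>L\<in>set_pmf (stage x y j). \<exists>B. good_block K (block_length x y (stage x y j)) (last (x # fst L)) (last (y # snd L)) B)"
    unfolding block_length_def by (rule someI_ex) (use exists_block_length[OF finite_stage] in blast)
  then show "1 \<le> block_length x y (stage x y j)" by blast
  assume "L \<in> set_pmf (stage x y j)"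
  with * have "\<exists>B. good_block K (block_length x y (stage x y j)) (last (x # fst L)) (last (y # snd L)) B" by blast
  then show "good_block K (block_length x y (stage x y j)) (last (x # fst L)) (last (y # snd L))
     (block (block_length x y (stage x y j)) (last (x # fst L)) (last (y # snd L)))"
    by (rule good_block_block)
qed

text \<open>The marginal of a block depends only on its own starting state, and the block length on
  neither state, so \<open>path_add\<close> assembles each marginal separately.\<close>

lemma stage_marginals:
  "map_pmf fst (stage x y j) = path_pmf K (stage_time x y j) x"
  "map_pmf snd (stage x y j) = path_pmf K (stage_time x y j) y"
proof -
  have "map_pmf fst (stage x y j) = path_pmf K (stage_time x y j) x \<and> map_pmf snd (stage x y j) = path_pmf K (stage_time x y j) y"
  proof (induction j)
    case 0
    show ?case by (simp add: stage_time_def)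
  next
    case (Suc j)
    let ?k = "block_length x y (stage x y j)"
    have e1: "map_pmf fst (extend x y ?k L) = map_pmf (append (fst L)) (path_pmf K ?k (last (x # fst L)))" for L
      unfolding block_marginals(1)[symmetric, where y = "last (y # snd L)"] extend_def
      by (simp add: map_pmf_comp split_def)
    have e2: "map_pmf snd (extend x y ?k L) = map_pmf (append (snd L)) (path_pmf K ?k (last (y # snd L)))" for L
      unfolding block_marginals(2)[symmetric, where x = "last (x # fst L)"] extend_def
      by (simp add: map_pmf_comp split_def)
    have t: "stage_time x y (Suc j) = stage_time x y j + ?k" by (simp add: stage_time_def)
    show ?case unfolding t path_add stage.simps map_bind_pmf e1 e2
      using Suc.IH by (simp add: bind_map_pmf flip: conjunct1[OF Suc.IH] conjunct2[OF Suc.IH])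
  qed
  then show "map_pmf fst (stage x y j) = path_pmf K (stage_time x y j) x"
    "map_pmf snd (stage x y j) = path_pmf K (stage_time x y j) y" by auto
qed

lemma stage_time_ge: "j \<le> stage_time x y j"
proof (induction j)
  case (Suc j)
  then show ?case using block_length(1)[of x y j] by (simp add: stage_time_def)
qed simp

end

lemma measurable_map_list:
  fixes Z :: "'i \<Rightarrow> 'w \<Rightarrow> 's::countable"
  assumes "\<And>i. i \<in> set is \<Longrightarrow> Z i \<in> measurable M (count_space UNIV)"
  shows "(\<lambda>\<omega>. map (\<lambda>i. Z i \<omega>) is) \<in> measurable M (count_space UNIV)"
  using assms
proof (induction "is")
  case (Cons i ks)
  have "(\<lambda>\<omega>. (Z i \<omega>, map (\<lambda>i. Z i \<omega>) ks)) \<in> measurable M (count_space UNIV \<Otimes>\<^sub>M count_space UNIV)"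
    using Cons by (intro measurable_Pair) auto
  then have "(\<lambda>\<omega>. (Z i \<omega>, map (\<lambda>i. Z i \<omega>) ks)) \<in> measurable M (count_space UNIV)"
    by (simp add: pair_measure_countable)
  from measurable_compose[OF this, of "\<lambda>(a, b). a # b" "count_space UNIV"] show ?case by simp
qed simp

context lazy_liouville_kernel
begin

text \<open>The histories form a Markov sequence \<open>\<omega>\<close>, one block per index.
  Position \<open>k\<close> is read off the history of index \<open>k\<close>, which is long enough
  as every block has length at least 1. After \<open>j\<close> blocks the copies are apart with
  probability at most \<open>(1 / 2) ^ j\<close>.\<close>

theorem exists_discrete_coupling:
  fixes x y :: 's
  shows "\<exists>M :: (nat \<Rightarrow> 's list \<times> 's list) measure. \<exists>X Y. prob_space M \<and>
    (\<forall>k. X k \<in> measurable M (count_space UNIV)) \<and> (\<forall>k. Y k \<in> measurable M (count_space UNIV)) \<and>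
    (\<forall>\<omega>. X 0 \<omega> = x) \<and> (\<forall>\<omega>. Y 0 \<omega> = y) \<and>
    (\<forall>k. distr M (count_space UNIV) (\<lambda>\<omega>. map (\<lambda>i. X i \<omega>) [1..<Suc k]) = measure_pmf (path_pmf K k x)) \<and>
    (\<forall>k. distr M (count_space UNIV) (\<lambda>\<omega>. map (\<lambda>i. Y i \<omega>) [1..<Suc k]) = measure_pmf (path_pmf K k y)) \<and>
    (AE \<omega> in M. \<exists>k0. \<forall>k\<ge>k0. X k \<omega> = Y k \<omega>)"
proof -
  define \<mu> where "\<mu> = stage x y"
  define N where "N j = block_length x y (\<mu> j)" for j
  define t where "t = stage_time x y"
  obtain M where M: "prob_space M"
    and MM: "\<forall>j. (\<lambda>\<omega>. \<omega> j) \<in> measurable M (count_space UNIV)"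
      "\<forall>F :: 's list \<times> 's list \<Rightarrow> ennreal. (\<integral>\<^sup>+\<omega>. F (\<omega> 0) \<partial>M) = F ([], [])"
      "\<forall>j. \<forall>F :: 's list \<times> 's list \<Rightarrow> 's list \<times> 's list \<Rightarrow> ennreal.
        (\<integral>\<^sup>+\<omega>. F (\<omega> j) (\<omega> (Suc j)) \<partial>M) = (\<integral>\<^sup>+\<omega>. (\<integral>\<^sup>+b. F (\<omega> j) b \<partial>extend x y (N j) (\<omega> j)) \<partial>M)"
    using exists_markov_sequence[of "([], [])" "\<lambda>j. extend x y (N j)"] by (elim exE conjE) (rule that)
  note meas = MM(1)[rule_format] and init = MM(2)[rule_format] and step = MM(3)[rule_format]
  interpret M: prob_space M by (rule M)
  note [measurable] = meas
  have law: "(\<integral>\<^sup>+\<omega>. F (\<omega> j) \<partial>M) = (\<integral>\<^sup>+a. F a \<partial>\<mu> j)" for F :: "'s list \<times> 's list \<Rightarrow> ennreal" and j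
  proof (induction j arbitrary: F)
    case 0
    show ?case by (simp add: init \<mu>_def)
  next
    case (Suc j)
    have "(\<integral>\<^sup>+\<omega>. F (\<omega> (Suc j)) \<partial>M) = (\<integral>\<^sup>+\<omega>. (\<integral>\<^sup>+b. F b \<partial>extend x y (N j) (\<omega> j)) \<partial>M)"
      by (rule step)
    also have "\<dots> = (\<integral>\<^sup>+a. (\<integral>\<^sup>+b. F b \<partial>extend x y (N j) a) \<partial>\<mu> j)" by (rule Suc.IH)
    also have "\<dots> = (\<integral>\<^sup>+b. F b \<partial>\<mu> (Suc j))" by (simp add: \<mu>_def N_def)
    finally show ?case .
  qed
  have distr_state: "distr M (count_space UNIV) (\<lambda>\<omega>. \<omega> j) = measure_pmf (\<mu> j)" for j
  proof (rule measure_eqI)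
    fix A :: "('s list \<times> 's list) set"
    have "emeasure (distr M (count_space UNIV) (\<lambda>\<omega>. \<omega> j)) A = (\<integral>\<^sup>+\<omega>. indicator A (\<omega> j) \<partial>M)"
      by (subst nn_integral_indicator[symmetric], simp, subst nn_integral_distr) auto
    then show "emeasure (distr M (count_space UNIV) (\<lambda>\<omega>. \<omega> j)) A = emeasure (measure_pmf (\<mu> j)) A"
      by (simp add: law)
  qed simp
  have AE_state: "AE \<omega> in M. \<omega> j \<in> set_pmf (\<mu> j)" for j
  proof -
    have "AE a in distr M (count_space UNIV) (\<lambda>\<omega>. \<omega> j). a \<in> set_pmf (\<mu> j)"
      unfolding distr_state by (rule AE_pmfI)
    then show ?thesis by (subst (asm) AE_distr_iff) auto
  qed
  have AE_step: "AE \<omega> in M. \<omega> (Suc j) \<in> set_pmf (extend x y (N j) (\<omega> j))" for j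
  proof -
    have "(\<integral>\<^sup>+\<omega>. indicator {p. snd p \<notin> set_pmf (extend x y (N j) (fst p))} (\<omega> j, \<omega> (Suc j)) \<partial>M)
       = (\<integral>\<^sup>+\<omega>. (\<integral>\<^sup>+b. indicator {p. snd p \<notin> set_pmf (extend x y (N j) (fst p))} (\<omega> j, b) \<partial>extend x y (N j) (\<omega> j)) \<partial>M)"
      by (rule step[of "\<lambda>a b. indicator {p. snd p \<notin> set_pmf (extend x y (N j) (fst p))} (a, b)" j])
    also have "\<dots> = (\<integral>\<^sup>+\<omega>. 0 \<partial>M)"
    proof (rule nn_integral_cong)
      fix \<omega>
      show "(\<integral>\<^sup>+b. indicator {p. snd p \<notin> set_pmf (extend x y (N j) (fst p))} (\<omega> j, b) \<partial>extend x y (N j) (\<omega> j)) = 0"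
        by (subst nn_integral_0_iff_AE) (auto simp: AE_measure_pmf_iff)
    qed
    also have "\<dots> = 0" by simp
    finally have int0: "(\<integral>\<^sup>+\<omega>. indicator {p. snd p \<notin> set_pmf (extend x y (N j) (fst p))} (\<omega> j, \<omega> (Suc j)) \<partial>M) = (0::ennreal)" .
    have "(\<lambda>\<omega>. (\<omega> j, \<omega> (Suc j))) \<in> measurable M (count_space UNIV \<Otimes>\<^sub>M count_space UNIV)"
      by (intro measurable_Pair meas)
    then have pm: "(\<lambda>\<omega>. (\<omega> j, \<omega> (Suc j))) \<in> measurable M (count_space UNIV)"
      by (simp add: pair_measure_countable)
    define u where "u p = (indicator {p. snd p \<notin> set_pmf (extend x y (N j) (fst p))} p :: ennreal)"
      for p :: "('s list \<times> 's list) \<times> ('s list \<times> 's list)"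
    have um: "(\<lambda>\<omega>. u (\<omega> j, \<omega> (Suc j))) \<in> borel_measurable M"
      by (rule measurable_compose[OF pm, of u borel]) simp
    have "(\<integral>\<^sup>+\<omega>. u (\<omega> j, \<omega> (Suc j)) \<partial>M) = 0" unfolding u_def by (rule int0)
    then have "AE \<omega> in M. u (\<omega> j, \<omega> (Suc j)) = 0"
      by (rule iffD1[OF nn_integral_0_iff_AE[OF um]])
    then show ?thesis
    proof (rule AE_mp, intro AE_I2 impI)
      fix \<omega> assume "u (\<omega> j, \<omega> (Suc j)) = 0"
      then show "\<omega> (Suc j) \<in> set_pmf (extend x y (N j) (\<omega> j))"
        by (simp add: u_def indicator_def split: if_splits)
    qed
  qed
  define cx cy where "cx = (\<lambda>L :: 's list \<times> 's list. last (x # fst L))" and "cy = (\<lambda>L :: 's list \<times> 's list. last (y # snd L))"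
  define D where "D = {L. cx L \<noteq> cy L}"
  \<comment> \<open>The indicator on the right encodes both properties of a block: failure at most
    1/2 when apart, and no separation once together.\<close>
  have half: "emeasure (extend x y (N j) L) D \<le> ennreal (1 / 2) * indicator D L" if "L \<in> set_pmf (\<mu> j)" for j L
  proof -
    have g: "good_block K (N j) (cx L) (cy L) (block (N j) (cx L) (cy L))"
      using block_length(2)[of L x y j] that by (simp add: N_def \<mu>_def cx_def cy_def)
    have eq: "measure_pmf.prob (extend x y (N j) L) D
        = measure_pmf.prob (block (N j) (cx L) (cy L)) {(a, b). last (cx L # a) \<noteq> last (cy L # b)}"
    proof -
      have "cx (fst L @ a, b) = last (cx L # a)" "cy (b, snd L @ a) = last (cy L # a)" for a b
        by (simp_all add: cx_def cy_def)
      then have "(\<lambda>(a, b). (fst L @ a, snd L @ b)) -` D = {(a, b). last (cx L # a) \<noteq> last (cy L # b)}"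
        unfolding D_def vimage_def by (simp only: split_def mem_Collect_eq)
      moreover have "extend x y (N j) L = map_pmf (\<lambda>(a, b). (fst L @ a, snd L @ b)) (block (N j) (cx L) (cy L))"
        unfolding extend_def cx_def cy_def ..
      ultimately show ?thesis by (simp only: measure_map_pmf)
    qed
    show ?thesis
    proof (cases "L \<in> D")
      case True
      have "measure_pmf.prob (extend x y (N j) L) D \<le> 1 / 2"
        using g unfolding eq good_block_def by blast
      then have "emeasure (extend x y (N j) L) D \<le> ennreal (1 / 2)"
        unfolding measure_pmf.emeasure_eq_measure by (rule ennreal_leI)
      with True show ?thesis by (simp only: indicator_simps mult_1_right)
    next
      case False
      then have "cx L = cy L" by (simp add: D_def)
      have "set_pmf (block (N j) (cx L) (cy L)) \<inter> {(a, b). last (cx L # a) \<noteq> last (cy L # b)} = {}"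
        using g unfolding good_block_def \<open>cx L = cy L\<close> by fast
      then have "measure_pmf.prob (block (N j) (cx L) (cy L)) {(a, b). last (cx L # a) \<noteq> last (cy L # b)} = 0"
        by (simp only: measure_pmf_zero_iff)
      then show ?thesis by (simp only: measure_pmf.emeasure_eq_measure eq) simp
    qed
  qed
  have decay: "emeasure (\<mu> j) D \<le> ennreal ((1 / 2) ^ j)" for j
  proof (induction j)
    case 0
    show ?case unfolding power_0 ennreal_1 by (rule measure_pmf.emeasure_le_1)
  next
    case (Suc j)
    have "emeasure (\<mu> (Suc j)) D = (\<integral>\<^sup>+L. emeasure (extend x y (N j) L) D \<partial>\<mu> j)"
      by (simp add: \<mu>_def N_def)
    also have "\<dots> \<le> (\<integral>\<^sup>+L. ennreal (1 / 2) * indicator D L \<partial>\<mu> j)"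
      by (intro nn_integral_mono_AE AE_pmfI half)
    also have "\<dots> = ennreal (1 / 2) * emeasure (\<mu> j) D" by (simp add: nn_integral_cmult)
    also have "\<dots> \<le> ennreal (1 / 2) * ennreal ((1 / 2) ^ j)" using Suc.IH by (rule mult_left_mono) simp
    also have "\<dots> = ennreal ((1 / 2) ^ Suc j)"
      unfolding power_Suc by (rule ennreal_mult[symmetric]) auto
    finally show ?case .
  qed
  have meet: "AE \<omega> in M. \<exists>j. \<omega> j \<notin> D"
  proof -
    have "emeasure M {\<omega> \<in> space M. \<forall>j. \<omega> j \<in> D} \<le> ennreal ((1 / 2) ^ j)" for j
    proof -
      have "emeasure M {\<omega> \<in> space M. \<forall>j. \<omega> j \<in> D} \<le> emeasure M {\<omega> \<in> space M. \<omega> j \<in> D}"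
        by (intro emeasure_mono) auto
      also have "\<dots> = emeasure (distr M (count_space UNIV) (\<lambda>\<omega>. \<omega> j)) D"
        by (subst emeasure_distr) (auto intro!: arg_cong2[where f = emeasure])
      also have "\<dots> \<le> ennreal ((1 / 2) ^ j)" unfolding distr_state by (rule decay)
      finally show ?thesis .
    qed
    moreover have "(\<lambda>j. ennreal ((1 / 2) ^ j)) \<longlonglongrightarrow> ennreal 0"
      by (intro tendsto_ennrealI LIMSEQ_power_zero) auto
    ultimately have "emeasure M {\<omega> \<in> space M. \<forall>j. \<omega> j \<in> D} \<le> 0"
      by (intro LIMSEQ_le_const[where X = "\<lambda>j. ennreal ((1 / 2) ^ j)"]) auto
    then have "emeasure M {\<omega> \<in> space M. \<not> (\<exists>j. \<omega> j \<notin> D)} = 0" by simp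
    then show ?thesis by (subst AE_iff_measurable[OF _ refl]) auto
  qed
  define good where "good \<omega> \<longleftrightarrow> (\<forall>j. \<omega> j \<in> set_pmf (\<mu> j) \<and> \<omega> (Suc j) \<in> set_pmf (extend x y (N j) (\<omega> j)))" for \<omega>
  have AE_good: "AE \<omega> in M. good \<omega>"
    unfolding good_def AE_all_countable using AE_state AE_step by (auto intro: AE_conjI)
  have len: "length (fst L) = t j" "length (snd L) = t j" if "L \<in> set_pmf (\<mu> j)" for L j
  proof -
    have "fst L \<in> set_pmf (path_pmf K (t j) x)" "snd L \<in> set_pmf (path_pmf K (t j) y)"
      using that unfolding t_def stage_marginals[symmetric] \<mu>_def by auto
    then show "length (fst L) = t j" "length (snd L) = t j" by (auto dest: length_path)
  qed
  have ext: "\<exists>a b. \<omega> (Suc j) = (fst (\<omega> j) @ a, snd (\<omega> j) @ b) \<and> (cx (\<omega> j) = cy (\<omega> j) \<longrightarrow> a = b)"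
    if "good \<omega>" for \<omega> j
  proof -
    have 1: "\<omega> j \<in> set_pmf (\<mu> j)" and 2: "\<omega> (Suc j) \<in> set_pmf (extend x y (N j) (\<omega> j))"
      using that by (auto simp: good_def)
    have g: "good_block K (N j) (cx (\<omega> j)) (cy (\<omega> j)) (block (N j) (cx (\<omega> j)) (cy (\<omega> j)))"
      using block_length(2)[of "\<omega> j" x y j] 1 by (simp add: N_def \<mu>_def cx_def cy_def)
    from 2 obtain a b where "(a, b) \<in> set_pmf (block (N j) (cx (\<omega> j)) (cy (\<omega> j)))"
      "\<omega> (Suc j) = (fst (\<omega> j) @ a, snd (\<omega> j) @ b)"
      by (auto simp: extend_def cx_def cy_def)
    then show ?thesis using g by (auto simp: good_block_def)
  qed
  have prefix: "\<exists>a b. \<omega> (i + d) = (fst (\<omega> i) @ a, snd (\<omega> i) @ b) \<and> (cx (\<omega> i) = cy (\<omega> i) \<longrightarrow> a = b)"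
    if "good \<omega>" for \<omega> i d
  proof (induction d)
    case 0
    show ?case by (intro exI[of _ "[]"]) simp
  next
    case (Suc d)
    then obtain a b where ab: "\<omega> (i + d) = (fst (\<omega> i) @ a, snd (\<omega> i) @ b)"
      "cx (\<omega> i) = cy (\<omega> i) \<Longrightarrow> a = b" by blast
    from ext[OF that, of "i + d"] obtain a' b' where
      ab': "\<omega> (Suc (i + d)) = (fst (\<omega> (i + d)) @ a', snd (\<omega> (i + d)) @ b')"
      "cx (\<omega> (i + d)) = cy (\<omega> (i + d)) \<Longrightarrow> a' = b'" by blast
    have "a @ a' = b @ b'" if eq: "cx (\<omega> i) = cy (\<omega> i)"
    proof -
      have "cx (\<omega> (i + d)) = cy (\<omega> (i + d))"
        using ab(1) ab(2)[OF eq] eq by (auto simp: cx_def cy_def last_append)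
      then show ?thesis using ab(2)[OF eq] ab'(2) by simp
    qed
    then show ?case using ab(1) ab'(1) by auto
  qed
  \<comment> \<open>Almost surely later histories extend earlier ones, so the same entry can be read
    off any later history.\<close>
  define X where "X k \<omega> = (x # fst (\<omega> k)) ! k" for k and \<omega> :: "nat \<Rightarrow> 's list \<times> 's list"
  define Y where "Y k \<omega> = (y # snd (\<omega> k)) ! k" for k and \<omega> :: "nat \<Rightarrow> 's list \<times> 's list"
  have measXY [measurable]: "X k \<in> measurable M (count_space UNIV)" "Y k \<in> measurable M (count_space UNIV)" for k
    unfolding X_def[abs_def] Y_def[abs_def] by (auto intro: measurable_compose[OF meas])
  have tge: "k \<le> t k" for k unfolding t_def by (rule stage_time_ge)
  have nth: "X i \<omega> = (x # fst (\<omega> k)) ! i" "Y i \<omega> = (y # snd (\<omega> k)) ! i" if "good \<omega>" "i \<le> k" for \<omega> i k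
  proof -
    from prefix[OF that(1), of i "k - i"] that(2)
    obtain a b where ab: "\<omega> k = (fst (\<omega> i) @ a, snd (\<omega> i) @ b)" by auto
    have "length (fst (\<omega> i)) = t i" "length (snd (\<omega> i)) = t i"
      using len that(1) by (auto simp: good_def)
    then show "X i \<omega> = (x # fst (\<omega> k)) ! i" "Y i \<omega> = (y # snd (\<omega> k)) ! i"
      using tge[of i] unfolding X_def Y_def ab append_Cons[symmetric] fst_conv snd_conv
      by (auto simp: nth_append simp del: append_Cons)
  qed
  have map_nth: "map (\<lambda>i. (z # L) ! i) [1..<Suc k] = take k L" if "k \<le> length L" for z :: 's and L k
    using that by (intro nth_equalityI) (auto simp del: upt_Suc)
  have lists: "map (\<lambda>i. X i \<omega>) [1..<Suc k] = take k (fst (\<omega> k))" "map (\<lambda>i. Y i \<omega>) [1..<Suc k] = take k (snd (\<omega> k))"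
    if "good \<omega>" for \<omega> k
  proof -
    have l: "length (fst (\<omega> k)) = t k" "length (snd (\<omega> k)) = t k"
      using len that by (auto simp: good_def)
    have "map (\<lambda>i. X i \<omega>) [1..<Suc k] = map (\<lambda>i. (x # fst (\<omega> k)) ! i) [1..<Suc k]"
      by (rule map_cong[OF refl], rule nth(1)[OF that]) auto
    also have "\<dots> = take k (fst (\<omega> k))" using l tge[of k] by (intro map_nth) linarith
    finally show "map (\<lambda>i. X i \<omega>) [1..<Suc k] = take k (fst (\<omega> k))" .
    have "map (\<lambda>i. Y i \<omega>) [1..<Suc k] = map (\<lambda>i. (y # snd (\<omega> k)) ! i) [1..<Suc k]"
      by (rule map_cong[OF refl], rule nth(2)[OF that]) auto
    also have "\<dots> = take k (snd (\<omega> k))" using l tge[of k] by (intro map_nth) linarith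
    finally show "map (\<lambda>i. Y i \<omega>) [1..<Suc k] = take k (snd (\<omega> k))" .
  qed
  have take_path: "map_pmf (take k) (path_pmf K (t k) z) = path_pmf K k z" for k z
    using path_take[of k K "t k - k" z] tge[of k] by simp
  have fin: "distr M (count_space UNIV) (\<lambda>\<omega>. map (\<lambda>i. Z i \<omega>) [1..<Suc k]) = measure_pmf (path_pmf K k z)"
    if m: "\<And>k. Z k \<in> measurable M (count_space UNIV)"
      and l: "\<And>\<omega>. good \<omega> \<Longrightarrow> map (\<lambda>i. Z i \<omega>) [1..<Suc k] = take k (f (\<omega> k))"
      and f: "map_pmf f (\<mu> k) = path_pmf K (t k) z"
    for Z :: "nat \<Rightarrow> (nat \<Rightarrow> 's list \<times> 's list) \<Rightarrow> 's" and f k z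
  proof -
    have "distr M (count_space UNIV) (\<lambda>\<omega>. map (\<lambda>i. Z i \<omega>) [1..<Suc k])
        = distr M (count_space UNIV) (\<lambda>\<omega>. take k (f (\<omega> k)))"
      using AE_good l by (intro distr_cong_AE refl measurable_map_list m measurable_compose[OF meas]) auto
    also have "\<dots> = distr (distr M (count_space UNIV) (\<lambda>\<omega>. \<omega> k)) (count_space UNIV) (\<lambda>L. take k (f L))"
      by (subst distr_distr) (auto simp: comp_def)
    also have "\<dots> = measure_pmf (map_pmf (\<lambda>L. take k (f L)) (\<mu> k))"
      unfolding distr_state map_pmf_rep_eq ..
    also have "map_pmf (\<lambda>L. take k (f L)) (\<mu> k) = map_pmf (take k) (map_pmf f (\<mu> k))"
      by (simp add: map_pmf_comp)
    also have "\<dots> = path_pmf K k z" by (simp add: f take_path)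
    finally show ?thesis .
  qed
  have "AE \<omega> in M. \<exists>k0. \<forall>k\<ge>k0. X k \<omega> = Y k \<omega>"
    using meet AE_good
  proof eventually_elim
    case (elim \<omega>)
    then obtain j where j: "cx (\<omega> j) = cy (\<omega> j)" by (auto simp: D_def)
    have l: "length (fst (\<omega> i)) = t i" "length (snd (\<omega> i)) = t i" for i
      using len elim by (auto simp: good_def)
    \<comment> \<open>\<open>k \<ge> j\<close> makes \<open>\<omega> k\<close> an extension of
      \<open>\<omega> j\<close>, and \<open>k > t j\<close> puts entry \<open>k\<close> into the
      appended part \<open>a\<close>, which both histories share.\<close>
    have "X k \<omega> = Y k \<omega>" if k: "k \<ge> Suc (max j (t j))" for k
    proof -
      obtain a where a: "\<omega> k = (fst (\<omega> j) @ a, snd (\<omega> j) @ a)"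
        using prefix[OF elim(2), of j "k - j"] j k by auto
      show ?thesis using k l[of j] unfolding X_def Y_def a
        by (cases k) (auto simp: nth_append)
    qed
    then show ?case by blast
  qed
  moreover have "\<And>k. distr M (count_space UNIV) (\<lambda>\<omega>. map (\<lambda>i. X i \<omega>) [1..<Suc k]) = measure_pmf (path_pmf K k x)"
    by (rule fin[OF measXY(1) lists(1)]) (auto simp: \<mu>_def t_def stage_marginals(1))
  moreover have "\<And>k. distr M (count_space UNIV) (\<lambda>\<omega>. map (\<lambda>i. Y i \<omega>) [1..<Suc k]) = measure_pmf (path_pmf K k y)"
    by (rule fin[OF measXY(2) lists(2)]) (auto simp: \<mu>_def t_def stage_marginals(2))
  ultimately show ?thesis using M measXY
    by (intro exI[of _ M] exI[of _ X] exI[of _ Y]) (auto simp: X_def Y_def)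
qed

end

section \<open>The Poisson clock\<close>

definition arrival :: "nat \<Rightarrow> real stream \<Rightarrow> real" where
  "arrival n e = (\<Sum>i<n. e !! i)"

definition in_window :: "real \<Rightarrow> nat \<Rightarrow> real stream \<Rightarrow> bool" where
  "in_window t n e \<longleftrightarrow> arrival n e \<le> t \<and> t < arrival (Suc n) e"

text \<open>Each pair is a waiting time and the number of arrivals during it; \<open>t\<close> and
  \<open>n\<close> accumulate, so that the recursion can start at any time and count.\<close>

fun counts_match :: "real \<Rightarrow> nat \<Rightarrow> (real \<times> nat) list \<Rightarrow> real stream \<Rightarrow> bool" where
  "counts_match t n [] e = True"
| "counts_match t n ((d, k) # ds) e = (in_window (t + d) (n + k) e \<and> counts_match (t + d) (n + k) ds e)"

lemma arrival_0 [simp]: "arrival 0 e = 0" by (simp add: arrival_def)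

lemma arrival_Suc_Stream [simp]: "arrival (Suc n) (u ## e) = u + arrival n e"
  unfolding arrival_def by (subst sum.lessThan_Suc_shift) simp

lemma counts_match_later: "counts_match t (Suc n) ds (u ## e) = counts_match (t - u) n ds e"
proof (induction "t" n ds e arbitrary: t rule: counts_match.induct)
  case (2 t' n d k ds e)
  have "in_window (t + d) (Suc n + k) (u ## e) = in_window (t - u + d) (n + k) e"
    by (auto simp: in_window_def)
  moreover have "counts_match (t + d) (Suc (n + k)) ds (u ## e) = counts_match (t - u + d) (n + k) ds e"
    using 2[of "t + d"] by (simp add: algebra_simps)
  ultimately show ?case by simp
qed simp

text \<open>Waiting for \<open>d\<close> only uses up part of the first waiting time. Nonnegative
  times are used at count 0, where the lower end of the window is 0 and does not move with
  \<open>u\<close>.\<close>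

lemma counts_match_shift:
  assumes "0 \<le> d" "0 \<le> t" "\<forall>(d', k)\<in>set ds. 0 \<le> d'"
  shows "counts_match (t + d) n ds (u ## e) = counts_match t n ds ((u - d) ## e)"
  using assms
proof (induction ds arbitrary: t n)
  case (Cons a ds)
  obtain d' k where a: "a = (d', k)" by (cases a)
  have "in_window (t + d + d') (n + k) (u ## e) = in_window (t + d') (n + k) ((u - d) ## e)"
    using Cons.prems by (cases "n + k") (auto simp: in_window_def a)
  moreover have "counts_match (t + d' + d) (n + k) ds (u ## e) = counts_match (t + d') (n + k) ds ((u - d) ## e)"
    using Cons.prems by (intro Cons.IH) (auto simp: a)
  ultimately show ?case by (simp add: a add_ac)
qed simp

text \<open>Includes rate 0, as observation times may coincide.\<close>

definition pois :: "real \<Rightarrow> nat pmf" where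
  "pois r = (if r \<le> 0 then return_pmf 0 else poisson_pmf r)"

lemma pmf_pois: "0 \<le> r \<Longrightarrow> pmf (pois r) k = r ^ k / fact k * exp (- r)"
  by (cases k) (auto simp: pois_def)

lemma pmf_bind_Cons:
  "pmf (bind_pmf p (\<lambda>y. map_pmf (Cons y) (f y))) (y # ys) = pmf p y * pmf (f y) ys"
proof -
  have "pmf (map_pmf (Cons y') (f y')) (y # ys) = indicator {y} y' * pmf (f y) ys" for y'
  proof (cases "y' = y")
    case True
    then show ?thesis by (simp add: pmf_map_inj')
  next
    case False
    then have "y # ys \<notin> set_pmf (map_pmf (Cons y') (f y'))" by auto
    then have "pmf (map_pmf (Cons y') (f y')) (y # ys) = 0" by (simp only: set_pmf_iff not_not)
    then show ?thesis using False by simp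
  qed
  then show ?thesis by (simp add: pmf_bind measure_pmf_single)
qed

locale clock =
  fixes R :: real
  assumes R: "0 < R"
begin

definition expo :: "real measure" where
  "expo = density lborel (\<lambda>u. ennreal (exponential_density R u))"

definition W :: "real stream measure" where "W = stream_space expo"

lemma prob_expo: "prob_space expo"
  unfolding expo_def by (rule prob_space_exponential_density[OF R])

sublocale E: prob_space expo by (rule prob_expo)

sublocale W: prob_space W unfolding W_def by (rule E.prob_space_stream_space)

lemma sets_expo [measurable_cong]: "sets expo = sets borel" by (simp add: expo_def)

lemma space_expo [simp]: "space expo = UNIV" by (simp add: expo_def)

lemma space_W [simp]: "space W = UNIV" by (simp add: W_def space_stream_space)

lemma measurable_arrival [measurable]: "arrival n \<in> borel_measurable W"
proof -
  have "(\<lambda>e. e !! i) \<in> borel_measurable W" for i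
    unfolding W_def using measurable_snth[of i expo] by (simp add: measurable_cong_sets[OF refl sets_expo])
  then show ?thesis unfolding arrival_def[abs_def] by (intro borel_measurable_sum) auto
qed

lemma measurable_counts_match [measurable]: "Measurable.pred W (counts_match t n ds)"
proof (induction ds arbitrary: t n)
  case Nil
  have "counts_match t n [] = (\<lambda>_. True)" by auto
  then show ?case by simp
next
  case (Cons a ds)
  have "counts_match t n (a # ds) = (\<lambda>e. (arrival (n + snd a) e \<le> t + fst a \<and>
      t + fst a < arrival (Suc (n + snd a)) e) \<and> counts_match (t + fst a) (n + snd a) ds e)"
    by (cases a) (auto simp: in_window_def)
  then show ?case using Cons[of "t + fst a" "n + snd a"] by simp
qed

lemma AE_pos: "AE e in W. \<forall>i. 0 < e !! i"
proof -
  have "AE u in expo. 0 < u"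
  proof -
    have "AE u in lborel. 0 < ennreal (exponential_density R u) \<longrightarrow> 0 < u"
      using AE_lborel_singleton[of "0::real"] by eventually_elim (auto simp: exponential_density_def)
    then show ?thesis unfolding expo_def by (subst AE_density) auto
  qed
  then have "AE e in stream_space expo. stream_all (\<lambda>u. 0 < u) e"
    by (intro E.AE_stream_all) auto
  then show ?thesis unfolding W_def by (rule eventually_mono) (auto simp: stream.pred_set snth_sset)
qed

lemma arrival_nonneg: "(\<And>i. 0 < e !! i) \<Longrightarrow> 0 \<le> arrival n e"
  unfolding arrival_def by (intro sum_nonneg) (auto simp: less_imp_le)

text \<open>Convolution over the time \<open>u\<close> of the first arrival: the exponentials
  combine to \<open>exp (- R * d)\<close>, and what remains is polynomial, with antiderivative
  \<open>F\<close>.\<close>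

lemma poisson_integral:
  assumes "0 \<le> d"
  shows "(\<integral>\<^sup>+u. ennreal (exponential_density R u) * (ennreal (pmf (pois (R * (d - u))) k) * indicator {..d} u) \<partial>lborel)
    = ennreal (pmf (pois (R * d)) (Suc k))"
proof -
  define f where "f u = exp (- R * d) * (R ^ Suc k * (d - u) ^ k / fact k)" for u
  define F where "F u = - exp (- R * d) * (R ^ Suc k * (d - u) ^ Suc k / fact (Suc k))" for u
  have "(\<integral>\<^sup>+u. ennreal (exponential_density R u) * (ennreal (pmf (pois (R * (d - u))) k) * indicator {..d} u) \<partial>lborel)
     = (\<integral>\<^sup>+u. ennreal (f u) * indicator {0..d} u \<partial>lborel)"
  proof (rule nn_integral_cong)
    fix u :: real
    show "ennreal (exponential_density R u) * (ennreal (pmf (pois (R * (d - u))) k) * indicator {..d} u)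
        = ennreal (f u) * indicator {0..d} u"
    proof (cases "0 \<le> u \<and> u \<le> d")
      case True
      then have "0 \<le> R * (d - u)" using R by simp
      then have "exponential_density R u * pmf (pois (R * (d - u))) k
          = R * (exp (- u * R) * exp (- (R * (d - u)))) * (R * (d - u)) ^ k / fact k"
        using True by (simp add: exponential_density_def pmf_pois)
      also have "exp (- u * R) * exp (- (R * (d - u))) = exp (- R * d)"
        by (simp add: algebra_simps flip: exp_add)
      finally have "exponential_density R u * pmf (pois (R * (d - u))) k = f u"
        by (simp add: f_def power_mult_distrib)
      then show ?thesis using True R
        by (simp add: ennreal_mult[symmetric] exponential_density_nonneg)
    next
      case False
      then show ?thesis by (auto simp: exponential_density_def indicator_def)
    qed
  qed
  also have "\<dots> = ennreal (F d - F 0)"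
  proof (rule nn_integral_FTC_Icc)
    show "f \<in> borel_measurable borel" unfolding f_def by measurable
    show "DERIV F u :> f u" if "u \<in> {0..d}" for u
    proof -
      have "((\<lambda>u. (d - u) ^ Suc k) has_real_derivative real (Suc k) * (d - u) ^ k * (- 1)) (at u)"
        by (auto intro!: derivative_eq_intros simp del: power_Suc)
      from DERIV_cmult[OF this, of "- exp (- R * d) * R ^ Suc k / fact (Suc k)"]
      show ?thesis by (simp add: F_def[abs_def] f_def mult_ac del: of_nat_Suc power_Suc)
    qed
    show "0 \<le> f u" if "u \<in> {0..d}" for u using that R by (simp add: f_def)
  qed (use assms in auto)
  also have "F d - F 0 = pmf (pois (R * d)) (Suc k)"
    using assms R by (simp add: F_def pmf_pois power_mult_distrib mult_ac del: fact_Suc)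
  finally show ?thesis .
qed

lemma memoryless:
  assumes g: "g \<in> borel_measurable borel" and d: "0 \<le> d"
  shows "(\<integral>\<^sup>+u. g (u - d) * indicator {d<..} u \<partial>expo) = ennreal (exp (- R * d)) * (\<integral>\<^sup>+u. g u \<partial>expo)"
proof -
  let ?f = "\<lambda>u. ennreal (exponential_density R u)"
  have "(\<integral>\<^sup>+u. g (u - d) * indicator {d<..} u \<partial>expo) = (\<integral>\<^sup>+u. ?f u * (g (u - d) * indicator {d<..} u) \<partial>lborel)"
    unfolding expo_def using g by (subst nn_integral_density) auto
  also have "\<dots> = (\<integral>\<^sup>+u. ?f (d + u) * (g u * indicator {0<..} u) \<partial>lborel)"
    using g by (subst nn_integral_real_affine[of _ 1 d]) (auto simp: indicator_def intro!: nn_integral_cong)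
  also have "\<dots> = (\<integral>\<^sup>+u. ennreal (exp (- R * d)) * (?f u * g u) \<partial>lborel)"
  proof (rule nn_integral_cong_AE)
    show "AE u in lborel. ?f (d + u) * (g u * indicator {0<..} u) = ennreal (exp (- R * d)) * (?f u * g u)"
      using AE_lborel_singleton[of "0::real"]
    proof eventually_elim
      case (elim u)
      show ?case
      proof (cases "u > 0")
        case True
        then have "exponential_density R (d + u) = exp (- R * d) * exponential_density R u"
          using d by (simp add: exponential_density_def algebra_simps flip: exp_add)
        then show ?thesis using True R by (simp add: ennreal_mult exponential_density_nonneg mult_ac)
      next
        case False
        then have "u < 0" using elim by simp
        then show ?thesis by (simp add: exponential_density_def)
      qed
    qed
  qed
  also have "\<dots> = ennreal (exp (- R * d)) * (\<integral>\<^sup>+u. ?f u * g u \<partial>lborel)"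
    using g by (intro nn_integral_cmult) auto
  also have "(\<integral>\<^sup>+u. ?f u * g u \<partial>lborel) = (\<integral>\<^sup>+u. g u \<partial>expo)"
    unfolding expo_def using g by (subst nn_integral_density) auto
  finally show ?thesis .
qed

lemma nn_integral_W:
  "f \<in> borel_measurable W \<Longrightarrow> (\<integral>\<^sup>+e. f e \<partial>W) = (\<integral>\<^sup>+u. (\<integral>\<^sup>+e. f (u ## e) \<partial>W) \<partial>expo)"
  unfolding W_def by (rule E.nn_integral_stream_space)

text \<open>Induction on the first arrival: it is memoryless, and the process starts afresh after it.\<close>

lemma counts_law:
  assumes "\<forall>(d, k)\<in>set ds. 0 \<le> d"
  shows "(\<integral>\<^sup>+e. indicator {e. counts_match 0 0 ds e} e \<partial>W) = ennreal (prod_list (map (\<lambda>(d, k). pmf (pois (R * d)) k) ds))"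
  using assms
proof (induction ds)
  case Nil
  show ?case using W.emeasure_space_1 by simp
next
  case (Cons a ds)
  let ?I = "\<lambda>ds e. indicator {e. counts_match 0 0 ds e} e :: ennreal"
  let ?p = "prod_list (map (\<lambda>(d, k). pmf (pois (R * d)) k) ds)"
  have ds: "\<forall>(d, k)\<in>set ds. 0 \<le> d" using Cons.prems by auto
  have p0: "0 \<le> ?p" by (rule prod_list_nonneg) auto
  note IH = Cons.IH[OF ds]
  have meas: "?I ds \<in> borel_measurable W" for ds by measurable
  have measS: "(\<lambda>u. \<integral>\<^sup>+e. ?I ds (u ## e) \<partial>W) \<in> borel_measurable borel" for ds
  proof -
    have "(\<lambda>(u, e). ?I ds (u ## e)) \<in> borel_measurable (expo \<Otimes>\<^sub>M W)"
      using meas[of ds] unfolding W_def by measurable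
    then have "(\<lambda>u. \<integral>\<^sup>+e. ?I ds (u ## e) \<partial>W) \<in> borel_measurable expo" by measurable
    then show ?thesis by (simp add: measurable_cong_sets[OF sets_expo refl])
  qed
  \<comment> \<open>Inner induction on \<open>k\<close> for all \<open>d\<close>: without an arrival
    in the gap, memorylessness passes to the remaining gaps; otherwise the first arrival is removed
    and the gap shrinks to \<open>d - u\<close>.\<close>
  have "(\<integral>\<^sup>+e. ?I ((d, k) # ds) e \<partial>W) = ennreal (pmf (pois (R * d)) k * ?p)" if "0 \<le> d" for d k
    using that
  proof (induction k arbitrary: d)
    case 0
    have "(\<integral>\<^sup>+e. ?I ((d, 0) # ds) e \<partial>W) = (\<integral>\<^sup>+u. (\<integral>\<^sup>+e. ?I ((d, 0) # ds) (u ## e) \<partial>W) \<partial>expo)"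
      by (rule nn_integral_W[OF meas])
    also have "\<dots> = (\<integral>\<^sup>+u. (\<integral>\<^sup>+e. ?I ds ((u - d) ## e) \<partial>W) * indicator {d<..} u \<partial>expo)"
    proof (rule nn_integral_cong)
      fix u
      have "counts_match 0 0 ((d, 0) # ds) (u ## e) \<longleftrightarrow> d < u \<and> counts_match 0 0 ds ((u - d) ## e)" for e
        using counts_match_shift[of d 0 ds 0 u e] 0 ds by (simp add: in_window_def)
      then have "?I ((d, 0) # ds) (u ## e) = ?I ds ((u - d) ## e) * indicator {d<..} u" for e
        by (auto simp: indicator_def)
      moreover have "(\<lambda>e. ?I ds ((u - d) ## e)) \<in> borel_measurable W"
        using meas[of ds] unfolding W_def by measurable
      ultimately show "(\<integral>\<^sup>+e. ?I ((d, 0) # ds) (u ## e) \<partial>W) = (\<integral>\<^sup>+e. ?I ds ((u - d) ## e) \<partial>W) * indicator {d<..} u"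
        by (simp add: nn_integral_multc)
    qed
    also have "\<dots> = ennreal (exp (- R * d)) * (\<integral>\<^sup>+u. (\<integral>\<^sup>+e. ?I ds (u ## e) \<partial>W) \<partial>expo)"
      by (rule memoryless[OF measS 0])
    also have "(\<integral>\<^sup>+u. (\<integral>\<^sup>+e. ?I ds (u ## e) \<partial>W) \<partial>expo) = ennreal ?p"
      unfolding nn_integral_W[OF meas, symmetric] by (rule IH)
    also have "ennreal (exp (- R * d)) * ennreal ?p = ennreal (pmf (pois (R * d)) 0 * ?p)"
      using 0 R p0 by (simp add: pmf_pois ennreal_mult)
    finally show ?case .
  next
    case (Suc k)
    have "(\<integral>\<^sup>+e. ?I ((d, Suc k) # ds) e \<partial>W) = (\<integral>\<^sup>+u. (\<integral>\<^sup>+e. ?I ((d, Suc k) # ds) (u ## e) \<partial>W) \<partial>expo)"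
      by (rule nn_integral_W[OF meas])
    also have "\<dots> = (\<integral>\<^sup>+u. ennreal ?p * (ennreal (pmf (pois (R * (d - u))) k) * indicator {..d} u) \<partial>expo)"
    proof (rule nn_integral_cong)
      fix u
      have eq: "?I ((d, Suc k) # ds) (u ## e) = ?I ((d - u, k) # ds) e" for e
        by (auto simp: indicator_def in_window_def counts_match_later)
      show "(\<integral>\<^sup>+e. ?I ((d, Suc k) # ds) (u ## e) \<partial>W)
          = ennreal ?p * (ennreal (pmf (pois (R * (d - u))) k) * indicator {..d} u)"
      proof (cases "u \<le> d")
        case True
        then have "(\<integral>\<^sup>+e. ?I ((d - u, k) # ds) e \<partial>W) = ennreal (pmf (pois (R * (d - u))) k * ?p)"
          by (intro Suc.IH) simp
        moreover have "indicator {..d} u = (1 :: ennreal)" using True by simp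
        ultimately show ?thesis
          unfolding eq by (simp only: ennreal_mult[OF pmf_nonneg p0] mult_1_right) (rule mult.commute)
      next
        case False
        have "(\<integral>\<^sup>+e. ?I ((d - u, k) # ds) e \<partial>W) = (\<integral>\<^sup>+e. 0 \<partial>W)"
        proof (rule nn_integral_cong_AE)
          show "AE e in W. ?I ((d - u, k) # ds) e = 0"
            using AE_pos
          proof eventually_elim
            case (elim e)
            then have "0 \<le> arrival k e" by (intro arrival_nonneg) auto
            then show ?case using False by (auto simp: in_window_def indicator_def)
          qed
        qed
        also have "\<dots> = 0" by simp
        finally show ?thesis unfolding eq by (rule trans) (use False in simp)
      qed
    qed
    also have "\<dots> = ennreal ?p * (\<integral>\<^sup>+u. ennreal (pmf (pois (R * (d - u))) k) * indicator {..d} u \<partial>expo)"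
    proof (rule nn_integral_cmult)
      have "(\<lambda>u. ennreal (pmf (pois (R * (d - u))) k) * indicator {..d} u)
          = (\<lambda>u. ennreal ((R * (d - u)) ^ k / fact k * exp (- (R * (d - u)))) * indicator {..d} u)"
        using R by (auto simp: indicator_def pmf_pois fun_eq_iff)
      then show "(\<lambda>u. ennreal (pmf (pois (R * (d - u))) k) * indicator {..d} u) \<in> borel_measurable expo"
        by simp
    qed
    also have "(\<integral>\<^sup>+u. ennreal (pmf (pois (R * (d - u))) k) * indicator {..d} u \<partial>expo)
       = ennreal (pmf (pois (R * d)) (Suc k))"
    proof -
      have "(\<lambda>u. ennreal (pmf (pois (R * (d - u))) k) * indicator {..d} u)
          = (\<lambda>u. ennreal ((R * (d - u)) ^ k / fact k * exp (- (R * (d - u)))) * indicator {..d} u)"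
        using R by (auto simp: indicator_def pmf_pois fun_eq_iff)
      then have "(\<lambda>u. ennreal (pmf (pois (R * (d - u))) k) * indicator {..d} u) \<in> borel_measurable borel"
        by simp
      then show ?thesis
        unfolding expo_def by (subst nn_integral_density) (auto simp: poisson_integral[OF Suc.prems])
    qed
    finally show ?case using p0 by (simp add: ennreal_mult mult_ac)
  qed
  then show ?case using Cons.prems by (cases a) simp
qed

end

section \<open>The chain observed at finitely many times\<close>

primrec positions :: "nat \<Rightarrow> nat list \<Rightarrow> nat list" where
  "positions n [] = []"
| "positions n (k # ks) = (n + k) # positions (n + k) ks"

primrec instants :: "real \<Rightarrow> real list \<Rightarrow> real list" where
  "instants t [] = []"
| "instants t (d # ds) = (t + d) # instants (t + d) ds"

text \<open>\<open>positions\<close> recovers a nondecreasing list from its gaps; there the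
  truncated subtraction is exact.\<close>

primrec gaps :: "nat \<Rightarrow> nat list \<Rightarrow> nat list" where
  "gaps n [] = []"
| "gaps n (v # vs) = (v - n) # gaps v vs"

primrec skeleton :: "('s \<Rightarrow> 's pmf) \<Rightarrow> nat list \<Rightarrow> 's \<Rightarrow> 's list pmf" where
  "skeleton K [] x = return_pmf []"
| "skeleton K (n # ns) x = bind_pmf (kern_pow K n x) (\<lambda>y. map_pmf (Cons y) (skeleton K ns y))"

lemma length_gaps [simp]: "length (gaps n vs) = length vs"
  by (induction vs arbitrary: n) auto

lemma length_instants [simp]: "length (instants t ds) = length ds"
  by (induction ds arbitrary: t) auto

lemma positions_shift: "positions (n + m) ks = map ((+) n) (positions m ks)"
  by (induction ks arbitrary: m) (auto simp: add.assoc)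

lemma positions_le: "i \<in> set (positions n ks) \<Longrightarrow> i \<le> n + sum_list ks"
  by (induction ks arbitrary: n) fastforce+

lemma skeleton_path:
  "sum_list ns \<le> k \<Longrightarrow> map_pmf (\<lambda>L. map (\<lambda>i. (x # L) ! i) (positions 0 ns)) (path_pmf K k x) = skeleton K ns x"
proof (induction ns arbitrary: k x)
  case Nil
  show ?case by (simp add: map_pmf_const)
next
  case (Cons n ns)
  then obtain l where k: "k = n + l" "sum_list ns \<le> l" by (metis add_leD1 le_Suc_ex nat_add_left_cancel_le sum_list.Cons)
  have "map_pmf (\<lambda>L. map (\<lambda>i. (x # L) ! i) (positions 0 (n # ns))) (path_pmf K k x)
     = bind_pmf (path_pmf K n x) (\<lambda>L. map_pmf (Cons (last (x # L)))
          (map_pmf (\<lambda>L'. map (\<lambda>i. (last (x # L) # L') ! i) (positions 0 ns)) (path_pmf K l (last (x # L)))))"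
    unfolding k(1) path_add map_bind_pmf map_pmf_comp
  proof (intro bind_pmf_cong map_pmf_cong refl)
    fix L L' assume "L \<in> set_pmf (path_pmf K n x)"
    then have n: "length L = n" by (rule length_path)
    have shift: "(x # L @ L') ! (n + i) = (last (x # L) # L') ! i" for i
      using n by (cases i) (auto simp: nth_append nth_Cons' last_conv_nth)
    show "map (\<lambda>i. (x # L @ L') ! i) (positions 0 (n # ns))
        = last (x # L) # map (\<lambda>i. (last (x # L) # L') ! i) (positions 0 ns)"
      using positions_shift[of n 0 ns] shift[of 0] shift by (simp add: comp_def del: nth_Cons_Suc)
  qed
  also have "\<dots> = bind_pmf (map_pmf (\<lambda>L. last (x # L)) (path_pmf K n x)) (\<lambda>y. map_pmf (Cons y) (skeleton K ns y))"
    unfolding bind_map_pmf by (intro bind_pmf_cong refl) (simp only: Cons.IH[OF k(2)])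
  finally show ?case by (simp only: path_last skeleton.simps)
qed

text \<open>No position exceeds \<open>sum_list ns\<close>, so that many steps of the path determine
  the observation.\<close>

lemma skeleton_law:
  fixes X :: "nat \<Rightarrow> 'w \<Rightarrow> 's::countable"
  assumes meas: "\<And>k. X k \<in> measurable M (count_space UNIV)" and start: "\<And>\<omega>. X 0 \<omega> = x"
    and law: "\<And>k. distr M (count_space UNIV) (\<lambda>\<omega>. map (\<lambda>i. X i \<omega>) [1..<Suc k]) = measure_pmf (path_pmf K k x)"
  shows "emeasure M {\<omega> \<in> space M. map (\<lambda>i. X i \<omega>) (positions 0 ns) = zs} = ennreal (pmf (skeleton K ns x) zs)"
proof -
  let ?k = "sum_list ns"
  let ?f = "\<lambda>L. map (\<lambda>i. (x # L) ! i) (positions 0 ns)"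
  have eq: "map (\<lambda>i. X i \<omega>) (positions 0 ns) = ?f (map (\<lambda>i. X i \<omega>) [1..<Suc ?k])" for \<omega>
  proof (rule map_cong[OF refl])
    fix i assume "i \<in> set (positions 0 ns)"
    then have "i \<le> ?k" using positions_le[of i 0 ns] by simp
    then show "X i \<omega> = (x # map (\<lambda>i. X i \<omega>) [1..<Suc ?k]) ! i"
      by (cases i) (auto simp: start simp del: upt_Suc)
  qed
  have mL: "(\<lambda>\<omega>. map (\<lambda>i. X i \<omega>) [1..<Suc ?k]) \<in> measurable M (count_space UNIV)"
    by (rule measurable_map_list) (rule meas)
  have "{\<omega> \<in> space M. map (\<lambda>i. X i \<omega>) (positions 0 ns) = zs}
      = (\<lambda>\<omega>. map (\<lambda>i. X i \<omega>) [1..<Suc ?k]) -` {L. ?f L = zs} \<inter> space M"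
    unfolding eq by auto
  then have "emeasure M {\<omega> \<in> space M. map (\<lambda>i. X i \<omega>) (positions 0 ns) = zs}
      = emeasure (distr M (count_space UNIV) (\<lambda>\<omega>. map (\<lambda>i. X i \<omega>) [1..<Suc ?k])) {L. ?f L = zs}"
    by (simp only: emeasure_distr[OF mL] sets_count_space Pow_UNIV UNIV_I)
  also have "\<dots> = emeasure (measure_pmf (path_pmf K ?k x)) {L. ?f L = zs}" by (simp only: law)
  also have "\<dots> = emeasure (measure_pmf (map_pmf ?f (path_pmf K ?k x))) {zs}"
    by (simp add: vimage_def)
  also have "\<dots> = ennreal (pmf (skeleton K ns x) zs)"
    by (simp only: skeleton_path order_refl emeasure_pmf_single)
  finally show ?thesis .
qed

lemma kern_pow_add: "kern_pow K (a + b) x = bind_pmf (kern_pow K a x) (kern_pow K b)"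
  by (induction a arbitrary: x) (auto simp: bind_return_pmf bind_assoc_pmf intro!: bind_pmf_cong)

lemma pois_add:
  assumes "0 \<le> a" "0 \<le> b"
  shows "bind_pmf (pois a) (\<lambda>n. map_pmf ((+) n) (pois b)) = pois (a + b)"
proof (rule pmf_eqI)
  fix k
  have shift: "pmf (map_pmf ((+) n) (pois b)) k = (if n \<le> k then pmf (pois b) (k - n) else 0)" for n
  proof (cases "n \<le> k")
    case True
    then show ?thesis using pmf_map_inj'[of "(+) n" "pois b" "k - n"] by simp
  next
    case False
    then have "k \<notin> set_pmf (map_pmf ((+) n) (pois b))" by auto
    then have "pmf (map_pmf ((+) n) (pois b)) k = 0" by (simp only: set_pmf_iff not_not)
    then show ?thesis using False by simp
  qed
  have "pmf (bind_pmf (pois a) (\<lambda>n. map_pmf ((+) n) (pois b))) k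
      = (\<Sum>n\<le>k. pmf (pois a) n * pmf (pois b) (k - n))"
    unfolding pmf_bind by (subst integral_measure_pmf[of "{..k}"]) (auto simp: shift split: if_splits)
  also have "\<dots> = (\<Sum>n\<le>k. real (k choose n) * a ^ n * b ^ (k - n)) / fact k * exp (- (a + b))"
    using assms by (auto simp: pmf_pois sum_divide_distrib sum_distrib_right binomial_fact exp_add exp_diff
        exp_minus field_simps intro!: sum.cong)
  also have "\<dots> = pmf (pois (a + b)) k"
    using assms by (simp add: pmf_pois binomial_ring)
  finally show "pmf (bind_pmf (pois a) (\<lambda>n. map_pmf ((+) n) (pois b))) k = pmf (pois (a + b)) k" .
qed

text \<open>Uniformisation: the semigroup with generator \<open>R * (K - 1)\<close> as a Poisson
  mixture of powers of \<open>K\<close>.\<close>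

definition jump_semigroup :: "('s \<Rightarrow> 's pmf) \<Rightarrow> real \<Rightarrow> real \<Rightarrow> 's \<Rightarrow> 's pmf" where
  "jump_semigroup K R t x = bind_pmf (pois (R * t)) (\<lambda>n. kern_pow K n x)"

primrec chain_pmf :: "(real \<Rightarrow> 's \<Rightarrow> 's pmf) \<Rightarrow> real list \<Rightarrow> 's \<Rightarrow> 's list pmf" where
  "chain_pmf P [] x = return_pmf []"
| "chain_pmf P (d # ds) x = bind_pmf (P d x) (\<lambda>y. map_pmf (Cons y) (chain_pmf P ds y))"

primrec increments_pmf :: "real \<Rightarrow> real list \<Rightarrow> nat list pmf" where
  "increments_pmf R [] = return_pmf []"
| "increments_pmf R (d # ds) = bind_pmf (pois (R * d)) (\<lambda>n. map_pmf (Cons n) (increments_pmf R ds))"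

text \<open>The remaining increments of the clock do not depend on the state \<open>y\<close> just
  reached, so the two draws commute.\<close>

lemma increments_skeleton: "bind_pmf (increments_pmf R ds) (\<lambda>ns. skeleton K ns x) = chain_pmf (jump_semigroup K R) ds x"
proof (induction ds arbitrary: x)
  case Nil
  show ?case by (simp add: bind_return_pmf)
next
  case (Cons d ds)
  have "bind_pmf (increments_pmf R (d # ds)) (\<lambda>ns. skeleton K ns x)
      = bind_pmf (pois (R * d)) (\<lambda>n. bind_pmf (increments_pmf R ds) (\<lambda>ns. bind_pmf (kern_pow K n x) (\<lambda>y. map_pmf (Cons y) (skeleton K ns y))))"
    by (simp add: bind_assoc_pmf bind_map_pmf)
  also have "\<dots> = bind_pmf (pois (R * d)) (\<lambda>n. bind_pmf (kern_pow K n x) (\<lambda>y. bind_pmf (increments_pmf R ds) (\<lambda>ns. map_pmf (Cons y) (skeleton K ns y))))"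
    by (subst bind_commute_pmf) simp
  also have "\<dots> = chain_pmf (jump_semigroup K R) (d # ds) x"
    by (simp add: jump_semigroup_def bind_assoc_pmf map_bind_pmf flip: Cons.IH)
  finally show ?case .
qed

lemma pmf_increments: "length ks = length ds \<Longrightarrow> pmf (increments_pmf R ds) ks = prod_list (map (\<lambda>(d, k). pmf (pois (R * d)) k) (zip ds ks))"
proof (induction ds arbitrary: ks)
  case (Cons d ds)
  then obtain k ks' where "ks = k # ks'" "length ks' = length ds" by (cases ks) auto
  then show ?case using Cons.IH by (simp add: pmf_bind_Cons)
qed simp

lemma length_increments: "ks \<in> set_pmf (increments_pmf R ds) \<Longrightarrow> length ks = length ds"
  by (induction ds arbitrary: ks) auto

text \<open>\<open>chain_pmf\<close> grows at the front, while the Markov property in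
  \<open>markov_chain_from\<close> adds a time at the end.\<close>

lemma pmf_chain_snoc:
  "length zs = length ds \<Longrightarrow>
   pmf (chain_pmf P (ds @ [d]) x) (zs @ [z]) = pmf (chain_pmf P ds x) zs * pmf (P d (last (x # zs))) z"
proof (induction ds arbitrary: zs x)
  case Nil
  have "pmf (bind_pmf (P d x) (\<lambda>y. map_pmf (Cons y) (return_pmf []))) [z] = pmf (P d x) z"
    by (subst pmf_bind_Cons) simp
  then show ?case using Nil by (simp add: pmf_return)
next
  case (Cons a ds)
  then obtain z' zs' where zs: "zs = z' # zs'" "length zs' = length ds" by (cases zs) auto
  show ?case unfolding zs append_Cons chain_pmf.simps pmf_bind_Cons using Cons.IH[OF zs(2)] by simp
qed

text \<open>The derivative at 0 by squeezing: \<open>L\<close> keeps the contribution of at most one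
  tick of the clock, and \<open>U\<close> adds the probability of two or more. Both have slope
  \<open>R * (p1 - p0)\<close>.\<close>

lemma jump_semigroup_transition:
  fixes K :: "'s \<Rightarrow> 's pmf"
  assumes R: "0 < R" and Q: "\<And>x y. Q_matrix q x y = R * (pmf (K x) y - (if x = y then 1 else 0))"
  shows "transition_semigroup q (jump_semigroup K R)"
  unfolding transition_semigroup_def
proof (intro conjI allI impI)
  show "jump_semigroup K R 0 x = return_pmf x" for x
    by (simp add: jump_semigroup_def pois_def bind_return_pmf)
  show "jump_semigroup K R (s + t) x = bind_pmf (jump_semigroup K R s x) (jump_semigroup K R t)"
    if "0 \<le> s" "0 \<le> t" for s t x
  proof -
    have "jump_semigroup K R (s + t) x = bind_pmf (pois (R * s)) (\<lambda>n. bind_pmf (pois (R * t)) (\<lambda>m. bind_pmf (kern_pow K n x) (kern_pow K m)))"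
      unfolding jump_semigroup_def distrib_left using R that
      by (subst pois_add[symmetric]) (auto simp: bind_assoc_pmf bind_map_pmf kern_pow_add)
    also have "\<dots> = bind_pmf (pois (R * s)) (\<lambda>n. bind_pmf (kern_pow K n x) (\<lambda>y. bind_pmf (pois (R * t)) (\<lambda>m. kern_pow K m y)))"
      by (subst bind_commute_pmf) simp
    finally show ?thesis by (simp add: jump_semigroup_def[abs_def] bind_assoc_pmf)
  qed
  fix x y :: 's
  define p0 where "p0 = (if x = y then 1 else 0 :: real)"
  define p1 where "p1 = pmf (K x) y"
  define f where "f t = pmf (jump_semigroup K R t x) y" for t
  define L where "L t = exp (- (R * t)) * p0 + R * t * exp (- (R * t)) * p1" for t
  define U where "U t = L t + (1 - exp (- (R * t)) - R * t * exp (- (R * t)))" for t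
  have f0: "f 0 = p0" by (auto simp: f_def p0_def jump_semigroup_def pois_def bind_return_pmf)
  have bounds: "L t \<le> f t \<and> f t \<le> U t" if "0 < t" for t
  proof -
    let ?p = "pois (R * t)" and ?h = "\<lambda>n. pmf (kern_pow K n x) y"
    have Rt: "0 \<le> R * t" using R that by simp
    have h: "?h 0 = p0" "?h 1 = p1"
    proof -
      have "kern_pow K 0 = return_pmf" by (simp add: fun_eq_iff)
      then show "?h 0 = p0" "?h 1 = p1" by (auto simp: p0_def p1_def bind_return_pmf')
    qed
    have p: "pmf ?p 0 = exp (- (R * t))" "pmf ?p 1 = R * t * exp (- (R * t))"
      using Rt by (auto simp: pmf_pois)
    have int: "integrable (measure_pmf ?p) g" if "\<And>n. \<bar>g n\<bar> \<le> (1::real)" for g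
      using that by (intro measure_pmf.integrable_const_bound[where B = 1]) auto
    have split: "measure_pmf.expectation ?p (\<lambda>n. g n * indicator {0, 1} n) = pmf ?p 0 * g 0 + pmf ?p 1 * g 1"
      for g :: "nat \<Rightarrow> real"
      by (subst integral_measure_pmf[of "{0, 1}"]) (auto simp: indicator_def)
    have f: "f t = measure_pmf.expectation ?p ?h" by (simp add: f_def jump_semigroup_def pmf_bind)
    have "measure_pmf.expectation ?p (\<lambda>n. ?h n * indicator {0, 1} n) \<le> measure_pmf.expectation ?p ?h"
      by (intro integral_mono int) (auto simp: indicator_def pmf_le_1)
    then have lo: "L t \<le> f t" unfolding split f h p by (simp add: L_def)
    have "measure_pmf.expectation ?p ?h \<le> measure_pmf.expectation ?p (\<lambda>n. ?h n * indicator {0, 1} n + (1 - 1 * indicator {0, 1} n))"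
      by (intro integral_mono int) (auto simp: indicator_def pmf_le_1)
    also have "\<dots> = measure_pmf.expectation ?p (\<lambda>n. ?h n * indicator {0, 1} n)
        + (1 - measure_pmf.expectation ?p (\<lambda>n. 1 * indicator {0, 1} n))"
      by (subst Bochner_Integration.integral_add, (intro int; auto simp: indicator_def pmf_le_1)+,
          subst Bochner_Integration.integral_diff, (intro int; auto simp: indicator_def)+) simp
    finally have "f t \<le> U t" unfolding split f h p by (simp add: U_def L_def)
    with lo show ?thesis by simp
  qed
  have dL: "(L has_real_derivative R * (p1 - p0)) (at_right 0)"
    unfolding L_def by (auto intro!: derivative_eq_intros simp: algebra_simps)
  have dU: "(U has_real_derivative R * (p1 - p0)) (at_right 0)"
    unfolding U_def by (auto intro!: derivative_eq_intros dL simp: algebra_simps)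
  have L0: "L 0 = p0" "U 0 = p0" by (auto simp: L_def U_def)
  have "((\<lambda>t. (f t - f 0) / (t - 0)) \<longlongrightarrow> R * (p1 - p0)) (at_right 0)"
  proof (rule tendsto_sandwich)
    show "((\<lambda>t. (L t - L 0) / (t - 0)) \<longlongrightarrow> R * (p1 - p0)) (at_right 0)"
      using dL by (simp only: has_field_derivative_iff)
    show "((\<lambda>t. (U t - U 0) / (t - 0)) \<longlongrightarrow> R * (p1 - p0)) (at_right 0)"
      using dU by (simp only: has_field_derivative_iff)
    show "\<forall>\<^sub>F t in at_right 0. (L t - L 0) / (t - 0) \<le> (f t - f 0) / (t - 0)"
      using eventually_at_right_less[of 0]
      by eventually_elim (use bounds in \<open>auto simp: f0 L0 intro!: divide_right_mono\<close>)
    show "\<forall>\<^sub>F t in at_right 0. (f t - f 0) / (t - 0) \<le> (U t - U 0) / (t - 0)"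
      using eventually_at_right_less[of 0]
      by eventually_elim (use bounds in \<open>auto simp: f0 L0 intro!: divide_right_mono\<close>)
  qed
  then have "(f has_real_derivative R * (p1 - p0)) (at_right 0)"
    by (simp only: has_field_derivative_iff)
  then show "((\<lambda>t. pmf (jump_semigroup K R t x) y) has_real_derivative Q_matrix q x y) (at_right 0)"
    by (simp add: f_def[abs_def] Q p0_def p1_def)
qed

section \<open>The counting process of the clock\<close>

context clock
begin

text \<open>Number of arrivals up to time \<open>t\<close>; meaningful only when the arrival times are unbounded.\<close>

definition N :: "real \<Rightarrow> real stream \<Rightarrow> nat" where
  "N t e = (LEAST n. t < arrival (Suc n) e)"

text \<open>Integer times are enough to make the arrivals unbounded, since a window at time
  \<open>k\<close> entails an arrival after \<open>k\<close>; countably many conditions keep the set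
  measurable.\<close>

definition good_clock :: "real stream \<Rightarrow> bool" where
  "good_clock e \<longleftrightarrow> (\<forall>i. 0 < e !! i) \<and> (\<forall>k::nat. \<exists>n. in_window (real k) n e)"

lemma measurable_N [measurable]: "N t \<in> measurable W (count_space UNIV)"
  unfolding N_def[abs_def] by measurable

lemma arrival_mono:
  assumes "\<And>i. 0 < e !! i" "m \<le> n" shows "arrival m e \<le> arrival n e"
  unfolding arrival_def using assms by (intro sum_mono2) (auto simp: less_imp_le)

lemma window_unique:
  assumes pos: "\<And>i. 0 < e !! i" and "in_window t m e" "in_window t n e"
  shows "m = n"
proof (rule ccontr)
  assume "m \<noteq> n"
  then consider "Suc m \<le> n" | "Suc n \<le> m" by linarith
  then show False
    using arrival_mono[of e "Suc m" n] arrival_mono[of e "Suc n" m] assms by cases (auto simp: in_window_def)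
qed

lemma window_exists:
  assumes e: "good_clock e" and t: "0 \<le> t"
  shows "in_window t (N t e) e"
proof -
  obtain k :: nat where "t \<le> real k" using real_arch_simple by blast
  moreover from e obtain m where "in_window (real k) m e" unfolding good_clock_def by blast
  ultimately have ex: "\<exists>n. t < arrival (Suc n) e" by (auto simp: in_window_def intro: le_less_trans)
  then have "t < arrival (Suc (N t e)) e" unfolding N_def by (rule LeastI_ex)
  moreover have "arrival (N t e) e \<le> t"
  proof (cases "N t e")
    case (Suc n)
    then have "n < N t e" by simp
    then have "\<not> t < arrival (Suc n) e" unfolding N_def by (rule not_less_Least)
    then show ?thesis using Suc by simp
  qed (use t in simp)
  ultimately show ?thesis by (simp add: in_window_def)
qed

lemma window_iff: "good_clock e \<Longrightarrow> 0 \<le> t \<Longrightarrow> in_window t n e \<longleftrightarrow> N t e = n"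
  using window_exists[of e t] window_unique[of e t n "N t e"] by (auto simp: good_clock_def)

lemma N_mono:
  assumes e: "good_clock e" and st: "0 \<le> s" "s \<le> t"
  shows "N s e \<le> N t e"
proof (rule ccontr)
  assume "\<not> N s e \<le> N t e"
  then have "arrival (Suc (N t e)) e \<le> arrival (N s e) e"
    using e by (intro arrival_mono) (auto simp: good_clock_def)
  also have "\<dots> \<le> s" using window_exists[OF e st(1)] by (simp add: in_window_def)
  finally show False using window_exists[OF e, of t] st by (simp add: in_window_def)
qed

lemma measurable_good_clock [measurable]: "Measurable.pred W good_clock"
proof -
  have "(\<lambda>e. e !! i) \<in> borel_measurable W" for i
    unfolding W_def using measurable_snth[of i expo] by (simp add: measurable_cong_sets[OF refl sets_expo])
  then show ?thesis unfolding good_clock_def[abs_def] in_window_def by measurable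
qed

text \<open>Non-explosion, because the Poisson weights sum to 1: \<open>g\<close> counts the windows
  that contain \<open>t\<close>, is almost surely at most 1, and has integral 1.\<close>

lemma AE_window:
  assumes "0 \<le> t"
  shows "AE e in W. \<exists>n. in_window t n e"
proof -
  define g where "g e = (\<Sum>n. indicator {e. in_window t n e} e :: ennreal)" for e
  have m: "(\<lambda>e. indicator {e. in_window t n e} e :: ennreal) \<in> borel_measurable W" for n
    unfolding in_window_def by measurable
  have gm: "g \<in> borel_measurable W" unfolding g_def[abs_def] by (rule borel_measurable_suminf_order[OF m])
  have "(\<integral>\<^sup>+e. g e \<partial>W) = (\<Sum>n. \<integral>\<^sup>+e. indicator {e. in_window t n e} e \<partial>W)"
    unfolding g_def by (rule nn_integral_suminf[OF m])
  also have "\<dots> = (\<Sum>n. ennreal (pmf (pois (R * t)) n))"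
  proof (rule suminf_cong)
    fix n
    show "(\<integral>\<^sup>+e. indicator {e. in_window t n e} e \<partial>W) = ennreal (pmf (pois (R * t)) n)"
    proof -
      have "in_window t n = counts_match 0 0 [(t, n)]" by (simp add: fun_eq_iff)
      then show ?thesis using counts_law[of "[(t, n)]"] assms by (simp del: counts_match.simps)
    qed
  qed
  also have "\<dots> = (\<integral>\<^sup>+n. ennreal (pmf (pois (R * t)) n) \<partial>count_space UNIV)"
    by (rule nn_integral_count_space_nat[symmetric])
  also have "\<dots> = 1" by (rule nn_integral_pmf_eq_1)
  finally have int: "(\<integral>\<^sup>+e. g e \<partial>W) = 1" .
  have le1: "AE e in W. g e \<le> 1"
    using AE_pos
  proof eventually_elim
    case (elim e)
    show "g e \<le> 1"
    proof (cases "\<exists>n. in_window t n e")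
      case True
      then obtain n where n: "in_window t n e" by blast
      then have "indicator {e. in_window t m e} e = (if m = n then 1 else 0 :: ennreal)" for m
      proof (cases "m = n")
        case False
        then have "\<not> in_window t m e" using window_unique[OF elim[rule_format] _ n, of m] by blast
        then show ?thesis using False by simp
      qed (simp add: n)
      then show ?thesis using suminf_finite[of "{n}" "\<lambda>m. if m = n then 1 else 0 :: ennreal"] by (simp add: g_def)
    qed (simp add: g_def)
  qed
  have "(\<integral>\<^sup>+e. 1 - g e \<partial>W) = (\<integral>\<^sup>+e. 1 \<partial>W) - (\<integral>\<^sup>+e. g e \<partial>W)"
    by (rule nn_integral_diff) (use gm le1 int in simp_all)
  also have "\<dots> = 0" using int W.emeasure_space_1 by simp
  finally have int0: "(\<integral>\<^sup>+e. 1 - g e \<partial>W) = 0" .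
  have "(\<lambda>e. 1 - g e) \<in> borel_measurable W" using gm by measurable
  from nn_integral_0_iff_AE[OF this] int0 have "AE e in W. 1 - g e = 0" by simp
  then show ?thesis
  proof eventually_elim
    case (elim e)
    show ?case
    proof (rule ccontr)
      assume "\<nexists>n. in_window t n e"
      then have "g e = 0" by (simp add: g_def)
      with elim show False by simp
    qed
  qed
qed

lemma AE_good_clock: "AE e in W. good_clock e"
proof -
  have "AE e in W. \<forall>k::nat. \<exists>n. in_window (real k) n e"
    unfolding AE_all_countable by (intro allI AE_window) simp
  then show ?thesis using AE_pos by eventually_elim (simp add: good_clock_def)
qed

definition counts :: "real list \<Rightarrow> real stream \<Rightarrow> nat list" where
  "counts ds e = gaps 0 (map (\<lambda>s. N s e) (instants 0 ds))"

lemma counts_match_iff: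
  assumes "good_clock e" "0 \<le> t" "\<forall>d\<in>set ds. 0 \<le> d" "n \<le> N t e" "length ks = length ds"
  shows "counts_match t n (zip ds ks) e \<longleftrightarrow> gaps n (map (\<lambda>s. N s e) (instants t ds)) = ks"
  using assms(2-)
proof (induction ds arbitrary: t n ks)
  case (Cons d ds)
  obtain k ks' where ks: "ks = k # ks'" "length ks' = length ds" using Cons.prems(4) by (cases ks) auto
  have d: "0 \<le> d" "0 \<le> t + d" using Cons.prems by auto
  have le: "n \<le> N (t + d) e" using N_mono[OF assms(1), of t "t + d"] Cons.prems d by linarith
  have A: "in_window (t + d) (n + k) e \<longleftrightarrow> N (t + d) e - n = k"
    unfolding window_iff[OF assms(1) d(2), of "n + k"] using le by linarith
  have B: "counts_match (t + d) (n + k) (zip ds ks') e \<longleftrightarrow> gaps (N (t + d) e) (map (\<lambda>s. N s e) (instants (t + d) ds)) = ks'"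
    if "N (t + d) e = n + k"
    using Cons.IH[OF d(2), of "n + k" ks'] Cons.prems ks that by simp
  show ?case
  proof (cases "N (t + d) e - n = k")
    case True
    then have "N (t + d) e = n + k" using le by linarith
    then show ?thesis using A B True by (simp add: ks)
  next
    case False
    then show ?thesis using A by (simp add: ks)
  qed
qed simp

lemma positions_gaps:
  assumes "good_clock e" "0 \<le> t" "\<forall>d\<in>set ds. 0 \<le> d" "n \<le> N t e"
  shows "positions n (gaps n (map (\<lambda>s. N s e) (instants t ds))) = map (\<lambda>s. N s e) (instants t ds)"
  using assms(2-)
proof (induction ds arbitrary: t n)
  case (Cons d ds)
  have d: "0 \<le> d" "0 \<le> t + d" using Cons.prems by auto
  have "n \<le> N (t + d) e" using N_mono[OF assms(1), of t "t + d"] Cons.prems d by linarith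
  then have "n + (N (t + d) e - n) = N (t + d) e" by simp
  moreover have "positions (N (t + d) e) (gaps (N (t + d) e) (map (\<lambda>s. N s e) (instants (t + d) ds)))
      = map (\<lambda>s. N s e) (instants (t + d) ds)"
    by (rule Cons.IH) (use d Cons.prems in auto)
  ultimately show ?case by simp
qed simp

lemma measurable_counts: "counts ds \<in> measurable W (count_space UNIV)"
proof -
  have "(\<lambda>e. map (\<lambda>s. N s e) (instants 0 ds)) \<in> measurable W (count_space UNIV)"
    by (rule measurable_map_list) simp
  then show ?thesis unfolding counts_def[abs_def] by (rule measurable_compose) simp
qed

lemma distr_counts:
  assumes "\<forall>d\<in>set ds. 0 \<le> d"
  shows "distr W (count_space UNIV) (counts ds) = measure_pmf (increments_pmf R ds)"
proof (rule measure_eqI_countable[where A = UNIV])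
  fix ks :: "nat list"
  have "emeasure (distr W (count_space UNIV) (counts ds)) {ks} = (\<integral>\<^sup>+e. indicator {ks} (counts ds e) \<partial>W)"
    by (subst nn_integral_indicator[symmetric], simp, subst nn_integral_distr[OF measurable_counts]) auto
  also have "\<dots> = ennreal (pmf (increments_pmf R ds) ks)"
  proof (cases "length ks = length ds")
    case True
    have "(\<integral>\<^sup>+e. indicator {ks} (counts ds e) \<partial>W) = (\<integral>\<^sup>+e. indicator {e. counts_match 0 0 (zip ds ks) e} e \<partial>W)"
    proof (rule nn_integral_cong_AE)
      show "AE e in W. (indicator {ks} (counts ds e) :: ennreal) = indicator {e. counts_match 0 0 (zip ds ks) e} e"
        using AE_good_clock
      proof eventually_elim
        case (elim e)
        then show ?case using counts_match_iff[of e 0 ds 0 ks] assms True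
          by (auto simp: counts_def indicator_def)
      qed
    qed
    also have "\<dots> = ennreal (pmf (increments_pmf R ds) ks)"
      unfolding pmf_increments[OF True] using assms by (intro counts_law) (auto dest: set_zip_leftD)
    finally show ?thesis .
  next
    case False
    then have "(indicator {ks} (counts ds e) :: ennreal) = 0" for e
      by (auto simp: indicator_def counts_def)
    moreover have "pmf (increments_pmf R ds) ks = 0" using False length_increments[of ks R ds] by (auto simp: set_pmf_iff)
    ultimately show ?thesis by simp
  qed
  finally show "emeasure (distr W (count_space UNIV) (counts ds)) {ks} = emeasure (measure_pmf (increments_pmf R ds)) {ks}"
    by (simp add: emeasure_pmf_single)
qed auto

lemma measurable_subordinated:
  fixes X :: "nat \<Rightarrow> 'w \<Rightarrow> 's"
  assumes "\<And>k. X k \<in> measurable M (count_space UNIV)"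
  shows "(\<lambda>p. X (N t (fst p)) (snd p)) \<in> measurable (W \<Otimes>\<^sub>M M) (count_space UNIV)"
proof (rule measurable_compose_countable[where g = "\<lambda>p. N t (fst p)" and f = "\<lambda>i p. X i (snd p)"])
  show "(\<lambda>p. X i (snd p)) \<in> measurable (W \<Otimes>\<^sub>M M) (count_space UNIV)" for i
    by (rule measurable_compose[OF measurable_snd assms])
  show "(\<lambda>p. N t (fst p)) \<in> measurable (W \<Otimes>\<^sub>M M) (count_space UNIV)"
    by (rule measurable_compose[OF measurable_fst measurable_N])
qed

text \<open>Fubini: for a fixed clock the skeleton is observed at deterministic positions, and
  integrating over the clock mixes these laws with independent Poisson increments.\<close>

lemma subordinated_law:
  fixes X :: "nat \<Rightarrow> 'w \<Rightarrow> 's::countable"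
  assumes M: "prob_space M" and meas: "\<And>k. X k \<in> measurable M (count_space UNIV)" and start: "\<And>\<omega>. X 0 \<omega> = x"
    and law: "\<And>k. distr M (count_space UNIV) (\<lambda>\<omega>. map (\<lambda>i. X i \<omega>) [1..<Suc k]) = measure_pmf (path_pmf K k x)"
    and ds: "\<forall>d\<in>set ds. 0 \<le> d"
  shows "emeasure (W \<Otimes>\<^sub>M M) {p \<in> space (W \<Otimes>\<^sub>M M). map (\<lambda>s. X (N s (fst p)) (snd p)) (instants 0 ds) = zs}
     = ennreal (pmf (chain_pmf (jump_semigroup K R) ds x) zs)"
proof -
  interpret M: prob_space M by (rule M)
  let ?A = "{p \<in> space (W \<Otimes>\<^sub>M M). map (\<lambda>s. X (N s (fst p)) (snd p)) (instants 0 ds) = zs}"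
  have "(\<lambda>p. map (\<lambda>s. X (N s (fst p)) (snd p)) (instants 0 ds)) \<in> measurable (W \<Otimes>\<^sub>M M) (count_space UNIV)"
    by (rule measurable_map_list) (rule measurable_subordinated[OF meas])
  from measurable_sets[OF this, of "{zs}"]
  have "(\<lambda>p. map (\<lambda>s. X (N s (fst p)) (snd p)) (instants 0 ds)) -` {zs} \<inter> space (W \<Otimes>\<^sub>M M) \<in> sets (W \<Otimes>\<^sub>M M)"
    by simp
  also have "(\<lambda>p. map (\<lambda>s. X (N s (fst p)) (snd p)) (instants 0 ds)) -` {zs} \<inter> space (W \<Otimes>\<^sub>M M) = ?A"
    by blast
  finally have A: "?A \<in> sets (W \<Otimes>\<^sub>M M)" .
  have "emeasure (W \<Otimes>\<^sub>M M) ?A = (\<integral>\<^sup>+e. emeasure M (Pair e -` ?A) \<partial>W)"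
    by (rule M.emeasure_pair_measure_alt[OF A])
  also have "\<dots> = (\<integral>\<^sup>+e. ennreal (pmf (skeleton K (counts ds e) x) zs) \<partial>W)"
  proof (rule nn_integral_cong_AE)
    show "AE e in W. emeasure M (Pair e -` ?A) = ennreal (pmf (skeleton K (counts ds e) x) zs)"
      using AE_good_clock
    proof eventually_elim
      case (elim e)
      have "map (\<lambda>s. X (N s e) \<omega>) (instants 0 ds) = map (\<lambda>i. X i \<omega>) (positions 0 (counts ds e))" for \<omega>
        unfolding counts_def by (subst positions_gaps[OF elim]) (use ds in auto)
      then have "Pair e -` ?A = {\<omega> \<in> space M. map (\<lambda>i. X i \<omega>) (positions 0 (counts ds e)) = zs}"
        by (auto simp: space_pair_measure)
      then show ?case using skeleton_law[OF meas start law] by simp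
    qed
  qed
  also have "\<dots> = (\<integral>\<^sup>+ks. ennreal (pmf (skeleton K ks x) zs) \<partial>distr W (count_space UNIV) (counts ds))"
    by (subst nn_integral_distr[OF measurable_counts]) auto
  also have "\<dots> = (\<integral>\<^sup>+ks. ennreal (pmf (skeleton K ks x) zs) \<partial>increments_pmf R ds)"
    by (simp only: distr_counts[OF ds])
  also have "\<dots> = ennreal (pmf (bind_pmf (increments_pmf R ds) (\<lambda>ks. skeleton K ks x)) zs)"
    by (rule ennreal_pmf_bind[symmetric])
  finally show ?thesis by (simp only: increments_skeleton)
qed

lemma good_clock_pos: "good_clock e \<Longrightarrow> 0 < e !! i"
  unfolding good_clock_def by blast

lemma arrival_less_Suc: "good_clock e \<Longrightarrow> arrival n e < arrival (Suc n) e"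
  using good_clock_pos[of e n] by (simp add: arrival_def)

lemma arrival_ge_0: "good_clock e \<Longrightarrow> 0 \<le> arrival n e"
  by (intro arrival_nonneg good_clock_pos)

lemma cadlag_subordinated:
  assumes e: "good_clock e"
  shows "cadlag_path (\<lambda>t. Z (N t e))"
  unfolding cadlag_path_def
proof (intro conjI allI impI)
  have const: "N s e = n" if "arrival n e \<le> s" "s < arrival (Suc n) e" for s n
  proof -
    have "0 \<le> s" using arrival_ge_0[OF e, of n] that by linarith
    then show ?thesis using window_iff[OF e, of s n] that by (simp add: in_window_def)
  qed
  fix t :: real
  show "\<forall>\<^sub>F s in at_right t. Z (N s e) = Z (N t e)" if "0 \<le> t"
  proof -
    have w: "arrival (N t e) e \<le> t" "t < arrival (Suc (N t e)) e"
      using window_exists[OF e that] by (auto simp: in_window_def)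
    have "\<forall>\<^sub>F s in at_right t. s \<in> {t<..<arrival (Suc (N t e)) e}"
      using w by (intro eventually_at_right_real) auto
    then show ?thesis
    proof eventually_elim
      case (elim s)
      have "N s e = N t e" by (rule const) (use elim w in auto)
      then show ?case by (rule arg_cong)
    qed
  qed
  show "\<exists>z. \<forall>\<^sub>F s in at_left t. Z (N s e) = z" if "0 < t"
  proof -
    have w: "arrival (N t e) e \<le> t" "t < arrival (Suc (N t e)) e"
      using window_exists[OF e, of t] that by (auto simp: in_window_def)
    \<comment> \<open>If \<open>t\<close> is itself an arrival time, the left limit belongs to the
      preceding window, which exists because \<open>t > 0\<close>.\<close>
    obtain n where n: "arrival n e < t" "t \<le> arrival (Suc n) e"
    proof (cases "arrival (N t e) e < t")
      case True
      then show thesis using that[of "N t e"] w by simp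
    next
      case False
      then have eq: "arrival (N t e) e = t" using w by simp
      then obtain m where m: "N t e = Suc m" using \<open>0 < t\<close> by (cases "N t e") auto
      have "arrival m e < arrival (Suc m) e" by (rule arrival_less_Suc[OF e])
      then show thesis using that[of m] eq m by simp
    qed
    have "\<forall>\<^sub>F s in at_left t. s \<in> {arrival n e<..<t}"
      using n by (intro eventually_at_left_real) auto
    then have "\<forall>\<^sub>F s in at_left t. Z (N s e) = Z n"
    proof eventually_elim
      case (elim s)
      have "N s e = n" by (rule const) (use elim n in auto)
      then show ?case by (rule arg_cong)
    qed
    then show ?thesis by blast
  qed
qed

lemma N_unbounded:
  assumes e: "good_clock e"
  shows "\<exists>t\<ge>0. \<forall>s\<ge>t. k \<le> N s e"
proof (intro exI[of _ "arrival k e"] conjI allI impI)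
  show k0: "0 \<le> arrival k e" by (rule arrival_ge_0[OF e])
  have "in_window (arrival k e) k e" using arrival_less_Suc[OF e] by (simp add: in_window_def)
  then have "N (arrival k e) e = k" using window_iff[OF e k0] by blast
  then show "k \<le> N s e" if "arrival k e \<le> s" for s
    using N_mono[OF e k0 that] by simp
qed

end

lemma instants_increments:
  "instants 0 (map (\<lambda>i. t i - (if i = 0 then 0 else t (i - 1))) [0..<k]) = map t [0..<k]"
proof -
  have snoc: "instants a (ds @ [d]) = instants a ds @ [a + sum_list ds + d]" for a ds and d :: real
    by (induction ds arbitrary: a) (auto simp: add.assoc)
  have sum: "sum_list (map (\<lambda>i. t i - (if i = 0 then 0 else t (i - 1))) [0..<k]) = (if k = 0 then 0 else t (k - 1))" for k
    by (induction k) auto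
  show ?thesis by (induction k) (auto simp: snoc sum)
qed

text \<open>One clock drives both skeletons, so agreement from step \<open>k0\<close> on becomes
  agreement from the \<open>k0\<close>-th arrival on. \<open>markov_chain_from\<close> asks for the
  initial value and regular paths at every point of the space, so null sets are discarded before the
  law is carried to path space.\<close>

theorem coupling_from_skeleton:
  fixes K :: "'s::countable \<Rightarrow> 's pmf" and X Y :: "nat \<Rightarrow> 'w \<Rightarrow> 's"
  assumes R: "0 < R" and Q: "\<And>x y. Q_matrix q x y = R * (pmf (K x) y - (if x = y then 1 else 0))"
    and M: "prob_space M" and X: "\<And>k. X k \<in> measurable M (count_space UNIV)"
    and Y: "\<And>k. Y k \<in> measurable M (count_space UNIV)"
    and start: "\<And>\<omega>. X 0 \<omega> = x" "\<And>\<omega>. Y 0 \<omega> = y"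
    and lawX: "\<And>k. distr M (count_space UNIV) (\<lambda>\<omega>. map (\<lambda>i. X i \<omega>) [1..<Suc k]) = measure_pmf (path_pmf K k x)"
    and lawY: "\<And>k. distr M (count_space UNIV) (\<lambda>\<omega>. map (\<lambda>i. Y i \<omega>) [1..<Suc k]) = measure_pmf (path_pmf K k y)"
    and meet: "AE \<omega> in M. \<exists>k0. \<forall>k\<ge>k0. X k \<omega> = Y k \<omega>"
  shows "\<exists>P :: (real \<Rightarrow> 's \<times> 's) measure.
    markov_chain_from q x P (\<lambda>t w. fst (w t)) \<and> markov_chain_from q y P (\<lambda>t w. snd (w t)) \<and>
    measure P {w \<in> space P. coupling_time (\<lambda>t w. fst (w t)) (\<lambda>t w. snd (w t)) w < \<infinity>} = 1"
proof -
  interpret clock R by standard (rule R)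
  interpret M: prob_space M by (rule M)
  interpret WM: pair_prob_space W M ..
  let ?\<Omega> = "W \<Otimes>\<^sub>M M"
  define G where "G = {p \<in> space ?\<Omega>. good_clock (fst p) \<and> (\<exists>k0. \<forall>k\<ge>k0. X k (snd p) = Y k (snd p))}"
  have eqm: "Measurable.pred M (\<lambda>\<omega>. X k \<omega> = Y k \<omega>)" for k
  proof -
    have "(\<lambda>\<omega>. (X k \<omega>, Y k \<omega>)) \<in> measurable M (count_space UNIV \<Otimes>\<^sub>M count_space UNIV)"
      by (intro measurable_Pair X Y)
    then have "(\<lambda>\<omega>. (X k \<omega>, Y k \<omega>)) \<in> measurable M (count_space UNIV)"
      by (simp add: pair_measure_countable)
    from measurable_compose[OF this, of "\<lambda>(a, b). a = b" "count_space UNIV"] show ?thesis by simp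
  qed
  have meetm: "Measurable.pred M (\<lambda>\<omega>. \<exists>k0. \<forall>k\<ge>k0. X k \<omega> = Y k \<omega>)"
    using eqm by measurable
  have g1: "Measurable.pred ?\<Omega> (\<lambda>p. good_clock (fst p))"
    by (rule measurable_compose[OF measurable_fst measurable_good_clock])
  have g2: "Measurable.pred ?\<Omega> (\<lambda>p. \<exists>k0. \<forall>k\<ge>k0. X k (snd p) = Y k (snd p))"
    by (rule measurable_compose[OF measurable_snd meetm])
  have G: "G \<in> sets ?\<Omega>"
    unfolding G_def by (rule predE, rule pred_intros_logic, rule g1, rule g2)
  have AE_G: "AE p in ?\<Omega>. p \<in> G"
  proof (rule WM.AE_pair_measure)
    have "{p \<in> space ?\<Omega>. p \<in> G} = G" by (auto simp: G_def)
    then show "{p \<in> space ?\<Omega>. p \<in> G} \<in> sets ?\<Omega>" using G by simp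
    show "AE e in W. AE \<omega> in M. (e, \<omega>) \<in> G"
      using AE_good_clock
    proof eventually_elim
      case (elim e)
      show "AE \<omega> in M. (e, \<omega>) \<in> G"
        using meet AE_space by eventually_elim (use elim in \<open>simp add: G_def space_pair_measure\<close>)
    qed
  qed
  have om: "prob_space ?\<Omega>" by (rule prob_space_pair[OF W.prob_space_axioms M])
  define \<Omega>' where "\<Omega>' = restrict_space ?\<Omega> G"
  have emG: "emeasure ?\<Omega> G = 1"
    by (rule prob_space.emeasure_eq_1_AE[OF om G AE_G])
  interpret \<Omega>': prob_space \<Omega>'
    unfolding \<Omega>'_def by (rule prob_space_restrict_space[OF G emG])
  have space_\<Omega>': "space \<Omega>' = G" using G sets.sets_into_space[OF G] by (auto simp: \<Omega>'_def space_restrict_space)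
  \<comment> \<open>The conditions involve uncountably many coordinates, so the law is put on the
    trace sigma-algebra of \<open>\<Gamma>\<close>; this works because \<open>\<Phi>\<close> maps
    \<open>G\<close> into \<open>\<Gamma>\<close>.\<close>
  define \<Gamma> :: "(real \<Rightarrow> 's \<times> 's) set" where "\<Gamma> = {w. fst (w 0) = x \<and> snd (w 0) = y \<and>
    cadlag_path (\<lambda>t. fst (w t)) \<and> cadlag_path (\<lambda>t. snd (w t)) \<and> (\<exists>T\<ge>0. \<forall>s\<ge>T. fst (w s) = snd (w s))}"
  define \<Phi> where "\<Phi> p = (\<lambda>t. (X (N t (fst p)) (snd p), Y (N t (fst p)) (snd p)))" for p
  let ?PM = "PiM (UNIV :: real set) (\<lambda>_. count_space (UNIV :: ('s \<times> 's) set))"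
  have \<Phi>_\<Gamma>: "\<Phi> p \<in> \<Gamma>" if "p \<in> G" for p
  proof -
    obtain e \<omega> where p: "p = (e, \<omega>)" by (cases p)
    have e: "good_clock e" and ex: "\<exists>k0. \<forall>k\<ge>k0. X k \<omega> = Y k \<omega>" using that by (auto simp: G_def p)
    have "in_window 0 0 e" using arrival_less_Suc[OF e, of 0] by (simp add: in_window_def)
    then have "N 0 e = 0" using window_iff[OF e, of 0 0] by simp
    moreover from ex obtain k0 where k0: "\<And>k. k \<ge> k0 \<Longrightarrow> X k \<omega> = Y k \<omega>" by blast
    moreover from N_unbounded[OF e, of k0] obtain T where "0 \<le> T" "\<And>s. T \<le> s \<Longrightarrow> k0 \<le> N s e" by blast
    ultimately show ?thesis
      using cadlag_subordinated[OF e, of "\<lambda>k. X k \<omega>"] cadlag_subordinated[OF e, of "\<lambda>k. Y k \<omega>"]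
      unfolding \<Gamma>_def \<Phi>_def p by (auto simp: start intro!: exI[of _ T])
  qed
  have \<Phi>m: "\<Phi> \<in> measurable \<Omega>' (restrict_space ?PM \<Gamma>)"
  proof (rule measurable_restrict_space2)
    show "\<Phi> \<in> space \<Omega>' \<rightarrow> \<Gamma>" using \<Phi>_\<Gamma> by (auto simp: space_\<Omega>')
    show "\<Phi> \<in> measurable \<Omega>' ?PM"
      unfolding \<Omega>'_def
    proof (rule measurable_restrict_space1)
      show "\<Phi> \<in> measurable ?\<Omega> ?PM"
        unfolding \<Phi>_def[abs_def]
      proof (rule measurable_PiM_single')
        fix t :: real
        have "(\<lambda>p. (X (N t (fst p)) (snd p), Y (N t (fst p)) (snd p))) \<in> measurable ?\<Omega> (count_space UNIV \<Otimes>\<^sub>M count_space UNIV)"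
          by (intro measurable_Pair measurable_subordinated X Y)
        then show "(\<lambda>p. (X (N t (fst p)) (snd p), Y (N t (fst p)) (snd p))) \<in> measurable ?\<Omega> (count_space UNIV)"
          by (simp add: pair_measure_countable)
      qed simp
    qed
  qed
  define P where "P = distr \<Omega>' (restrict_space ?PM \<Gamma>) \<Phi>"
  have sets_P: "sets P = sets (restrict_space ?PM \<Gamma>)" by (simp add: P_def)
  have space_P: "space P = \<Gamma>" by (simp add: P_def space_restrict_space space_PiM)
  interpret P: prob_space P unfolding P_def by (rule \<Omega>'.prob_space_distr[OF \<Phi>m])
  have comp: "(\<lambda>w. w t) \<in> measurable P (count_space UNIV)" for t
  proof -
    have "(\<lambda>w. w t) \<in> measurable (restrict_space ?PM \<Gamma>) (count_space UNIV)"
      by (rule measurable_restrict_space1) (rule measurable_component_singleton, simp)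
    then show ?thesis unfolding P_def by simp
  qed
  have markov: "markov_chain_from q z0 P (\<lambda>t w. pr (w t))"
    if Zm: "\<And>k. Z k \<in> measurable M (count_space UNIV)" and Z0: "\<And>\<omega>. Z 0 \<omega> = z0"
      and lawZ: "\<And>k. distr M (count_space UNIV) (\<lambda>\<omega>. map (\<lambda>i. Z i \<omega>) [1..<Suc k]) = measure_pmf (path_pmf K k z0)"
      and pr: "\<And>p t. pr (\<Phi> p t) = Z (N t (fst p)) (snd p)"
      and \<Gamma>: "\<And>w. w \<in> \<Gamma> \<Longrightarrow> pr (w 0) = z0 \<and> cadlag_path (\<lambda>t. pr (w t))"
    for Z :: "nat \<Rightarrow> 'w \<Rightarrow> 's" and z0 and pr :: "'s \<times> 's \<Rightarrow> 's"
  proof -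
    have prm: "(\<lambda>w. pr (w t)) \<in> measurable P (count_space UNIV)" for t
      by (rule measurable_compose[OF comp]) simp
    define ds where "ds t k = map (\<lambda>i. t i - (if i = 0 then 0 else t (i - 1))) [0..<k]" for t :: "nat \<Rightarrow> real" and k
    have fdd: "measure P {w \<in> space P. \<forall>i\<le>k. pr (w (t i)) = z i}
        = pmf (chain_pmf (jump_semigroup K R) (ds t (Suc k)) z0) (map z [0..<Suc k])"
      if t: "0 \<le> t 0" "\<And>i. i < k \<Longrightarrow> t i \<le> t (Suc i)" for k t z
    proof -
      let ?A = "{w \<in> space P. \<forall>i\<le>k. pr (w (t i)) = z i}"
      let ?B = "{p \<in> space ?\<Omega>. map (\<lambda>s. Z (N s (fst p)) (snd p)) (instants 0 (ds t (Suc k))) = map z [0..<Suc k]}"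
      have instants: "instants 0 (ds t (Suc k)) = map t [0..<Suc k]" unfolding ds_def by (rule instants_increments)
      have nonneg: "\<forall>d\<in>set (ds t (Suc k)). 0 \<le> d"
      proof
        fix d assume "d \<in> set (ds t (Suc k))"
        then obtain i where i: "i < Suc k" "d = t i - (if i = 0 then 0 else t (i - 1))" by (auto simp: ds_def simp del: upt_Suc)
        then show "0 \<le> d" using t(1) t(2)[of "i - 1"] by (cases i) auto
      qed
      have "{w \<in> space P. pr (w (t i)) = z i} \<in> sets P" for i
      proof (rule predE)
        show "Measurable.pred P (\<lambda>w. pr (w (t i)) = z i)"
          by (rule measurable_compose[OF prm, of "\<lambda>a. a = z i"]) simp
      qed
      then have "{w \<in> space P. \<forall>i\<in>{..k}. pr (w (t i)) = z i} \<in> sets P"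
        by (intro sets.sets_Collect_finite_All) auto
      then have A: "?A \<in> sets P" by (simp only: Ball_def atMost_iff)
      have "(\<lambda>p. map (\<lambda>s. Z (N s (fst p)) (snd p)) (instants 0 (ds t (Suc k)))) \<in> measurable ?\<Omega> (count_space UNIV)"
        by (rule measurable_map_list) (rule measurable_subordinated[OF Zm])
      from measurable_sets[OF this, of "{map z [0..<Suc k]}"]
      have "(\<lambda>p. map (\<lambda>s. Z (N s (fst p)) (snd p)) (instants 0 (ds t (Suc k)))) -` {map z [0..<Suc k]} \<inter> space ?\<Omega> \<in> sets ?\<Omega>"
        by simp
      also have "(\<lambda>p. map (\<lambda>s. Z (N s (fst p)) (snd p)) (instants 0 (ds t (Suc k)))) -` {map z [0..<Suc k]} \<inter> space ?\<Omega> = ?B"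
        by blast
      finally have B: "?B \<in> sets ?\<Omega>" .
      have pre: "\<Phi> -` ?A \<inter> space \<Omega>' = ?B \<inter> G"
      proof -
        have "(map (\<lambda>s. Z (N s (fst p)) (snd p)) (instants 0 (ds t (Suc k))) = map z [0..<Suc k])
          \<longleftrightarrow> (\<forall>i\<le>k. pr (\<Phi> p (t i)) = z i)" for p
          unfolding instants pr by (auto simp: less_Suc_eq_le simp del: upt_Suc)
        moreover have "G \<subseteq> space ?\<Omega>" by (auto simp: G_def)
        ultimately show ?thesis unfolding space_\<Omega>' space_P using \<Phi>_\<Gamma> by blast
      qed
      have "measure P ?A = measure \<Omega>' (?B \<inter> G)"
        using measure_distr[OF \<Phi>m A[unfolded sets_P]] by (simp only: P_def[symmetric] pre)
      also have "\<dots> = measure ?\<Omega> (?B \<inter> G)"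
        unfolding \<Omega>'_def by (rule measure_restrict_space) (use G sets.sets_into_space[OF G] in blast)+
      also have "\<dots> = measure ?\<Omega> ?B"
      proof (rule measure_eq_AE)
        show "AE p in ?\<Omega>. p \<in> ?B \<inter> G \<longleftrightarrow> p \<in> ?B" using AE_G by eventually_elim blast
      qed (use B G in blast)+
      also have "\<dots> = pmf (chain_pmf (jump_semigroup K R) (ds t (Suc k)) z0) (map z [0..<Suc k])"
        using subordinated_law[OF M Zm Z0 lawZ nonneg, of "map z [0..<Suc k]"]
        by (simp only: measure_def enn2real_ennreal pmf_nonneg)
      finally show ?thesis .
    qed
    show ?thesis
      unfolding markov_chain_from_def
    proof (intro conjI exI[of _ "jump_semigroup K R"] allI impI ballI)
      show "prob_space P" by (rule P.prob_space_axioms)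
      show "(\<lambda>w. pr (w t)) \<in> measurable P (count_space UNIV)" for t by (rule prm)
      show "pr (w 0) = z0" "cadlag_path (\<lambda>t. pr (w t))" if "w \<in> space P" for w
        using \<Gamma> that by (auto simp: space_P)
      show "transition_semigroup q (jump_semigroup K R)" by (rule jump_semigroup_transition[OF R Q])
      fix k and z :: "nat \<Rightarrow> 's" and t :: "nat \<Rightarrow> real" assume t: "0 \<le> t 0 \<and> (\<forall>i\<le>k. t i \<le> t (Suc i))"
      have len: "length (map z [0..<Suc k]) = length (ds t (Suc k))" by (simp add: ds_def)
      have snoc: "ds t (Suc (Suc k)) = ds t (Suc k) @ [t (Suc k) - t k]" by (simp add: ds_def)
      have "measure P {w \<in> space P. \<forall>i\<le>Suc k. pr (w (t i)) = z i}
          = pmf (chain_pmf (jump_semigroup K R) (ds t (Suc k) @ [t (Suc k) - t k]) z0) (map z [0..<Suc k] @ [z (Suc k)])"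
        using fdd[of t "Suc k" z] t unfolding snoc by (simp add: less_Suc_eq_le)
      also have "\<dots> = pmf (chain_pmf (jump_semigroup K R) (ds t (Suc k)) z0) (map z [0..<Suc k])
          * pmf (jump_semigroup K R (t (Suc k) - t k) (last (z0 # map z [0..<Suc k]))) (z (Suc k))"
        by (rule pmf_chain_snoc[OF len])
      also have "last (z0 # map z [0..<Suc k]) = z k" by simp
      also have "pmf (chain_pmf (jump_semigroup K R) (ds t (Suc k)) z0) (map z [0..<Suc k])
          = measure P {w \<in> space P. \<forall>i\<le>k. pr (w (t i)) = z i}"
        using fdd[of t k z] t by simp
      finally show "measure P {w \<in> space P. \<forall>i\<le>Suc k. pr (w (t i)) = z i} =
           measure P {w \<in> space P. \<forall>i\<le>k. pr (w (t i)) = z i} *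
             pmf (jump_semigroup K R (t (Suc k) - t k) (z k)) (z (Suc k))" .
    qed
  qed
  have "markov_chain_from q x P (\<lambda>t w. fst (w t))"
    by (rule markov[OF X start(1) lawX]) (auto simp: \<Phi>_def \<Gamma>_def)
  moreover have "markov_chain_from q y P (\<lambda>t w. snd (w t))"
    by (rule markov[OF Y start(2) lawY]) (auto simp: \<Phi>_def \<Gamma>_def)
  \<comment> \<open>Every path in \<open>\<Gamma>\<close> merges, so the event is the whole space
    and its measurability is immediate.\<close>
  moreover have "{w \<in> space P. coupling_time (\<lambda>t w. fst (w t)) (\<lambda>t w. snd (w t)) w < \<infinity>} = space P"
  proof -
    have "coupling_time (\<lambda>t w. fst (w t)) (\<lambda>t w. snd (w t)) w < \<infinity>" if "w \<in> \<Gamma>" for w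
    proof -
      from that obtain T where T: "0 \<le> T" "\<forall>s\<ge>T. fst (w s) = snd (w s)" unfolding \<Gamma>_def by blast
      have "coupling_time (\<lambda>t w. fst (w t)) (\<lambda>t w. snd (w t)) w \<le> ereal T"
        unfolding coupling_time_def using T by (intro INF_lower) simp
      then show ?thesis by (rule le_less_trans) simp
    qed
    then show ?thesis unfolding space_P by blast
  qed
  ultimately show ?thesis using P.prob_space by (intro exI[of _ P]) simp
qed

section \<open>The inclusion process\<close>

definition shift_site :: "int ^ 'd \<Rightarrow> 'd \<times> int \<Rightarrow> int ^ 'd" where
  "shift_site u b = (\<chi> a. if a = fst b then u $ a + snd b else u $ a)"

text \<open>Integer vectors at distance 1 differ in exactly one coordinate, by 1 or -1, and this
  determines the direction.\<close>

lemma card_neighbour_direction: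
  fixes u v :: "int ^ 'd"
  shows "card {b \<in> UNIV \<times> {1, -1}. shift_site u b = v} = (if l1_norm (u - v) = 1 then 1 else 0)"
proof (cases "l1_norm (u - v) = 1")
  case True
  have "int (\<Sum>a\<in>UNIV. nat \<bar>(u - v) $ a\<bar>) = 1" using True by (simp add: l1_norm_def)
  then have "(\<Sum>a\<in>UNIV. nat \<bar>(u - v) $ a\<bar>) = 1" by linarith
  then obtain a where a: "nat \<bar>(u - v) $ a\<bar> = 1" "\<And>b. a \<noteq> b \<Longrightarrow> nat \<bar>(u - v) $ b\<bar> = 0"
    using sum_eq_1_iff[of UNIV "\<lambda>a. nat \<bar>(u - v) $ a\<bar>"] by auto
  have other: "u $ b = v $ b" if "b \<noteq> a" for b using a(2)[of b] that by auto
  have ua: "\<bar>u $ a - v $ a\<bar> = 1" using a(1) by simp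
  have "{b \<in> UNIV \<times> {1, -1}. shift_site u b = v} = {(a, v $ a - u $ a)}"
  proof (intro equalityI subsetI)
    fix b assume "b \<in> {b \<in> UNIV \<times> {1, -1}. shift_site u b = v}"
    then have b: "snd b \<in> {1, -1}" "shift_site u b = v" by auto
    have "v $ c = (if c = fst b then u $ c + snd b else u $ c)" for c
      unfolding b(2)[symmetric] by (simp add: shift_site_def)
    from this[of a] this[of "fst b"] have "fst b = a" "snd b = v $ a - u $ a"
      using ua b(1) other[of "fst b"] by (auto split: if_splits)
    then show "b \<in> {(a, v $ a - u $ a)}" by (cases b) auto
  next
    fix b assume b: "b \<in> {(a, v $ a - u $ a)}"
    have "v $ a - u $ a \<in> {1, -1}" using ua by auto
    then show "b \<in> {b \<in> UNIV \<times> {1, -1}. shift_site u b = v}"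
      using b other by (auto simp: shift_site_def vec_eq_iff)
  qed
  then show ?thesis using True by simp
next
  case False
  have "l1_norm (u - v) = 1" if "b \<in> UNIV \<times> {1, -1}" "shift_site u b = v" for b
  proof -
    have "l1_norm (u - v) = (\<Sum>a\<in>UNIV. if a = fst b then 1 else 0)"
      unfolding l1_norm_def that(2)[symmetric] using that(1)
      by (intro sum.cong) (auto simp: shift_site_def)
    then show ?thesis by simp
  qed
  with False have "{b \<in> UNIV \<times> {1, -1}. shift_site u b = v} = {}" by blast
  then show ?thesis using False by (simp only: card.empty if_False)
qed

text \<open>Flattens the system to one point of the lattice indexed by
  \<open>'n \<times> 'd\<close>, the state space of \<open>elliptic_walk\<close>.\<close>

definition coords :: "int ^ 'd ^ 'n \<Rightarrow> 'n \<times> 'd \<Rightarrow> int" where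
  "coords z c = z $ fst c $ snd c"

definition of_coords :: "('n \<times> 'd \<Rightarrow> int) \<Rightarrow> int ^ 'd ^ 'n" where
  "of_coords f = (\<chi> i. \<chi> a. f (i, a))"

lemma coords_of_coords [simp]: "coords (of_coords f) = f" "of_coords (coords z) = z"
  by (auto simp: coords_def of_coords_def fun_eq_iff vec_eq_iff)

definition step :: "int ^ 'd ^ 'n \<Rightarrow> ('n \<times> 'd) \<times> int \<Rightarrow> int ^ 'd ^ 'n" where
  "step z e = of_coords (move (coords z) e)"

definition target :: "int ^ 'd ^ 'n \<Rightarrow> ('n \<times> 'd) \<times> int \<Rightarrow> int ^ 'd" where
  "target z e = step z e $ fst (fst e)"

lemma step_nth: "step z e $ j = (if j = fst (fst e) then shift_site (z $ j) (snd (fst e), snd e) else z $ j)"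
  by (cases e) (auto simp: step_def of_coords_def coords_def move_def shift_site_def vec_eq_iff)

lemma step_eq_move_particle: "step z e = move_particle z (fst (fst e)) (target z e)"
  by (auto simp: vec_eq_iff move_particle_def target_def step_nth)

lemma step_opp [simp]: "step (step z e) (opp e) = z"
  by (simp add: step_def)

lemma target_ne: "e \<in> dirs \<Longrightarrow> target z e \<noteq> z $ fst (fst e)"
  by (auto simp: target_def step_nth shift_site_def dirs_def vec_eq_iff intro!: exI[of _ "snd (fst e)"])

lemma target_opp: "target (step z e) (opp e) = z $ fst (fst e)"
  by (simp add: target_def) (simp add: opp_def)

definition occ :: "int ^ 'd ^ 'n \<Rightarrow> int ^ 'd \<Rightarrow> nat" where
  "occ z x = card {j. z $ j = x}"

lemma occ_le: "occ (z :: int ^ 'd ^ 'n) x \<le> CARD('n)"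
  unfolding occ_def by (intro card_mono) auto

lemma occ_step:
  assumes "e \<in> dirs"
  shows "occ (step z e) (target z e) = Suc (occ z (target z e))"
    and "occ z (z $ fst (fst e)) = Suc (occ (step z e) (z $ fst (fst e)))"
    and "x \<noteq> target z e \<Longrightarrow> x \<noteq> z $ fst (fst e) \<Longrightarrow> occ (step z e) x = occ z x"
proof -
  let ?i = "fst (fst e)"
  note ne = target_ne[OF assms, of z]
  have st: "step z e $ j = (if j = ?i then target z e else z $ j)" for j
    by (simp add: step_eq_move_particle move_particle_def)
  have "{j. step z e $ j = target z e} = insert ?i {j. z $ j = target z e}"
    by (auto simp: st)
  then show "occ (step z e) (target z e) = Suc (occ z (target z e))"
    using ne by (simp add: occ_def)
  have "{j. z $ j = z $ ?i} = insert ?i {j. step z e $ j = z $ ?i}"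
    using ne by (auto simp: st)
  moreover have "?i \<notin> {j. step z e $ j = z $ ?i}" using ne by (simp add: st)
  ultimately show "occ z (z $ ?i) = Suc (occ (step z e) (z $ ?i))"
    by (simp add: occ_def)
  assume "x \<noteq> target z e" "x \<noteq> z $ ?i"
  then have "{j. step z e $ j = x} = {j. z $ j = x}" by (auto simp: st)
  then show "occ (step z e) x = occ z x" by (simp add: occ_def)
qed

text \<open>The reversible measure of the labelled process. In the unlabelled one each factor is
  divided by the factorial of the occupation number.\<close>

definition weight :: "real \<Rightarrow> int ^ 'd ^ 'n \<Rightarrow> real" where
  "weight m z = (\<Prod>x\<in>range (($) z). pochhammer (m / 2) (occ z x))"

lemma weight_superset:
  assumes "finite A" "range (($) z) \<subseteq> A"
  shows "weight m z = (\<Prod>x\<in>A. pochhammer (m / 2) (occ z x))"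
  unfolding weight_def
proof (rule prod.mono_neutral_left[OF assms])
  show "\<forall>x\<in>A - range (($) z). pochhammer (m / 2) (occ z x) = 1"
  proof
    fix x assume "x \<in> A - range (($) z)"
    then have "{j. z $ j = x} = {}" by auto
    then have "occ z x = 0" by (simp only: occ_def card.empty)
    then show "pochhammer (m / 2) (occ z x) = 1" by simp
  qed
qed

text \<open>Detailed balance: only the factors of two sites change, and
  \<open>pochhammer (m / 2) (Suc k)\<close> adds the factor \<open>m / 2 + k\<close>. For the
  reverse jump the old site is counted after the particle has left it.\<close>

lemma weight_step:
  fixes z :: "int ^ 'd ^ 'n"
  assumes "e \<in> dirs"
  shows "weight m (step z e) * (m / 2 + real (occ (step z e) (z $ fst (fst e))))
       = weight m z * (m / 2 + real (occ z (target z e)))"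
proof -
  define x y where "x = z $ fst (fst e)" and "y = target z e"
  define A where "A = range (($) z) \<union> range (($) (step z e)) \<union> {x, y}"
  let ?B = "A - {x} - {y}"
  have fin: "finite A" and sup: "range (($) z) \<subseteq> A" "range (($) (step z e)) \<subseteq> A" by (auto simp: A_def)
  have xy: "x \<in> A" "y \<in> A - {x}" using target_ne[OF assms, of z] by (auto simp: A_def x_def y_def)
  have dec: "(\<Prod>v\<in>A. f v) = f x * (f y * (\<Prod>v\<in>?B. f v))" for f :: "int ^ 'd \<Rightarrow> real"
    using fin xy by (simp add: prod.remove[of A x] prod.remove[of "A - {x}" y])
  let ?f = "\<lambda>z v. pochhammer (m / 2) (occ z v)"
  have rest: "(\<Prod>v\<in>?B. ?f (step z e) v) = (\<Prod>v\<in>?B. ?f z v)"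
    using occ_step(3)[OF assms, of _ z] by (intro prod.cong) (auto simp: x_def y_def)
  have ox: "occ z x = Suc (occ (step z e) x)" and oy: "occ (step z e) y = Suc (occ z y)"
    using occ_step(1,2)[OF assms, of z] by (auto simp: x_def y_def)
  have w1: "weight m z = ?f z x * (?f z y * (\<Prod>v\<in>?B. ?f z v))"
    using weight_superset[OF fin sup(1)] dec by simp
  have w2: "weight m (step z e) = ?f (step z e) x * (?f (step z e) y * (\<Prod>v\<in>?B. ?f z v))"
    using weight_superset[OF fin sup(2)] dec rest by simp
  show ?thesis unfolding w1 w2 x_def[symmetric] y_def[symmetric] ox oy
    by (simp add: pochhammer_Suc mult_ac)
qed

lemma weight_bounds:
  fixes z :: "int ^ 'd ^ 'n"
  assumes m: "0 < m"
  defines "n \<equiv> CARD('n)"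
  shows "(min 1 (m / 2) ^ n) ^ n \<le> weight m z" "weight m z \<le> ((1 + m / 2 + real n) ^ n) ^ n"
proof -
  let ?R = "range (($) z)"
  have card: "card ?R \<le> n" unfolding n_def by (rule card_image_le) simp
  have k: "occ z x \<le> n" for x unfolding n_def by (rule occ_le)
  have lo: "min 1 (m / 2) ^ n \<le> pochhammer (m / 2) (occ z x)" for x
  proof -
    have "min 1 (m / 2) ^ n \<le> min 1 (m / 2) ^ occ z x" using m k by (intro power_decreasing) auto
    also have "\<dots> = (\<Prod>i<occ z x. min 1 (m / 2))" by simp
    also have "\<dots> \<le> (\<Prod>i<occ z x. m / 2 + real i)" using m by (intro prod_mono) auto
    finally show ?thesis by (simp add: pochhammer_prod atLeast0LessThan)
  qed
  have hi: "pochhammer (m / 2) (occ z x) \<le> (1 + m / 2 + real n) ^ n" for x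
  proof -
    have "(\<Prod>i<occ z x. m / 2 + real i) \<le> (\<Prod>i<occ z x. 1 + m / 2 + real n)"
      using m k[of x] by (intro prod_mono) auto
    also have "\<dots> \<le> (1 + m / 2 + real n) ^ n" using m k by (simp add: power_increasing)
    finally show ?thesis by (simp add: pochhammer_prod atLeast0LessThan)
  qed
  have "(min 1 (m / 2) ^ n) ^ n \<le> (min 1 (m / 2) ^ n) ^ card ?R"
    using m card by (intro power_decreasing) (auto intro: power_le_one)
  also have "\<dots> = (\<Prod>x\<in>?R. min 1 (m / 2) ^ n)" by simp
  also have "\<dots> \<le> weight m z" unfolding weight_def using lo m by (intro prod_mono) auto
  finally show "(min 1 (m / 2) ^ n) ^ n \<le> weight m z" .
  have "weight m z \<le> (\<Prod>x\<in>?R. (1 + m / 2 + real n) ^ n)"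
    unfolding weight_def using hi m by (intro prod_mono) (auto intro: pochhammer_nonneg)
  also have "\<dots> = ((1 + m / 2 + real n) ^ n) ^ card ?R" by simp
  also have "\<dots> \<le> ((1 + m / 2 + real n) ^ n) ^ n"
    using m card by (intro power_increasing one_le_power) auto
  finally show "weight m z \<le> ((1 + m / 2 + real n) ^ n) ^ n" .
qed

section \<open>The lazy skeleton of the inclusion process\<close>

locale sip =
  fixes m :: real
  assumes m: "0 < m"
begin

text \<open>
  The acceptance probability is half of the largest one that keeps the rates proportional to those of
  the process, whence laziness; the clock then has rate \<open>2 n (m / 2 + n)\<close>.
\<close>

definition acc :: "int ^ 'd ^ 'n \<Rightarrow> ('n \<times> 'd) \<times> int \<Rightarrow> real" where
  "acc z e = (m / 2 + real (occ z (target z e))) / (2 * (m / 2 + real CARD('n)))"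

definition kernel :: "int ^ 'd ^ 'n \<Rightarrow> (int ^ 'd ^ 'n) pmf" where
  "kernel z = bind_pmf (pmf_of_set dirs)
     (\<lambda>e. map_pmf (\<lambda>b. if b then step z e else z) (bernoulli_pmf (acc z e)))"

definition jump :: "int ^ 'd ^ 'n \<Rightarrow> ('n \<times> 'd) \<times> int \<Rightarrow> real" where
  "jump z e = acc z e / (2 * real CARD('n) * real CARD('d))"

lemma acc:
  fixes z :: "int ^ 'd ^ 'n"
  shows "0 < acc z e" "acc z e \<le> 1 / 2"
proof -
  have "real (occ z (target z e)) \<le> real CARD('n)" using occ_le[of z "target z e"] by simp
  then show "acc z e \<le> 1 / 2" using m zero_less_card_finite by (simp add: acc_def field_simps)
  show "0 < acc z e" using m zero_less_card_finite by (auto simp: acc_def intro!: divide_pos_pos add_pos_nonneg)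
qed

lemma card_dirs: "card (dirs :: (('n \<times> 'd) \<times> int) set) = 2 * CARD('n) * CARD('d)"
  by (simp add: dirs_def card_cartesian_product)

lemma dirs_ne: "(dirs :: (('n \<times> 'd) \<times> int) set) \<noteq> {}"
  by (auto simp: dirs_def)

lemma expectation_kernel:
  fixes z :: "int ^ 'd ^ 'n"
  shows "measure_pmf.expectation (kernel z) h = h z + (\<Sum>e\<in>dirs. jump z e * (h (step z e) - h z))"
proof -
  have "measure_pmf.expectation (kernel z) h
     = (\<Sum>e\<in>dirs. pmf (pmf_of_set dirs) e *\<^sub>R measure_pmf.expectation
         (map_pmf (\<lambda>b. if b then step z e else z) (bernoulli_pmf (acc z e))) h)"
    unfolding kernel_def by (rule pmf_expectation_bind) (simp_all add: set_pmf_of_set[OF dirs_ne finite_dirs])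
  also have "\<dots> = (\<Sum>e\<in>dirs. 1 / (2 * real CARD('n) * real CARD('d)) * (acc z e * h (step z e) + (1 - acc z e) * h z))"
  proof (rule sum.cong[OF refl])
    fix e :: "('n \<times> 'd) \<times> int" assume "e \<in> dirs"
    moreover have "0 \<le> acc z e" "acc z e \<le> 1" using acc[of z e] by auto
    ultimately show "pmf (pmf_of_set dirs) e *\<^sub>R measure_pmf.expectation
         (map_pmf (\<lambda>b. if b then step z e else z) (bernoulli_pmf (acc z e))) h
       = 1 / (2 * real CARD('n) * real CARD('d)) * (acc z e * h (step z e) + (1 - acc z e) * h z)"
      by (simp add: pmf_of_set[OF dirs_ne finite_dirs] card_dirs mult.commute)
  qed
  also have "\<dots> = (\<Sum>e\<in>dirs. 1 / (2 * real CARD('n) * real CARD('d)) * h z + jump z e * (h (step z e) - h z))"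
    by (intro sum.cong refl) (simp add: jump_def field_simps)
  also have "\<dots> = h z + (\<Sum>e\<in>dirs. jump z e * (h (step z e) - h z))"
    by (simp add: sum.distrib card_dirs)
  finally show ?thesis .
qed

lemma finite_kernel:
  fixes z :: "int ^ 'd ^ 'n"
  shows "finite (set_pmf (kernel z))"
  unfolding kernel_def by (simp add: set_pmf_of_set[OF dirs_ne finite_dirs])

lemma kern_op_kernel:
  fixes z :: "int ^ 'd ^ 'n"
  shows "kern_op kernel h z = h z + (\<Sum>e\<in>dirs. jump z e * (h (step z e) - h z))"
  unfolding expectation_kernel[symmetric] kern_op_def
  by (subst integral_measure_pmf[OF finite_kernel]) auto

lemma pmf_kernel:
  fixes z :: "int ^ 'd ^ 'n"
  shows "pmf (kernel z) y = indicator {y} z + (\<Sum>e\<in>dirs. jump z e * (indicator {y} (step z e) - indicator {y} z))"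
  unfolding expectation_kernel[symmetric] by (simp add: measure_pmf_single)

lemma sum_jump_le:
  fixes z :: "int ^ 'd ^ 'n"
  shows "(\<Sum>e\<in>dirs. jump z e) \<le> 1 / 2"
proof -
  have "(\<Sum>e\<in>dirs. jump z e) \<le> (\<Sum>e\<in>(dirs :: (('n \<times> 'd) \<times> int) set). 1 / 2 / (2 * real CARD('n) * real CARD('d)))"
    unfolding jump_def using acc(2) by (intro sum_mono divide_right_mono) auto
  also have "\<dots> = 1 / 2" by (simp add: card_dirs)
  finally show ?thesis .
qed

lemma jump_nonneg:
  fixes z :: "int ^ 'd ^ 'n"
  shows "0 \<le> jump z e"
  using acc(1)[of z e] by (simp add: jump_def)

lemma lazy_kernel:
  fixes z :: "int ^ 'd ^ 'n"
  shows "1 / 2 \<le> pmf (kernel z) z"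
proof -
  have "- (\<Sum>e\<in>dirs. jump z e) \<le> (\<Sum>e\<in>dirs. jump z e * (indicator {z} (step z e) - indicator {z} z))"
    unfolding sum_negf[symmetric]
    by (intro sum_mono) (auto simp: indicator_def jump_nonneg)
  then show ?thesis unfolding pmf_kernel using sum_jump_le[of z] by simp
qed

text \<open>A step \<open>s\<close> changes the square of a coordinate \<open>x\<close> by
  \<open>2 * s * x + 1\<close>. In the linear term the constant part of the rate cancels between
  opposite directions and the attraction is nonpositive; the ones add up to the jump probability, at
  most 1/2.\<close>

lemma drift_bound:
  fixes z :: "int ^ 'd ^ 'n"
  shows "(\<Sum>e\<in>dirs. jump z e * real_of_int ((coords (step z e) (fst e))\<^sup>2 - (coords z (fst e))\<^sup>2)) \<le> 1 / 2"
proof -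
  define k where "k = 1 / (2 * real CARD('n) * real CARD('d)) / (2 * (m / 2 + real CARD('n)))"
  have k: "0 \<le> k" using m by (simp add: k_def)
  let ?D = "dirs :: (('n \<times> 'd) \<times> int) set"
  let ?x = "\<lambda>e :: ('n \<times> 'd) \<times> int. real_of_int (z $ fst (fst e) $ snd (fst e))"
  let ?hit = "\<lambda>e j. if z $ j = target z e then 1 else 0 :: real"
  have jump: "jump z e = k * (m / 2) + k * (\<Sum>j\<in>UNIV. ?hit e j)" for e
  proof -
    have "(\<Sum>j\<in>UNIV. ?hit e j) = real (occ z (target z e))"
      by (simp add: occ_def flip: sum.inter_filter)
    then show ?thesis unfolding jump_def acc_def k_def distrib_left[symmetric] by (simp add: mult_ac)
  qed
  have sq: "real_of_int ((coords (step z e) (fst e))\<^sup>2 - (coords z (fst e))\<^sup>2)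
      = 2 * real_of_int (snd e) * ?x e + 1" if "e \<in> dirs" for e
  proof -
    have "coords (step z e) (fst e) = z $ fst (fst e) $ snd (fst e) + snd e"
      by (simp add: coords_def step_nth shift_site_def)
    moreover have "(snd e)\<^sup>2 = 1" using that by (auto simp: dirs_def)
    ultimately show ?thesis by (simp add: coords_def power2_sum algebra_simps flip: of_int_power)
  qed
  have free: "(\<Sum>e\<in>?D. real_of_int (snd e) * ?x e) = 0"
  proof -
    have "(\<Sum>e\<in>?D. real_of_int (snd e) * ?x e) = (\<Sum>e\<in>?D. real_of_int (snd (opp e)) * ?x (opp e))"
      by (rule sum.reindex_bij_witness[where i = opp and j = opp]) auto
    also have "\<dots> = - (\<Sum>e\<in>?D. real_of_int (snd e) * ?x e)"
      by (simp add: opp_def sum_negf)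
    finally show ?thesis by simp
  qed
  have attract: "(\<Sum>e\<in>?D. \<Sum>j\<in>UNIV. real_of_int (snd e) * ?x e * ?hit e j) \<le> 0"
  proof -
    \<comment> \<open>\<open>?r\<close> exchanges the jump of \<open>i\<close> onto \<open>j\<close>
      with the opposite jump of \<open>j\<close> onto \<open>i\<close>. If their coordinates are
      \<open>x\<close> and \<open>x + s\<close>, the two together contribute
      \<open>s * x - s * (x + s) = - 1\<close>.\<close>
    let ?r = "\<lambda>((e :: ('n \<times> 'd) \<times> int), j :: 'n). (((j, snd (fst e)), - snd e), fst (fst e))"
    let ?f = "\<lambda>p. real_of_int (snd (fst p)) * ?x (fst p) * ?hit (fst p) (snd p)"
    have hit: "?hit e j = ?hit ((j, snd (fst e)), - snd e) (fst (fst e))" for e j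
      by (auto simp: target_def step_nth shift_site_def vec_eq_iff)
    have "(\<Sum>p\<in>?D \<times> UNIV. ?f p) = (\<Sum>p\<in>?D \<times> UNIV. ?f (?r p))"
      by (rule sum.reindex_bij_witness[where i = ?r and j = ?r]) (auto simp: dirs_def)
    then have "2 * (\<Sum>p\<in>?D \<times> UNIV. ?f p) = (\<Sum>p\<in>?D \<times> UNIV. ?f p + ?f (?r p))"
      by (simp add: sum.distrib)
    also have "\<dots> \<le> 0"
    proof (rule sum_nonpos)
      fix p assume p: "p \<in> ?D \<times> (UNIV :: 'n set)"
      obtain i a s j where pe: "p = (((i, a), s), j)" by (metis surj_pair)
      have s: "s = 1 \<or> s = -1" using p by (auto simp: pe dirs_def)
      show "?f p + ?f (?r p) \<le> 0"
      proof (cases "z $ j = target z ((i, a), s)")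
        case True
        then have "z $ j $ a = z $ i $ a + s" by (simp add: target_def step_nth shift_site_def)
        moreover have "?hit ((j, a), - s) i = 1" using hit[of j "((i, a), s)"] True by simp
        ultimately show ?thesis using True s by (auto simp: pe algebra_simps)
      next
        case False
        moreover have "?hit ((j, a), - s) i = 0" using hit[of j "((i, a), s)"] False by simp
        ultimately show ?thesis by (simp add: pe)
      qed
    qed
    finally show ?thesis by (simp add: sum.cartesian_product split_def)
  qed
  have "(\<Sum>e\<in>?D. jump z e * real_of_int ((coords (step z e) (fst e))\<^sup>2 - (coords z (fst e))\<^sup>2))
      = (\<Sum>e\<in>?D. jump z e + 2 * (jump z e * (real_of_int (snd e) * ?x e)))"
    by (rule sum.cong[OF refl]) (subst sq, assumption, simp add: distrib_left)
  also have "\<dots> = (\<Sum>e\<in>?D. jump z e) + 2 * (\<Sum>e\<in>?D. jump z e * (real_of_int (snd e) * ?x e))"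
    by (simp add: sum.distrib sum_distrib_left)
  also have "(\<Sum>e\<in>?D. jump z e * (real_of_int (snd e) * ?x e))
      = k * (m / 2) * (\<Sum>e\<in>?D. real_of_int (snd e) * ?x e)
        + k * (\<Sum>e\<in>?D. \<Sum>j\<in>UNIV. real_of_int (snd e) * ?x e * ?hit e j)"
    unfolding jump by (simp add: algebra_simps sum.distrib sum_distrib_left sum_distrib_right)
  also have "\<dots> \<le> 0" using mult_nonneg_nonpos[OF k attract] by (simp add: free)
  finally show ?thesis using sum_jump_le[of z] by linarith
qed

text \<open>The ellipticity constant is the probability of a jump onto an empty site, the smallest
  one.\<close>

lemma elliptic: "elliptic_walk (\<lambda>f e. jump (of_coords f) e) (\<lambda>f. weight m (of_coords f :: int ^ 'd ^ 'n))
   (m / 2 / (2 * (m / 2 + real CARD('n))) / (2 * real CARD('n) * real CARD('d))) ((min 1 (m / 2) ^ CARD('n)) ^ CARD('n))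
   (((1 + m / 2 + real CARD('n)) ^ CARD('n)) ^ CARD('n)) (1 / 2)"
proof
  show "0 < m / 2 / (2 * (m / 2 + real CARD('n))) / (2 * real CARD('n) * real CARD('d))" using m by simp
  show "m / 2 / (2 * (m / 2 + real CARD('n))) / (2 * real CARD('n) * real CARD('d)) \<le> jump (of_coords f) e" for f :: "'n \<times> 'd \<Rightarrow> int" and e
    unfolding jump_def acc_def using m by (intro divide_right_mono) auto
  show "(\<Sum>e\<in>dirs. jump (of_coords f) e) \<le> 1 / 2" for f by (rule sum_jump_le)
  fix f and e :: "('n \<times> 'd) \<times> int" assume e: "e \<in> dirs"
  have st: "of_coords (move f e) = step (of_coords f) e" by (simp add: step_def)
  show "weight m (of_coords (move f e)) * jump (of_coords (move f e)) (opp e) = weight m (of_coords f) * jump (of_coords f) e"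
    unfolding st jump_def acc_def target_opp
    using weight_step[OF e, of m "of_coords f"] by (simp add: field_simps)
next
  show "0 < (min 1 (m / 2) ^ CARD('n)) ^ CARD('n)" using m by simp
  show "(min 1 (m / 2) ^ CARD('n)) ^ CARD('n) \<le> weight m (of_coords f :: int ^ 'd ^ 'n)"
    "weight m (of_coords f :: int ^ 'd ^ 'n) \<le> ((1 + m / 2 + real CARD('n)) ^ CARD('n)) ^ CARD('n)" for f
    by (rule weight_bounds[OF m])+
  show "(\<Sum>e\<in>dirs. jump (of_coords f) e * real_of_int ((move f e (fst e))\<^sup>2 - (f (fst e))\<^sup>2)) \<le> 1 / 2" for f
    using drift_bound[of "of_coords f"] by (simp add: step_def)
qed

lemma liouville_kernel:
  fixes h :: "int ^ 'd ^ 'n \<Rightarrow> real"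
  assumes h: "\<And>x. kern_op kernel h x = h x" and bdd: "\<And>x. \<bar>h x\<bar> \<le> 1"
  shows "h x = h y"
proof -
  interpret E: elliptic_walk "\<lambda>f e. jump (of_coords f) e" "\<lambda>f. weight m (of_coords f :: int ^ 'd ^ 'n)"
   "m / 2 / (2 * (m / 2 + real CARD('n))) / (2 * real CARD('n) * real CARD('d))" "(min 1 (m / 2) ^ CARD('n)) ^ CARD('n)"
   "((1 + m / 2 + real CARD('n)) ^ CARD('n)) ^ CARD('n)" "1 / 2"
    by (rule elliptic)
  have "E.K (\<lambda>f. h (of_coords f)) f = h (of_coords f)" for f
    using h[of "of_coords f"] unfolding E.K_def kern_op_kernel by (simp add: step_def)
  then have "h (of_coords (coords x)) = h (of_coords (coords y))"
    using bdd by (intro E.liouville[where h = "\<lambda>f. h (of_coords f)" and B = 1]) auto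
  then show ?thesis by simp
qed

lemma lazy_liouville: "lazy_liouville_kernel (kernel :: int ^ 'd ^ 'n \<Rightarrow> _)"
  by (rule lazy_liouville_kernel.intro) (rule finite_kernel lazy_kernel liouville_kernel; assumption)+

text \<open>Both sides are sums over the particle that moves. The clock rate cancels the
  normalisation of \<open>jump\<close> up to \<open>1 / (2 * d)\<close>, and the sum over directions
  counts those that lead from \<open>x $ i\<close> to \<open>y $ i\<close>, one or none.\<close>

lemma sip_rate_kernel:
  fixes x y :: "int ^ 'd ^ 'n"
  assumes "x \<noteq> y"
  shows "sip_rate m x y = (2 * real CARD('n) * (m / 2 + real CARD('n))) * pmf (kernel x) y"
proof -
  \<comment> \<open>Nonzero only if moving particle \<open>i\<close> alone turns \<open>x\<close>
    into \<open>y\<close>.\<close>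
  define a where "a i = (if y = move_particle x i (y $ i) then m / 2 + real (card {j. x $ j = y $ i}) else 0)" for i
  have eq: "step x ((i, b1), b2) = y \<longleftrightarrow> y = move_particle x i (y $ i) \<and> shift_site (x $ i) (b1, b2) = y $ i"
    for i b1 b2
    by (auto simp: vec_eq_iff step_nth move_particle_def)
  have "(2 * real CARD('n) * (m / 2 + real CARD('n))) * pmf (kernel x) y = (\<Sum>e\<in>dirs. (2 * real CARD('n) * (m / 2 + real CARD('n))) * (jump x e * indicator {y} (step x e)))"
  proof -
    have "pmf (kernel x) y = (\<Sum>e\<in>dirs. jump x e * indicator {y} (step x e))"
      unfolding pmf_kernel using assms by (simp add: indicator_def)
    then show ?thesis by (simp only: sum_distrib_left)
  qed
  also have "\<dots> = (\<Sum>e\<in>UNIV \<times> {1, -1}. if step x e = y then 1 / (2 * real CARD('d)) * a (fst (fst e)) else 0)"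
    unfolding dirs_def
  proof (rule sum.cong[OF refl])
    fix e :: "('n \<times> 'd) \<times> int"
    have "step x e = y \<Longrightarrow> a (fst (fst e)) = m / 2 + real (occ x (target x e))"
      using eq[of "fst (fst e)" "snd (fst e)" "snd e"] by (auto simp: a_def occ_def target_def)
    moreover have "(2 * real CARD('n) * (m / 2 + real CARD('n))) * jump x e = 1 / (2 * real CARD('d)) * (m / 2 + real (occ x (target x e)))"
    proof -
      have cancel: "2 * N * u * (X / (2 * u) / (2 * N * D)) = 1 / (2 * D) * X"
        if "N \<noteq> 0" "u \<noteq> 0" "D \<noteq> 0" for N u D X :: real
        using that by (simp add: field_simps)
      have "m / 2 + real CARD('n) \<noteq> 0" using m by (simp add: add_pos_nonneg less_imp_neq[symmetric])
      then show ?thesis unfolding jump_def acc_def by (intro cancel) auto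
    qed
    ultimately show "(2 * real CARD('n) * (m / 2 + real CARD('n))) * (jump x e * indicator {y} (step x e)) = (if step x e = y then 1 / (2 * real CARD('d)) * a (fst (fst e)) else 0)"
      by (auto simp: indicator_def)
  qed
  also have "\<dots> = (\<Sum>p\<in>UNIV \<times> (UNIV \<times> {1, -1}). if shift_site (x $ fst p) (snd p) = y $ fst p then 1 / (2 * real CARD('d)) * a (fst p) else 0)"
  proof (rule sum.reindex_bij_witness[where i = "\<lambda>(i, b). ((i, fst b), snd b)" and j = "\<lambda>e. (fst (fst e), (snd (fst e), snd e))"])
    fix e :: "('n \<times> 'd) \<times> int"
    show "(if shift_site (x $ fst (fst (fst e), (snd (fst e), snd e))) (snd (fst (fst e), (snd (fst e), snd e))) = y $ fst (fst (fst e), (snd (fst e), snd e))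
        then 1 / (2 * real CARD('d)) * a (fst (fst (fst e), (snd (fst e), snd e))) else 0)
        = (if step x e = y then 1 / (2 * real CARD('d)) * a (fst (fst e)) else 0)"
      using eq[of "fst (fst e)" "snd (fst e)" "snd e"] by (auto simp: a_def)
  qed auto
  also have "\<dots> = (\<Sum>i\<in>UNIV. \<Sum>b\<in>UNIV \<times> {1, -1}. if shift_site (x $ i) b = y $ i then 1 / (2 * real CARD('d)) * a i else 0)"
    unfolding sum.cartesian_product by (simp add: split_def)
  also have "\<dots> = (\<Sum>i\<in>UNIV. nn_kernel (x $ i) (y $ i) * a i)"
  proof (rule sum.cong[OF refl])
    fix i
    have "(\<Sum>b\<in>UNIV \<times> {1, -1}. if shift_site (x $ i) b = y $ i then 1 / (2 * real CARD('d)) * a i else 0)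
        = real (card {b \<in> UNIV \<times> {1, -1}. shift_site (x $ i) b = y $ i}) * (1 / (2 * real CARD('d)) * a i)"
      by (subst sum.inter_filter[symmetric]) auto
    then show "(\<Sum>b\<in>UNIV \<times> {1, -1}. if shift_site (x $ i) b = y $ i then 1 / (2 * real CARD('d)) * a i else 0)
        = nn_kernel (x $ i) (y $ i) * a i"
      unfolding card_neighbour_direction by (simp add: nn_kernel_def)
  qed
  also have "\<dots> = sip_rate m x y"
    unfolding sip_rate_def particle_jump_rate_def a_def
    by (rule sum.mono_neutral_cong_right) auto
  finally show ?thesis by simp
qed

text \<open>On the diagonal, the rates out of \<open>x\<close> add up to the clock rate times the
  probability of not staying; the finite support of the kernel makes the sum finite.\<close>

lemma Q_matrix_sip:
  fixes x y :: "int ^ 'd ^ 'n"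
  shows "Q_matrix (sip_rate m) x y = (2 * real CARD('n) * (m / 2 + real CARD('n))) * (pmf (kernel x) y - (if x = y then 1 else 0))"
proof (cases "x = y")
  case True
  let ?S = "set_pmf (kernel x)"
  have x: "x \<in> ?S" using lazy_kernel[of x] by (auto simp: set_pmf_iff)
  have "(\<Sum>\<^sub>\<infinity>z\<in>UNIV - {x}. sip_rate m x z) = (\<Sum>\<^sub>\<infinity>z\<in>?S - {x}. (2 * real CARD('n) * (m / 2 + real CARD('n))) * pmf (kernel x) z)"
    by (rule infsum_cong_neutral) (auto simp: sip_rate_kernel set_pmf_iff)
  also have "\<dots> = (2 * real CARD('n) * (m / 2 + real CARD('n))) * (\<Sum>z\<in>?S - {x}. pmf (kernel x) z)"
    using finite_kernel[of x] by (simp add: infsum_finite sum_distrib_left)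
  also have "(\<Sum>z\<in>?S - {x}. pmf (kernel x) z) = 1 - pmf (kernel x) x"
    using sum.remove[OF finite_kernel x, of "pmf (kernel x)"] sum_pmf_eq_1[OF finite_kernel order_refl, of x] by simp
  finally show ?thesis using True by (simp add: Q_matrix_def algebra_simps)
qed (simp add: Q_matrix_def sip_rate_kernel)

end

theorem theorem3p1:
  fixes m :: real and x y :: "int ^ 'd ^ 'n"
  assumes "m > 0"
  shows "\<exists>P :: (real \<Rightarrow> (int ^ 'd ^ 'n) \<times> (int ^ 'd ^ 'n)) measure.
    sip_coupling m x y P (\<lambda>t \<omega>. fst (\<omega> t)) (\<lambda>t \<omega>. snd (\<omega> t)) \<and>
    measure P {\<omega> \<in> space P.
      coupling_time (\<lambda>t \<omega>. fst (\<omega> t)) (\<lambda>t \<omega>. snd (\<omega> t)) \<omega> < \<infinity>} = 1"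
proof -
  interpret sip m by standard (rule assms)
  interpret L: lazy_liouville_kernel "kernel :: int ^ 'd ^ 'n \<Rightarrow> (int ^ 'd ^ 'n) pmf"
    by (rule lazy_liouville)
  obtain M :: "(nat \<Rightarrow> (int ^ 'd ^ 'n) list \<times> (int ^ 'd ^ 'n) list) measure" and X Y where
    M: "prob_space M" "\<forall>k. X k \<in> measurable M (count_space UNIV)" "\<forall>k. Y k \<in> measurable M (count_space UNIV)"
      "\<forall>\<omega>. X 0 \<omega> = x" "\<forall>\<omega>. Y 0 \<omega> = y"
      "\<forall>k. distr M (count_space UNIV) (\<lambda>\<omega>. map (\<lambda>i. X i \<omega>) [1..<Suc k]) = measure_pmf (path_pmf kernel k x)"
      "\<forall>k. distr M (count_space UNIV) (\<lambda>\<omega>. map (\<lambda>i. Y i \<omega>) [1..<Suc k]) = measure_pmf (path_pmf kernel k y)"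
      "AE \<omega> in M. \<exists>k0. \<forall>k\<ge>k0. X k \<omega> = Y k \<omega>"
    using L.exists_discrete_coupling[of x y] by (elim exE conjE) (rule that)
  have "0 < 2 * real CARD('n) * (m / 2 + real CARD('n))" using assms by simp
  from coupling_from_skeleton[OF this Q_matrix_sip M(1) M(2-7)[rule_format] M(8)]
  show ?thesis unfolding sip_coupling_def conj_assoc .
qed

end
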